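(* Let $K\subset\mathbb{R}^2$ be a fractal gasket. If $K$ is totally disconnected, then $\dim_C K=0$. If $K$ has a connected component consisting of more than one point, then $\dim_C K=1$.
   Context: Let $\triangle\subset\mathbb{R}^2$ be the (solid) regular triangle with vertices $a_1=(0,0)$, $a_2=(1,0)$, $a_3=(1/2,\sqrt3/2)$. Let $r_1,\dots,r_N\in(0,1)$, $d_1,\dots,d_N\in\mathbb{R}^2$, and $f_i(z)=r_i(z+d_i)$. The attractor $K$ of the IFS $F=\{f_i\}_{i=1}^N$ (the unique nonempty compact set with $K=\bigcup_i f_i(K)$) is called a fractal gasket if (i) $\bigcup_{i=1}^N f_i(\triangle)\subset\triangle$; (ii) for any $i\ne j$, $f_i(\triangle)$ and $f_j(\triangle)$ can only intersect at their vertices. $K$ carries the Euclidean metric. A homeomorphism $h:(X,d_X)\to(Y,d_Y)$ is quasisymmetric if there is an increasing homeomorphism $\eta:[0,\infty)\to[0,\infty)$ such that for all $x,y,z\in X$ and $t\ge0$, $d_X(x,y)\le t\,d_X(x,z)$ implies $d_Y(h(x),h(y))\le\eta(t)\,d_Y(h(x),h(z))$. The conformal dimension $\dim_C(X,d_X)$ is the infimum of the Hausdorff dimensions of all metric spaces $(Y,d_Y)$ that are the image of $(X,d_X)$ under a quasisymmetric homeomorphism. *)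

theory Defs
  imports "HOL-Analysis.Analysis"
begin

section \<open>Hausdorff dimension of a metric space\<close>

definition mdiam :: "'a metric \<Rightarrow> 'a set \<Rightarrow> ennreal" where
  "mdiam m U = (SUP x\<in>U. SUP y\<in>U. ennreal (mdist m x y))"

text \<open>The summand \<open>(diam U)\<^sup>s\<close>, with the conventions that the empty set contributes \<open>0\<close> and that
  \<open>0\<^sup>0 = 1\<close> (whereas \<open>0 powr 0 = 0\<close> in HOL). It is only used for sets of finite diameter.\<close>

definition hausdorff_gauge :: "'a metric \<Rightarrow> real \<Rightarrow> 'a set \<Rightarrow> ennreal" where
  "hausdorff_gauge m s U =
     (if U = {} then 0 else if s = 0 then 1 else ennreal (enn2real (mdiam m U) powr s))"

definition hausdorff_premeasure :: "'a metric \<Rightarrow> real \<Rightarrow> real \<Rightarrow> 'a set \<Rightarrow> ennreal" where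
  "hausdorff_premeasure m s \<delta> A =
     (INF U \<in> {U :: nat \<Rightarrow> 'a set. (\<forall>i. U i \<subseteq> mspace m \<and> mdiam m (U i) \<le> ennreal \<delta>) \<and> A \<subseteq> (\<Union>i. U i)}.
        \<Sum>i. hausdorff_gauge m s (U i))"

definition hausdorff_measure :: "'a metric \<Rightarrow> real \<Rightarrow> 'a set \<Rightarrow> ennreal" where
  "hausdorff_measure m s A = (SUP \<delta>\<in>{0<..}. hausdorff_premeasure m s \<delta> A)"

definition hausdorff_dim :: "'a metric \<Rightarrow> ennreal" where
  "hausdorff_dim m = (INF s \<in> {s. 0 \<le> s \<and> hausdorff_measure m s (mspace m) = 0}. ennreal s)"


section \<open>Quasisymmetric maps and conformal dimension\<close>

definition quasisymmetric_map :: "'a metric \<Rightarrow> 'b metric \<Rightarrow> ('a \<Rightarrow> 'b) \<Rightarrow> bool" where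
  "quasisymmetric_map m m' h \<longleftrightarrow>
     homeomorphic_map (mtopology_of m) (mtopology_of m') h \<and>
     (\<exists>\<eta> \<eta>' :: real \<Rightarrow> real. homeomorphism {0..} {0..} \<eta> \<eta>' \<and> strict_mono_on {0..} \<eta> \<and>
        (\<forall>x\<in>mspace m. \<forall>y\<in>mspace m. \<forall>z\<in>mspace m. \<forall>t\<ge>0.
           mdist m x y \<le> t * mdist m x z \<longrightarrow>
           mdist m' (h x) (h y) \<le> \<eta> t * mdist m' (h x) (h z)))"

text \<open>HOL cannot quantify over the carrier types of all metric spaces inside a term. Since a
  quasisymmetric image is in bijection with the original space, it is isometric to a metric space
  carried by the same type, so letting the metric range over \<open>'a metric\<close> loses nothing; see
  \<open>conformal_dim_le\<close> below, in which the image has an arbitrary carrier type.\<close>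

definition conformal_dim :: "'a metric \<Rightarrow> ennreal" where
  "conformal_dim m = (INF m' \<in> {m' :: 'a metric. \<exists>h. quasisymmetric_map m m' h}. hausdorff_dim m')"

lemma hausdorff_dim_isometric_le:
  fixes n :: "'a metric" and m' :: "'b metric"
  assumes h: "bij_betw h (mspace n) (mspace m')"
    and iso: "\<And>x y. x \<in> mspace n \<Longrightarrow> y \<in> mspace n \<Longrightarrow> mdist m' (h x) (h y) = mdist n x y"
  shows "hausdorff_dim n \<le> hausdorff_dim m'"
proof -
  define P where "P U = {x \<in> mspace n. h x \<in> U}" for U
  have hP: "h ` P U = U" if "U \<subseteq> mspace m'" for U
    using that h by (auto simp: P_def bij_betw_def image_iff)
  have Psub: "P U \<subseteq> mspace n" for U
    by (auto simp: P_def)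
  have diam: "mdiam n (P U) = mdiam m' U" if "U \<subseteq> mspace m'" for U
  proof -
    have "mdiam m' U = mdiam m' (h ` P U)"
      using hP that by simp
    also have "\<dots> = (SUP x\<in>P U. SUP y\<in>P U. ennreal (mdist m' (h x) (h y)))"
      by (simp add: mdiam_def image_image)
    also have "\<dots> = mdiam n (P U)"
      unfolding mdiam_def using iso Psub[of U] by (intro SUP_cong refl) (auto simp: subset_iff)
    finally show ?thesis ..
  qed
  have gauge: "hausdorff_gauge n s (P U) = hausdorff_gauge m' s U" if "U \<subseteq> mspace m'" for s U
    using diam[OF that] hP[OF that] by (auto simp: hausdorff_gauge_def)
  have pre: "hausdorff_premeasure n s \<delta> (mspace n) \<le> hausdorff_premeasure m' s \<delta> (mspace m')" for s \<delta>
    unfolding hausdorff_premeasure_def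
  proof (rule INF_mono, safe)
    fix U :: "nat \<Rightarrow> 'b set"
    assume U: "\<forall>i. U i \<subseteq> mspace m' \<and> mdiam m' (U i) \<le> ennreal \<delta>" "mspace m' \<subseteq> (\<Union>i. U i)"
    have "mspace n \<subseteq> (\<Union>i. P (U i))"
      using U(2) h by (force simp: P_def bij_betw_def)
    then show "\<exists>V\<in>{V. (\<forall>i. V i \<subseteq> mspace n \<and> mdiam n (V i) \<le> ennreal \<delta>) \<and> mspace n \<subseteq> (\<Union>i. V i)}.
        (\<Sum>i. hausdorff_gauge n s (V i)) \<le> (\<Sum>i. hausdorff_gauge m' s (U i))"
      using U(1) Psub diam gauge by (intro bexI[of _ "\<lambda>i. P (U i)"]) auto
  qed
  have "hausdorff_measure n s (mspace n) \<le> hausdorff_measure m' s (mspace m')" for s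
    unfolding hausdorff_measure_def by (intro SUP_mono) (use pre in auto)
  then have "{s. 0 \<le> s \<and> hausdorff_measure m' s (mspace m') = 0}
      \<subseteq> {s. 0 \<le> s \<and> hausdorff_measure n s (mspace n) = 0}"
    by (auto simp flip: le_zero_eq intro: order_trans)
  then show ?thesis
    unfolding hausdorff_dim_def by (intro INF_superset_mono) auto
qed

theorem conformal_dim_le:
  fixes m :: "'a metric" and m' :: "'b metric"
  assumes q: "quasisymmetric_map m m' h"
  shows "conformal_dim m \<le> hausdorff_dim m'"
proof -
  have hom: "homeomorphic_map (mtopology_of m) (mtopology_of m') h"
    using q by (simp add: quasisymmetric_map_def)
  then have bij: "bij_betw h (mspace m) (mspace m')"
    by (metis bij_betw_def homeomorphic_imp_injective_map homeomorphic_imp_surjective_map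
        topspace_mtopology_of)
  define d where "d x y = mdist m' (h x) (h y)" for x y
  have hin: "h x \<in> mspace m'" if "x \<in> mspace m" for x
    using bij that by (auto simp: bij_betw_def)
  interpret N: Metric_space "mspace m" d
  proof
    show "0 \<le> d x y" for x y by (simp add: d_def)
    show "d x y = d y x" for x y by (simp add: d_def mdist_commute)
    show "d x y = 0 \<longleftrightarrow> x = y" if "x \<in> mspace m" "y \<in> mspace m" for x y
      using bij hin that by (auto simp: d_def bij_betw_def inj_on_def)
    show "d x z \<le> d x y + d y z" if "x \<in> mspace m" "y \<in> mspace m" "z \<in> mspace m" for x y z
      using hin that by (simp add: d_def mdist_triangle)
  qed
  define n where "n = metric (mspace m, d)"
  have n: "mspace n = mspace m" "mdist n = d"
    by (simp_all add: n_def)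
  interpret M': Metric_space "mspace m'" "mdist m'"
    by (rule Metric_space_mspace_mdist)
  interpret NM: Metric_space12 "mspace m" d "mspace m'" "mdist m'"
    by unfold_locales
  have "homeomorphic_map (mtopology_of n) (mtopology_of m') h"
    using NM.isometry_imp_homeomorphic_map[of h] bij n
    by (auto simp: mtopology_of_def d_def bij_betw_def)
  then obtain g where g: "homeomorphic_maps (mtopology_of n) (mtopology_of m') h g"
    using homeomorphic_map_maps by blast
  then have "homeomorphic_map (mtopology_of m') (mtopology_of n) g"
    using homeomorphic_maps_map by blast
  with hom have "homeomorphic_map (mtopology_of m) (mtopology_of n) (g \<circ> h)"
    by (rule homeomorphic_map_compose)
  moreover have "h (g (h x)) = h x" if "x \<in> mspace m" for x
    using g that n by (simp add: homeomorphic_maps_def)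
  ultimately have "quasisymmetric_map m n (g \<circ> h)"
    using q unfolding quasisymmetric_map_def by (simp add: n d_def cong: ball_cong)
  then have "conformal_dim m \<le> hausdorff_dim n"
    unfolding conformal_dim_def by (blast intro: INF_lower)
  also have "\<dots> \<le> hausdorff_dim m'"
    using bij n by (intro hausdorff_dim_isometric_le[where h = h]) (auto simp: d_def)
  finally show ?thesis .
qed


section \<open>Fractal gaskets\<close>

definition triangle_vertices :: "(real^2) set" where
  "triangle_vertices = {vector [0, 0], vector [1, 0], vector [1/2, sqrt 3 / 2]}"

definition unit_triangle :: "(real^2) set" where
  "unit_triangle = convex hull triangle_vertices"

definition ifs_attractor :: "'i set \<Rightarrow> ('i \<Rightarrow> 'a \<Rightarrow> 'a) \<Rightarrow> 'a :: metric_space set \<Rightarrow> bool" where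
  "ifs_attractor I f K \<longleftrightarrow> K \<noteq> {} \<and> compact K \<and> K = (\<Union>i\<in>I. f i ` K)"

definition gasket_map :: "real \<Rightarrow> real^2 \<Rightarrow> real^2 \<Rightarrow> real^2" where
  "gasket_map r d z = r *\<^sub>R (z + d)"

text \<open>The last condition says that a common point of two distinct triangles of the first level is a
  vertex of both of them.\<close>

definition fractal_gasket :: "(real^2) set \<Rightarrow> bool" where
  "fractal_gasket K \<longleftrightarrow>
     (\<exists>(N :: nat) (r :: nat \<Rightarrow> real) (d :: nat \<Rightarrow> real^2).
        (\<forall>i\<in>{1..N}. 0 < r i \<and> r i < 1) \<and>
        ifs_attractor {1..N} (\<lambda>i. gasket_map (r i) (d i)) K \<and>
        (\<Union>i\<in>{1..N}. gasket_map (r i) (d i) ` unit_triangle) \<subseteq> unit_triangle \<and>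
        (\<forall>i\<in>{1..N}. \<forall>j\<in>{1..N}. i \<noteq> j \<longrightarrow>
           gasket_map (r i) (d i) ` unit_triangle \<inter> gasket_map (r j) (d j) ` unit_triangle
           \<subseteq> gasket_map (r i) (d i) ` triangle_vertices \<inter> gasket_map (r j) (d j) ` triangle_vertices))"

definition totally_disconnected :: "'a::topological_space set \<Rightarrow> bool" where
  "totally_disconnected S \<longleftrightarrow> (\<forall>C\<in>components S. \<exists>x. C = {x})"

end

theory Submission
  imports Defs
begin

text \<open>
  A quasisymmetric image of a nontrivial continuum is a nontrivial continuum, so it has Hausdorff
  dimension at least 1. For the upper bounds, the gasket is given new metrics that are
  quasisymmetrically equivalent to the Euclidean one. Let a cell \<open>f_w(K)\<close> have weight
  \<open>\<rho>(w) = r_w\<^sup>\<alpha> h(w)\<close>, where \<open>h(w)\<close> is \<open>\<epsilon>\<close> to the number of times that the word \<open>w\<close> interrupts a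
  run of one and the same corner letter (a letter whose map fixes a vertex of the triangle). The
  distance of \<open>x\<close> and \<open>y\<close> is the supremum of \<open>\<bar>\<phi>(x) - \<phi>(y)\<bar>\<close> over all functions \<open>\<phi>\<close> whose oscillation on
  every cell is at most its weight. Thus cells have diameter at most their weight, and the
  dimension is at most \<open>p\<close> as soon as the sums of \<open>\<rho>(w)\<^sup>p\<close> over the words of length \<open>n\<close> tend to 0.

  Two cells meet only in a vertex, so test functions can be glued from cut functions \<open>\<theta>\<^sub>a\<close> that are 1
  at a vertex \<open>a\<close>, decay like a power of the distance to \<open>a\<close> and vanish at the other vertices. This
  bounds the distance of \<open>x\<close> and \<open>y\<close> from below by a multiple of \<open>h(w) \<bar>x - y\<bar>\<^sup>\<alpha>\<close> for a common cell \<open>f_w(K)\<close>,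
  and quasisymmetry follows. To leave the vertex \<open>a\<close>, one has to cross, at each of about \<open>1/\<alpha>\<close> scales
  of comparable weight, one of the few cells that touch the next smaller corner cell; hence cut
  functions exist already for \<open>\<epsilon>\<close> of order \<open>\<alpha>\<close>. As \<open>\<alpha>\<close> tends to 0 this gives dimension at most \<open>p\<close> for
  each \<open>p > 1\<close>. If \<open>K\<close> is totally disconnected, clopen sets provide cut functions with \<open>\<epsilon> = 1\<close> and
  \<open>\<alpha>\<close> arbitrarily large, which gives dimension at most \<open>p\<close> for each \<open>p > 0\<close>.
\<close>


section \<open>Iterated function systems whose cells meet in vertices\<close>

text \<open>The planar geometry enters only through these axioms. \<open>cone\<close> says that two
  cells leave a common point at a positive angle: moving away from it in one cell also moves away
  from the whole other cell. That \<open>y\<close> in \<open>overlap\<close> is in \<open>V\<close>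
  as well follows by exchanging \<open>i\<close> and \<open>j\<close>.\<close>

locale gasket_ifs =
  fixes K :: "'a::euclidean_space set" and I :: "'i set" and f :: "'i \<Rightarrow> 'a \<Rightarrow> 'a" and r :: "'i \<Rightarrow> real"
    and V :: "'a set" and corner :: "'a \<Rightarrow> 'i" and \<kappa> :: real
  assumes finite_I: "finite I" and K_ne: "K \<noteq> {}" and compact_K: "compact K"
    and K_eq: "K = (\<Union>i\<in>I. f i ` K)"
    and r_pos: "i \<in> I \<Longrightarrow> 0 < r i" and r_less_1: "i \<in> I \<Longrightarrow> r i < 1"
    and dist_f: "i \<in> I \<Longrightarrow> x \<in> K \<Longrightarrow> y \<in> K \<Longrightarrow> dist (f i x) (f i y) = r i * dist x y"
    and V_sub: "V \<subseteq> K" and finite_V: "finite V"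
    and corner_in: "a \<in> V \<Longrightarrow> corner a \<in> I" and corner_fix: "a \<in> V \<Longrightarrow> f (corner a) a = a"
    and corner_unique: "a \<in> V \<Longrightarrow> j \<in> I \<Longrightarrow> a \<in> f j ` K \<Longrightarrow> j = corner a"
    and overlap: "i \<in> I \<Longrightarrow> j \<in> I \<Longrightarrow> i \<noteq> j \<Longrightarrow> x \<in> K \<Longrightarrow> y \<in> K \<Longrightarrow> f i x = f j y \<Longrightarrow> x \<in> V"
    and overlap_unique: "i \<in> I \<Longrightarrow> j \<in> I \<Longrightarrow> i \<noteq> j \<Longrightarrow> x \<in> K \<Longrightarrow> y \<in> K \<Longrightarrow> f i x = f j y \<Longrightarrow>
      x' \<in> K \<Longrightarrow> y' \<in> K \<Longrightarrow> f i x' = f j y' \<Longrightarrow> x = x'"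
    and kappa_pos: "0 < \<kappa>"
    and cone: "i \<in> I \<Longrightarrow> j \<in> I \<Longrightarrow> i \<noteq> j \<Longrightarrow> a \<in> K \<Longrightarrow> b \<in> K \<Longrightarrow> f i a = f j b \<Longrightarrow> x \<in> K \<Longrightarrow> y \<in> K \<Longrightarrow>
      \<kappa> * dist (f i x) (f i a) \<le> dist (f i x) (f j y)"
begin

lemma V_K: "a \<in> V \<Longrightarrow> a \<in> K"
  using V_sub by blast

lemma I_ne: "I \<noteq> {}"
  using K_eq K_ne by auto

lemma f_in [simp]: "i \<in> I \<Longrightarrow> x \<in> K \<Longrightarrow> f i x \<in> K"
  using K_eq by blast

lemma K_cases:
  assumes "x \<in> K" obtains i y where "i \<in> I" "y \<in> K" "x = f i y"
  using assms K_eq by blast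

lemma f_inj: "i \<in> I \<Longrightarrow> x \<in> K \<Longrightarrow> y \<in> K \<Longrightarrow> f i x = f i y \<Longrightarrow> x = y"
  using dist_f[of i x y] r_pos[of i] by simp

text \<open>A contraction has only one fixed point.\<close>

lemma corner_inj:
  assumes "a \<in> V" "b \<in> V" "corner a = corner b" shows "a = b"
proof (rule ccontr)
  assume "a \<noteq> b"
  have "dist a b = r (corner a) * dist a b"
    using dist_f[of "corner a" a b] corner_fix[of a] corner_fix[of b] assms corner_in V_K by metis
  then show False using \<open>a \<noteq> b\<close> r_less_1[of "corner a"] corner_in assms by simp
qed

section \<open>Words, cells and contraction ratios\<close>

abbreviation fw :: "'i list \<Rightarrow> 'a \<Rightarrow> 'a" where
  "fw w \<equiv> foldr f w"

definition rw :: "'i list \<Rightarrow> real" where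
  "rw w = prod_list (map r w)"

lemma rw_simps [simp]: "rw [] = 1" "rw (i # w) = r i * rw w" "rw (u @ w) = rw u * rw w"
  by (simp_all add: rw_def)

lemma rw_pos: "w \<in> lists I \<Longrightarrow> 0 < rw w"
  by (induction w) (auto intro: mult_pos_pos r_pos)

lemma rw_le_1: "w \<in> lists I \<Longrightarrow> rw w \<le> 1"
proof (induction w)
  case (Cons i w)
  then have "r i * rw w \<le> 1 * 1"
    using r_less_1[of i] r_pos[of i] rw_pos[of w] by (intro mult_mono) auto
  then show ?case by simp
qed simp

lemma fw_in [simp]: "w \<in> lists I \<Longrightarrow> x \<in> K \<Longrightarrow> fw w x \<in> K"
  by (induction w) auto

lemma dist_fw: "w \<in> lists I \<Longrightarrow> x \<in> K \<Longrightarrow> y \<in> K \<Longrightarrow> dist (fw w x) (fw w y) = rw w * dist x y"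
  by (induction w) (auto simp: dist_f)

definition rmin :: real where "rmin = Min (r ` I)"
definition rmax :: real where "rmax = Max (r ` I)"

lemma rmin_le: "i \<in> I \<Longrightarrow> rmin \<le> r i"
  unfolding rmin_def using finite_I by auto
lemma rmax_ge: "i \<in> I \<Longrightarrow> r i \<le> rmax"
  unfolding rmax_def using finite_I by auto
lemma rmin_pos: "0 < rmin"
  unfolding rmin_def using finite_I I_ne r_pos by (subst Min_gr_iff) auto
lemma rmax_less_1: "rmax < 1"
  unfolding rmax_def using finite_I I_ne r_less_1 by (subst Max_less_iff) auto
lemma rmin_le_rmax: "rmin \<le> rmax"
  using I_ne rmin_le rmax_ge by fastforce

lemma diam_ex: "\<exists>M\<ge>1. \<forall>x\<in>K. \<forall>y\<in>K. dist x y \<le> M"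
proof -
  obtain M where "\<forall>x\<in>K. \<forall>y\<in>K. dist x y \<le> M"
    using compact_imp_bounded[OF compact_K] by (auto simp: bounded_two_points)
  then show ?thesis by (intro exI[of _ "max 1 M"]) fastforce
qed

text \<open>A bound for the diameter of \<open>K\<close>, taken at least 1 so that it can be a
  divisor and can absorb summands equal to 1.\<close>

definition diamK :: real where "diamK = (SOME M. M \<ge> 1 \<and> (\<forall>x\<in>K. \<forall>y\<in>K. dist x y \<le> M))"

lemma diamK: "1 \<le> diamK" "x \<in> K \<Longrightarrow> y \<in> K \<Longrightarrow> dist x y \<le> diamK"
  using someI_ex[OF diam_ex] unfolding diamK_def[symmetric] by auto

lemma compact_image_f: "i \<in> I \<Longrightarrow> compact (f i ` K)"
proof (rule compact_continuous_image[OF _ compact_K])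
  assume "i \<in> I"
  then show "continuous_on K (f i)"
    by (intro lipschitz_on_continuous_on[of "r i"] lipschitz_onI) (auto simp: dist_f intro: less_imp_le r_pos)
qed

text \<open>Disjoint compact sets have positive distance, and only finitely many pairs occur. Adding
  1 to the set \<open>S\<close> of distances keeps it nonempty and gives
  \<open>g \<le> 1\<close>.\<close>

lemma gap_ex:
  "\<exists>g>0. g \<le> 1 \<and> (\<forall>i\<in>I. \<forall>j\<in>I. f i ` K \<inter> f j ` K = {} \<longrightarrow> (\<forall>x\<in>K. \<forall>y\<in>K. g \<le> dist (f i x) (f j y)))
     \<and> (\<forall>a\<in>V. \<forall>j\<in>I. j \<noteq> corner a \<longrightarrow> (\<forall>x\<in>K. g \<le> dist (f j x) a))"
proof -
  have 1: "\<exists>g>0. \<forall>x\<in>K. \<forall>y\<in>K. g \<le> dist (f i x) (f j y)" if "i \<in> I" "j \<in> I" "f i ` K \<inter> f j ` K = {}" for i j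
    using separate_compact_closed[of "f i ` K" "f j ` K"] compact_image_f compact_imp_closed that by auto
  have 2: "\<exists>g>0. \<forall>x\<in>K. g \<le> dist (f j x) a" if "a \<in> V" "j \<in> I" "j \<noteq> corner a" for a j
    using separate_compact_closed[of "f j ` K" "{a}"] compact_image_f that corner_unique by fastforce
  define A where "A = {(i,j). i \<in> I \<and> j \<in> I \<and> f i ` K \<inter> f j ` K = {}}"
  define B where "B = {(a,j). a \<in> V \<and> j \<in> I \<and> j \<noteq> corner a}"
  have "\<forall>p\<in>A. \<exists>g>0. \<forall>x\<in>K. \<forall>y\<in>K. g \<le> dist (f (fst p) x) (f (snd p) y)"
    using 1 by (auto simp: A_def)
  then obtain g1 where g1: "\<And>p. p \<in> A \<Longrightarrow> g1 p > 0 \<and> (\<forall>x\<in>K. \<forall>y\<in>K. g1 p \<le> dist (f (fst p) x) (f (snd p) y))"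
    by metis
  have "\<forall>p\<in>B. \<exists>g>0. \<forall>x\<in>K. g \<le> dist (f (snd p) x) (fst p)"
    using 2 by (auto simp: B_def)
  then obtain g2 where g2: "\<And>p. p \<in> B \<Longrightarrow> g2 p > 0 \<and> (\<forall>x\<in>K. g2 p \<le> dist (f (snd p) x) (fst p))"
    by metis
  have fin: "finite A" "finite B"
    by (rule finite_subset[of _ "I \<times> I"] finite_subset[of _ "V \<times> I"]; use finite_I finite_V in \<open>auto simp: A_def B_def\<close>)+
  define S where "S = insert 1 (g1 ` A \<union> g2 ` B)"
  have S: "finite S" "S \<noteq> {}" using fin by (auto simp: S_def)
  have "Min S > 0" using S g1 g2 by (subst Min_gr_iff) (auto simp: S_def)
  moreover have le: "Min S \<le> s" if "s \<in> S" for s using S that by auto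
  then have "Min S \<le> 1" by (auto simp: S_def)
  moreover have "Min S \<le> dist (f i x) (f j y)"
    if "i \<in> I" "j \<in> I" "f i ` K \<inter> f j ` K = {}" "x \<in> K" "y \<in> K" for i j x y
  proof -
    have "(i,j) \<in> A" using that by (auto simp: A_def)
    then show ?thesis using le[of "g1 (i,j)"] g1[of "(i,j)"] that by (fastforce simp: S_def)
  qed
  moreover have "Min S \<le> dist (f j x) a" if "a \<in> V" "j \<in> I" "j \<noteq> corner a" "x \<in> K" for a j x
  proof -
    have "(a,j) \<in> B" using that by (auto simp: B_def)
    then show ?thesis using le[of "g2 (a,j)"] g2[of "(a,j)"] that by (fastforce simp: S_def)
  qed
  ultimately show ?thesis by blast
qed

definition gap :: real where
  "gap = (SOME g. 0 < g \<and> g \<le> 1 \<and> (\<forall>i\<in>I. \<forall>j\<in>I. f i ` K \<inter> f j ` K = {} \<longrightarrow> (\<forall>x\<in>K. \<forall>y\<in>K. g \<le> dist (f i x) (f j y)))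
     \<and> (\<forall>a\<in>V. \<forall>j\<in>I. j \<noteq> corner a \<longrightarrow> (\<forall>x\<in>K. g \<le> dist (f j x) a)))"

lemma gap: "0 < gap" "gap \<le> 1"
  "i \<in> I \<Longrightarrow> j \<in> I \<Longrightarrow> f i ` K \<inter> f j ` K = {} \<Longrightarrow> x \<in> K \<Longrightarrow> y \<in> K \<Longrightarrow> gap \<le> dist (f i x) (f j y)"
  "a \<in> V \<Longrightarrow> j \<in> I \<Longrightarrow> j \<noteq> corner a \<Longrightarrow> x \<in> K \<Longrightarrow> gap \<le> dist (f j x) a"
  using someI_ex[OF gap_ex] unfolding gap_def[symmetric] by blast+

section \<open>Addresses of points\<close>

lemma rmax_power_less:
  assumes "0 < (d::real)" shows "\<exists>n. diamK * rmax ^ n < d"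
proof -
  have "0 \<le> rmax" using rmin_pos rmin_le_rmax by simp
  then have "(\<lambda>n. diamK * rmax ^ n) \<longlonglongrightarrow> diamK * 0"
    using rmax_less_1 by (intro tendsto_intros LIMSEQ_realpow_zero) auto
  then have "\<forall>\<^sub>F n in sequentially. diamK * rmax ^ n < d"
    using assms by (intro order_tendstoD) auto
  then show ?thesis by (simp add: eventually_sequentially) blast
qed

text \<open>Both points are pulled back as long as their first letters agree. Each pull-back
  multiplies the distance by at least \<open>1 / rmax\<close>, and the distance cannot exceed
  \<open>diamK\<close>, so the process stops.\<close>

lemma separating_word:
  assumes "x \<in> K" "y \<in> K" "x \<noteq> y"
  shows "\<exists>u\<in>lists I. \<exists>i\<in>I. \<exists>j\<in>I. \<exists>x'\<in>K. \<exists>y'\<in>K. i \<noteq> j \<and> x = fw u (f i x') \<and> y = fw u (f j y')"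
proof -
  have *: "\<lbrakk>x \<in> K; y \<in> K; diamK * rmax ^ n < dist x y\<rbrakk> \<Longrightarrow> ?thesis" for n
  proof (induction n arbitrary: x y)
    case 0
    then show ?case using diamK(2)[of x y] by simp
  next
    case (Suc n)
    obtain i x' where i: "i \<in> I" "x' \<in> K" "x = f i x'" using K_cases[OF Suc.prems(1)] .
    obtain j y' where j: "j \<in> I" "y' \<in> K" "y = f j y'" using K_cases[OF Suc.prems(2)] .
    show ?case
    proof (cases "i = j")
      case False
      then show ?thesis using i j by (intro bexI[of _ "[]"] bexI[of _ i] bexI[of _ j] bexI[of _ x'] bexI[of _ y']) auto
    next
      case True
      have "r i * dist x' y' \<le> rmax * dist x' y'" using rmax_ge i by (intro mult_right_mono) auto
      then have "rmax * (diamK * rmax ^ n) < rmax * dist x' y'"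
        using Suc.prems(3) i j True by (simp add: dist_f mult_ac)
      then have "diamK * rmax ^ n < dist x' y'"
        using rmin_pos rmin_le_rmax by (simp add: mult_less_cancel_left)
      from Suc.IH[OF i(2) j(2) this] obtain u k l x1 y1 where u: "u \<in> lists I" "k \<in> I" "l \<in> I" "x1 \<in> K" "y1 \<in> K" "k \<noteq> l"
        "x' = fw u (f k x1)" "y' = fw u (f l y1)" by blast
      then show ?thesis using i j True
        by (intro bexI[of _ "i # u"] bexI[of _ k] bexI[of _ l] bexI[of _ x1] bexI[of _ y1]) auto
    qed
  qed
  show ?thesis using * rmax_power_less[of "dist x y"] assms by auto
qed

text \<open>The same expansion argument, with the fixed point \<open>a\<close> in place of the
  second point.\<close>

lemma corner_word:
  assumes "a \<in> V" "x \<in> K" "x \<noteq> a"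
  shows "\<exists>n. \<exists>k\<in>I. \<exists>x'\<in>K. k \<noteq> corner a \<and> x = fw (replicate n (corner a)) (f k x')"
proof -
  have "\<lbrakk>x \<in> K; diamK * rmax ^ m < dist x a\<rbrakk> \<Longrightarrow> ?thesis" for m
  proof (induction m arbitrary: x)
    case 0
    then show ?case using diamK(2)[of x a] V_K assms by simp
  next
    case (Suc m)
    obtain i x' where i: "i \<in> I" "x' \<in> K" "x = f i x'" using K_cases[OF Suc.prems(1)] .
    show ?case
    proof (cases "i = corner a")
      case False
      then show ?thesis using i by (intro exI[of _ 0] bexI[of _ i] bexI[of _ x']) auto
    next
      case True
      have "r i * dist x' a \<le> rmax * dist x' a" using rmax_ge i by (intro mult_right_mono) auto
      moreover have "dist x a = r i * dist x' a"
        using dist_f[OF i(1,2), of a] i(3) corner_fix[OF assms(1)] V_K[OF assms(1)] True by simp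
      ultimately have "rmax * (diamK * rmax ^ m) < rmax * dist x' a"
        using Suc.prems(2) by (simp add: mult_ac)
      then have "diamK * rmax ^ m < dist x' a"
        using rmin_pos rmin_le_rmax by (simp add: mult_less_cancel_left)
      from Suc.IH[OF i(2) this] obtain n k x1 where "k \<in> I" "x1 \<in> K" "k \<noteq> corner a"
        "x' = fw (replicate n (corner a)) (f k x1)" by blast
      then show ?thesis using i True
        by (intro exI[of _ "Suc n"] bexI[of _ k] bexI[of _ x1]) auto
    qed
  qed
  then show ?thesis using rmax_power_less[of "dist x a"] assms by auto
qed

lemma fw_corner: "a \<in> V \<Longrightarrow> fw (replicate n (corner a)) a = a"
  by (induction n) (auto simp: corner_fix)

lemma corner_lists: "a \<in> V \<Longrightarrow> replicate n (corner a) \<in> lists I"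
  by (induction n) (auto simp: corner_in)

end


section \<open>Weights and the dual metric\<close>

context gasket_ifs
begin

text \<open>State \<open>Some i\<close> means that the word read so far ends in a run of the corner letter \<open>i\<close>. In state
  \<open>None\<close> every corner letter starts a run for free; all letters that neither start nor continue a run
  cost a factor \<open>\<epsilon>\<close> and lead back to \<open>None\<close>.\<close>

definition step :: "'i option \<Rightarrow> 'i \<Rightarrow> 'i option" where
  "step s i = (if i \<in> corner ` V \<and> (s = None \<or> s = Some i) then Some i else None)"

fun hh :: "real \<Rightarrow> 'i option \<Rightarrow> 'i list \<Rightarrow> real" where
  "hh \<epsilon> s [] = 1"
| "hh \<epsilon> s (i # w) = (if step s i = Some i then 1 else \<epsilon>) * hh \<epsilon> (step s i) w"

definition \<rho> :: "real \<Rightarrow> real \<Rightarrow> 'i option \<Rightarrow> 'i list \<Rightarrow> real" where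
  "\<rho> \<alpha> \<epsilon> s w = rw w powr \<alpha> * hh \<epsilon> s w"

lemma \<rho>_simps [simp]: "\<rho> \<alpha> \<epsilon> s [] = 1"
  "i \<in> I \<Longrightarrow> w \<in> lists I \<Longrightarrow>
    \<rho> \<alpha> \<epsilon> s (i # w) = r i powr \<alpha> * (if step s i = Some i then 1 else \<epsilon>) * \<rho> \<alpha> \<epsilon> (step s i) w"
  using rw_pos[of w] r_pos[of i] by (simp_all add: \<rho>_def powr_mult)

lemma step_simps [simp]: "a \<in> V \<Longrightarrow> step (Some (corner a)) (corner a) = Some (corner a)" "i \<noteq> j \<Longrightarrow> step (Some i) j = None"
  "a \<in> V \<Longrightarrow> step None (corner a) = Some (corner a)"
  by (auto simp: step_def)

lemma hh_pos: "0 < \<epsilon> \<Longrightarrow> 0 < hh \<epsilon> s w"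
  by (induction w arbitrary: s) auto

lemma hh_le_1: "0 < \<epsilon> \<Longrightarrow> \<epsilon> \<le> 1 \<Longrightarrow> hh \<epsilon> s w \<le> 1"
proof (induction w arbitrary: s)
  case (Cons i w)
  then have "(if step s i = Some i then 1 else \<epsilon>) * hh \<epsilon> (step s i) w \<le> 1 * 1"
    using hh_pos[of \<epsilon>] by (intro mult_mono) (auto intro: less_imp_le)
  then show ?case by simp
qed simp

lemma hh_append: "hh \<epsilon> s (u @ w) = hh \<epsilon> s u * hh \<epsilon> (foldl step s u) w"
  by (induction u arbitrary: s) auto

lemma hh_append_le: "0 < \<epsilon> \<Longrightarrow> \<epsilon> \<le> 1 \<Longrightarrow> hh \<epsilon> s (u @ w) \<le> hh \<epsilon> s u"
  using hh_le_1[of \<epsilon> _ w] hh_pos[of \<epsilon> s u] by (simp add: hh_append mult_left_le)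

text \<open>Each inequality needs the other one in the induction. After a letter
  \<open>j \<noteq> i\<close> the run from \<open>Some i\<close> has paid and stands in
  \<open>None\<close>, whereas the run from \<open>None\<close> may have moved to
  \<open>Some j\<close> for free.\<close>

lemma hh_Some_None:
  assumes "0 < \<epsilon>" "\<epsilon> \<le> 1"
  shows "hh \<epsilon> (Some i) w \<le> hh \<epsilon> None w" "\<epsilon> * hh \<epsilon> None w \<le> hh \<epsilon> (Some i) w"
proof (induction w arbitrary: i)
  case Nil
  case 1 show ?case by simp
  case 2 show ?case using assms by simp
next
  case (Cons j w)
  have p: "0 < hh \<epsilon> s w" for s by (rule hh_pos[OF assms(1)])
  have e: "\<epsilon> * hh \<epsilon> s w \<le> hh \<epsilon> s w" for s using p[of s] assms by simp
  have n: "step None j = Some j \<or> step None j = None" by (auto simp: step_def)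
  case 1
  show ?case
    using Cons.IH e n by (cases "i = j") (auto intro: order_trans simp: step_def)
  case 2
  have "\<epsilon> * (\<epsilon> * hh \<epsilon> None w) \<le> \<epsilon> * hh \<epsilon> None w"
    using e assms by simp
  then show ?case
    using Cons.IH[of j] e n assms by (cases "i = j") (auto simp: step_def intro: order_trans[OF e])
qed

lemma hh_compare:
  assumes "0 < \<epsilon>" "\<epsilon> \<le> 1"
  shows "hh \<epsilon> s w \<le> hh \<epsilon> None w" "\<epsilon> * hh \<epsilon> None w \<le> hh \<epsilon> s w"
  using hh_Some_None[OF assms] hh_pos[OF assms(1), of None w] assms by (cases s; simp)+

end

text \<open>The cut functions \<open>\<theta>\<close> are left open because the two halves of the
  theorem use different ones. \<open>theta_osc\<close> refers to the state \<open>None\<close>,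
  whose weights are the largest; \<open>theta_sep\<close> keeps \<open>\<theta> a\<close> away from
  1 at a distance from \<open>a\<close>.\<close>

locale gasket_weights = gasket_ifs K I f r V corner \<kappa>
  for K :: "'a::euclidean_space set" and I :: "'i set" and f r V corner \<kappa> +
  fixes \<alpha> \<epsilon> :: real and \<theta> :: "'a \<Rightarrow> 'a \<Rightarrow> real" and C0 c0 :: real
  assumes alpha_pos: "0 < \<alpha>" and eps: "0 < \<epsilon>" "\<epsilon> \<le> 1" and C0: "1 \<le> C0" and c0: "0 < c0"
    and theta_vertex: "a \<in> V \<Longrightarrow> b \<in> V \<Longrightarrow> \<theta> a b = (if a = b then 1 else 0)"
    and theta_01: "a \<in> V \<Longrightarrow> x \<in> K \<Longrightarrow> 0 \<le> \<theta> a x" "a \<in> V \<Longrightarrow> x \<in> K \<Longrightarrow> \<theta> a x \<le> 1"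
    and theta_osc: "a \<in> V \<Longrightarrow> w \<in> lists I \<Longrightarrow> x \<in> K \<Longrightarrow> y \<in> K \<Longrightarrow>
      \<bar>\<theta> a (fw w x) - \<theta> a (fw w y)\<bar> \<le> C0 * \<rho> \<alpha> \<epsilon> None w"
    and theta_sep: "a \<in> V \<Longrightarrow> x \<in> K \<Longrightarrow> c0 * dist x a powr \<alpha> \<le> 1 - \<theta> a x"
begin

abbreviation "h s w \<equiv> hh \<epsilon> s w"
abbreviation "R s w \<equiv> \<rho> \<alpha> \<epsilon> s w"

lemma h_pos: "0 < h s w" by (rule hh_pos[OF eps(1)])
lemma R_pos: "w \<in> lists I \<Longrightarrow> 0 < R s w"
  using h_pos rw_pos[of w] by (simp add: \<rho>_def)
lemma R_nonneg: "w \<in> lists I \<Longrightarrow> 0 \<le> R s w"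
  using R_pos less_imp_le by blast

lemma R_compare: "w \<in> lists I \<Longrightarrow> \<epsilon> * R None w \<le> R s w"
  using hh_compare(2)[OF eps, of w s] by (simp add: \<rho>_def mult.left_commute[of \<epsilon>] mult_left_mono)

lemma R_le: "w \<in> lists I \<Longrightarrow> R s w \<le> rw w powr \<alpha>"
  using hh_le_1[OF eps, of s w] by (simp add: \<rho>_def mult_left_le)

lemma R_le_1: "w \<in> lists I \<Longrightarrow> R s w \<le> 1"
  using R_le[of w s] rw_le_1[of w] rw_pos[of w] powr_le1[of \<alpha> "rw w"] alpha_pos by force

text \<open>The state \<open>s\<close> is a parameter because a test function on the cell of a word
  has to respect the weights read from the state reached after that word.\<close>

definition tame :: "'i option \<Rightarrow> ('a \<Rightarrow> real) \<Rightarrow> bool" where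
  "tame s \<phi> \<longleftrightarrow> (\<forall>w\<in>lists I. \<forall>x\<in>K. \<forall>y\<in>K. \<bar>\<phi> (fw w x) - \<phi> (fw w y)\<bar> \<le> R s w)"

definition D :: "'a \<Rightarrow> 'a \<Rightarrow> real" where
  "D x y = (SUP \<phi>\<in>Collect (tame None). \<bar>\<phi> x - \<phi> y\<bar>)"

lemma tame_0: "tame s (\<lambda>x. 0)"
  using R_pos by (auto simp: tame_def intro: less_imp_le)

lemma D_upper:
  assumes "w \<in> lists I" "x \<in> K" "y \<in> K"
  shows "D (fw w x) (fw w y) \<le> R None w"
  unfolding D_def
proof (rule cSUP_least)
  show "Collect (tame None) \<noteq> {}" using tame_0 by auto
qed (use assms in \<open>auto simp: tame_def\<close>)

lemma D_bdd: "x \<in> K \<Longrightarrow> y \<in> K \<Longrightarrow> bdd_above ((\<lambda>\<phi>. \<bar>\<phi> x - \<phi> y\<bar>) ` Collect (tame None))"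
  by (intro bdd_aboveI2[of _ _ 1]) (auto simp: tame_def dest: bspec[of _ _ "[]"])

lemma D_ge: "tame None \<phi> \<Longrightarrow> x \<in> K \<Longrightarrow> y \<in> K \<Longrightarrow> \<bar>\<phi> x - \<phi> y\<bar> \<le> D x y"
  unfolding D_def by (rule cSUP_upper2[OF D_bdd]) auto

lemma D_refl [simp]: "D x x = 0"
proof -
  have "Collect (tame None) \<noteq> {}" using tame_0 by auto
  then show ?thesis unfolding D_def by simp
qed

lemma D_commute: "D x y = D y x"
  unfolding D_def by (simp add: abs_minus_commute)

lemma D_nonneg: "x \<in> K \<Longrightarrow> y \<in> K \<Longrightarrow> 0 \<le> D x y"
  using D_ge[OF tame_0] by force

lemma D_triangle:
  assumes "x \<in> K" "y \<in> K" "z \<in> K" shows "D x z \<le> D x y + D y z"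
  unfolding D_def[of x z]
proof (rule cSUP_least)
  show "Collect (tame None) \<noteq> {}" using tame_0 by auto
  fix \<phi> assume "\<phi> \<in> Collect (tame None)"
  then have "\<bar>\<phi> x - \<phi> y\<bar> \<le> D x y" "\<bar>\<phi> y - \<phi> z\<bar> \<le> D y z"
    using assms by (auto intro: D_ge)
  then show "\<bar>\<phi> x - \<phi> z\<bar> \<le> D x y + D y z" by linarith
qed

text \<open>Let \<open>l\<close> be the run of the corner letter that leads to \<open>x\<close>. The
  cell of \<open>w @ l\<close> contains both points and is not much larger than their distance:
  after the run, \<open>x\<close> lies in a cell that misses \<open>a\<close> by at least
  \<open>gap\<close>.\<close>

lemma D_vertex:
  assumes a: "a \<in> V" and x: "x \<in> K" and w: "w \<in> lists I"
  shows "D (fw w x) (fw w a) \<le> gap powr (-\<alpha>) * h None w * dist (fw w x) (fw w a) powr \<alpha>"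
proof (cases "x = a")
  case False
  obtain n k x' where k: "k \<in> I" "x' \<in> K" "k \<noteq> corner a" "x = fw (replicate n (corner a)) (f k x')"
    using corner_word[OF a x False] by blast
  define l where "l = replicate n (corner a)"
  have l: "l \<in> lists I" "a = fw l a" using corner_lists[OF a] fw_corner[OF a] by (auto simp: l_def)
  have fwx: "fw w x = fw (w @ l) (f k x')" "fw w a = fw (w @ l) a" using k l by (simp_all add: l_def)
  have wl: "w @ l \<in> lists I" using w l by simp
  have "D (fw w x) (fw w a) \<le> R None (w @ l)"
    unfolding fwx using k a wl V_K by (intro D_upper) auto
  also have "\<dots> \<le> rw (w @ l) powr \<alpha> * h None w"
    using hh_append_le[OF eps] by (simp add: \<rho>_def mult_left_mono)
  also have "rw (w @ l) \<le> dist (fw w x) (fw w a) / gap"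
  proof -
    have "gap * rw (w @ l) \<le> dist (f k x') a * rw (w @ l)"
      using gap(4)[OF a k(1,3,2)] rw_pos[OF wl] by (intro mult_right_mono) auto
    also have "\<dots> = dist (fw w x) (fw w a)"
      unfolding fwx using k a wl V_K by (subst dist_fw) auto
    finally show ?thesis using gap(1) by (simp add: field_simps)
  qed
  then have "rw (w @ l) powr \<alpha> * h None w \<le> (dist (fw w x) (fw w a) / gap) powr \<alpha> * h None w"
    using rw_pos[OF wl] alpha_pos h_pos[of None w] by (intro mult_right_mono powr_mono2) auto
  also have "\<dots> = gap powr (-\<alpha>) * h None w * dist (fw w x) (fw w a) powr \<alpha>"
    using gap(1) by (simp add: powr_divide powr_minus_divide)
  finally show ?thesis .
qed simp

text \<open>The summand 1 serves disjoint siblings, the summand with \<open>\<kappa>\<close>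
  touching ones; there the factor 2 counts the two pieces of a path through the contact
  point.\<close>

definition "CU = 2 * gap powr (-\<alpha>) * (1 + \<kappa> powr (-\<alpha>))"

lemma CU_pos: "0 < CU"
  unfolding CU_def using gap(1) kappa_pos by (simp add: add_pos_pos)

text \<open>In the cell \<open>W\<close> the points pass to different children. If these are
  disjoint, the diameter bound and \<open>gap\<close> suffice. If they touch, the path goes through
  the contact point with \<open>D_vertex\<close> on both sides, and \<open>cone\<close> bounds both
  pieces by the distance of the points.\<close>

lemma D_le:
  assumes w: "w \<in> lists I" and x: "x \<in> K" and y: "y \<in> K"
  shows "D (fw w x) (fw w y) \<le> CU * h None w * dist (fw w x) (fw w y) powr \<alpha>"
proof (cases "x = y")
  case False
  obtain u i j x' y' where u: "u \<in> lists I" "i \<in> I" "j \<in> I" "x' \<in> K" "y' \<in> K" "i \<noteq> j"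
    "x = fw u (f i x')" "y = fw u (f j y')"
    using separating_word[OF x y False] by blast
  define W where "W = w @ u"
  have W: "W \<in> lists I" "fw w x = fw W (f i x')" "fw w y = fw W (f j y')"
    using u w by (auto simp: W_def)
  let ?d = "dist (fw w x) (fw w y)"
  let ?G = "gap powr (-\<alpha>)"
  have hW: "h None (W @ v) \<le> h None w" for v
    unfolding W_def append_assoc by (rule hh_append_le[OF eps])
  have d: "?d = rw W * dist (f i x') (f j y')"
    unfolding W using W u by (simp add: dist_fw)
  have G: "0 < ?G" using gap(1) by simp
  have kap: "0 < \<kappa> powr (-\<alpha>)" using kappa_pos by simp
  show ?thesis
  proof (cases "f i ` K \<inter> f j ` K = {}")
    case True
    have "D (fw w x) (fw w y) \<le> R None W"
      unfolding W(2,3) using u W by (intro D_upper) auto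
    also have "\<dots> \<le> rw W powr \<alpha> * h None w"
      using hW[of "[]"] by (simp add: \<rho>_def mult_left_mono)
    also have "rw W powr \<alpha> * h None w \<le> (?d / gap) powr \<alpha> * h None w"
      using rw_pos[OF W(1)] alpha_pos h_pos[of None w] gap(1) gap(3)[OF u(2,3) True u(4,5)] d
      by (intro mult_right_mono powr_mono2) (auto simp: field_simps)
    also have "\<dots> = ?G * (h None w * ?d powr \<alpha>)"
      using gap(1) by (simp add: powr_divide powr_minus_divide)
    also have "\<dots> \<le> CU * (h None w * ?d powr \<alpha>)"
      using G kap h_pos[of None w] by (intro mult_right_mono) (auto simp: CU_def algebra_simps add_increasing2)
    finally show ?thesis by (simp add: mult_ac)
  next
    case False
    then obtain a b where ab: "a \<in> K" "b \<in> K" "f i a = f j b" by blast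
    have V: "a \<in> V" "b \<in> V"
      using overlap[OF u(2,3,6) ab] overlap[OF u(3,2) _ ab(2,1)] u(6) ab(3) by auto
    have 1: "D (fw W (f i x')) (fw W (f i a)) \<le> ?G * h None w * (?d / \<kappa>) powr \<alpha>"
    proof -
      have "D (fw W (f i x')) (fw W (f i a)) \<le> ?G * h None (W @ [i]) * dist (fw W (f i x')) (fw W (f i a)) powr \<alpha>"
        using D_vertex[OF V(1) u(4), of "W @ [i]"] W u by simp
      also have "\<dots> \<le> ?G * h None w * (?d / \<kappa>) powr \<alpha>"
      proof (intro mult_mono[OF mult_left_mono] powr_mono2)
        have "\<kappa> * dist (f i x') (f i a) \<le> dist (f i x') (f j y')"
          using cone[OF u(2,3,6) ab u(4,5)] by (simp add: dist_commute)
        then have "rw W * (\<kappa> * dist (f i x') (f i a)) \<le> ?d"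
          using rw_pos[OF W(1)] by (simp add: d)
        then show "dist (fw W (f i x')) (fw W (f i a)) \<le> ?d / \<kappa>"
          using kappa_pos W(1) ab u by (simp add: dist_fw field_simps)
      qed (use hW[of "[i]"] gap(1) h_pos[THEN less_imp_le] alpha_pos in auto)
      finally show ?thesis .
    qed
    have 2: "D (fw W (f j y')) (fw W (f j b)) \<le> ?G * h None w * (?d / \<kappa>) powr \<alpha>"
    proof -
      have "D (fw W (f j y')) (fw W (f j b)) \<le> ?G * h None (W @ [j]) * dist (fw W (f j y')) (fw W (f j b)) powr \<alpha>"
        using D_vertex[OF V(2) u(5), of "W @ [j]"] W u by simp
      also have "\<dots> \<le> ?G * h None w * (?d / \<kappa>) powr \<alpha>"
      proof (intro mult_mono[OF mult_left_mono] powr_mono2)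
        have "\<kappa> * dist (f j y') (f j b) \<le> dist (f i x') (f j y')"
          using cone[OF u(3,2) u(6)[symmetric] ab(2,1) ab(3)[symmetric] u(5,4)] by (simp add: dist_commute)
        then have "rw W * (\<kappa> * dist (f j y') (f j b)) \<le> ?d"
          using rw_pos[OF W(1)] by (simp add: d)
        then show "dist (fw W (f j y')) (fw W (f j b)) \<le> ?d / \<kappa>"
          using kappa_pos W(1) ab u by (simp add: dist_fw field_simps)
      qed (use hW[of "[j]"] gap(1) h_pos[THEN less_imp_le] alpha_pos in auto)
      finally show ?thesis .
    qed
    have "D (fw w x) (fw w y) \<le> D (fw W (f i x')) (fw W (f i a)) + D (fw W (f i a)) (fw W (f j y'))"
      unfolding W(2,3) using u W ab by (intro D_triangle) auto
    also have "\<dots> \<le> 2 * (?G * h None w * (?d / \<kappa>) powr \<alpha>)"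
      using 1 2 ab(3) by (simp add: D_commute)
    also have "\<dots> = 2 * ?G * \<kappa> powr (-\<alpha>) * (h None w * ?d powr \<alpha>)"
      using kappa_pos by (simp add: powr_divide powr_minus_divide)
    also have "\<dots> \<le> CU * (h None w * ?d powr \<alpha>)"
      using G kap h_pos[of None w] by (intro mult_right_mono) (auto simp: CU_def algebra_simps)
    finally show ?thesis by (simp add: mult_ac)
  qed
qed simp

end


section \<open>Gluing test functions along vertices\<close>

context gasket_ifs
begin

definition contact :: "'i \<Rightarrow> 'i \<Rightarrow> 'a \<Rightarrow> 'a \<Rightarrow> bool" where
  "contact j i a b \<longleftrightarrow> a \<in> V \<and> b \<in> V \<and> f j a = f i b"

text \<open>A function \<open>g\<close> on the cell \<open>i\<close> is continued to a sibling
  \<open>j\<close> by letting it fade out along the cut function at the contact vertex. By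
  \<open>overlap_unique\<close> the sum has at most one term; the empty sum gives 0 on siblings that
  do not touch the cell \<open>i\<close>.\<close>

definition glue_part :: "('a \<Rightarrow> 'a \<Rightarrow> real) \<Rightarrow> 'i \<Rightarrow> ('a \<Rightarrow> real) \<Rightarrow> 'i \<Rightarrow> 'a \<Rightarrow> real" where
  "glue_part \<theta> i g j x = (if j = i then g x else \<Sum>(a,b)\<in>{(a,b). contact j i a b}. g b * \<theta> a x)"

text \<open>For normalized \<open>\<theta>\<close> the value is independent of the chosen address by
  \<open>glue_compat\<close>.\<close>

definition glue :: "('a \<Rightarrow> 'a \<Rightarrow> real) \<Rightarrow> 'i \<Rightarrow> ('a \<Rightarrow> real) \<Rightarrow> 'a \<Rightarrow> real" where
  "glue \<theta> i g p = (let (j,x) = (SOME (j,x). j \<in> I \<and> x \<in> K \<and> p = f j x) in glue_part \<theta> i g j x)"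

definition normalized :: "('a \<Rightarrow> 'a \<Rightarrow> real) \<Rightarrow> bool" where
  "normalized \<theta> \<longleftrightarrow> (\<forall>a\<in>V. \<forall>b\<in>V. \<theta> a b = (if a = b then 1 else 0))"

lemma contact_not_disjoint: "contact j i a b \<Longrightarrow> f j ` K \<inter> f i ` K \<noteq> {}"
  unfolding contact_def using V_K by blast

lemma contact_cases:
  assumes "i \<in> I" "j \<in> I" "i \<noteq> j"
  shows "(f j ` K \<inter> f i ` K = {} \<and> {(a,b). contact j i a b} = {}) \<or> (\<exists>a b. contact j i a b \<and> {(a,b). contact j i a b} = {(a,b)})"
proof (cases "f j ` K \<inter> f i ` K = {}")
  case True
  then show ?thesis using contact_not_disjoint by auto
next
  case False
  then obtain a b where ab: "a \<in> K" "b \<in> K" "f j a = f i b" by blast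
  then have "a \<in> V" "b \<in> V"
    using overlap[OF assms(2,1) _ ab] overlap[OF assms ab(2,1)] assms(3) by auto
  then have c: "contact j i a b" using ab by (simp add: contact_def)
  moreover have "a' = a \<and> b' = b" if "contact j i a' b'" for a' b'
    using that c overlap_unique[of j i a b a' b'] overlap_unique[of i j b a b' a'] assms V_K
    by (metis contact_def)
  ultimately show ?thesis by blast
qed

lemma glue_part_same [simp]: "glue_part \<theta> i g i x = g x"
  by (simp add: glue_part_def)

lemma glue_part_contact:
  assumes "i \<in> I" "j \<in> I" "i \<noteq> j" "contact j i a b"
  shows "glue_part \<theta> i g j x = g b * \<theta> a x"
proof -
  have "(a,b) \<in> {(a,b). contact j i a b}" using assms(4) by simp
  then have "{(a,b). contact j i a b} = {(a,b)}" using contact_cases[OF assms(1-3)] by (metis empty_iff singletonD)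
  then show ?thesis using assms(3) by (simp add: glue_part_def)
qed

lemma glue_part_disjoint:
  assumes "i \<in> I" "j \<in> I" "i \<noteq> j" "f j ` K \<inter> f i ` K = {}"
  shows "glue_part \<theta> i g j x = 0"
proof -
  have "{(a,b). contact j i a b} = {}" using assms(4) contact_not_disjoint by auto
  then show ?thesis using assms(3) unfolding glue_part_def by (simp only: sum.empty) simp
qed

lemma glue_part_vertex:
  assumes "normalized \<theta>" "i \<in> I" "j \<in> I" "i \<noteq> j" "x \<in> V" "\<nexists>b. contact j i x b"
  shows "glue_part \<theta> i g j x = 0"
  using contact_cases[OF assms(2-4)]
proof
  assume "\<exists>a b. contact j i a b \<and> {(a, b). contact j i a b} = {(a, b)}"
  then obtain a b where "contact j i a b" by blast
  moreover have "\<theta> a x = 0" using calculation assms by (auto simp: contact_def normalized_def)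
  ultimately show ?thesis using glue_part_contact[OF assms(2-4)] by simp
qed (use glue_part_disjoint assms in auto)

text \<open>A point with two different first letters is a vertex in both cells, where normalized cut
  functions are 0 or 1. If it also lies on the cell \<open>i\<close>, both addresses yield the value
  of \<open>g\<close> there, otherwise both yield 0.\<close>

lemma glue_compat:
  assumes n: "normalized \<theta>" and i: "i \<in> I" and j: "j \<in> I" and k: "k \<in> I" and x: "x \<in> K" and y: "y \<in> K"
    and eq: "f j x = f k y"
  shows "glue_part \<theta> i g j x = glue_part \<theta> i g k y"
proof (cases "j = k")
  case True
  then show ?thesis using f_inj[OF j x y] eq by simp
next
  case False
  then have V: "x \<in> V" "y \<in> V"
    using overlap[OF j k False x y eq] overlap[OF k j _ y x] eq by auto
  consider "j = i" | "k = i" | "j \<noteq> i" "k \<noteq> i" by blast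
  then show ?thesis
  proof cases
    case 1
    have "contact k i y x" using 1 V eq by (simp add: contact_def)
    from glue_part_contact[OF i k _ this] show ?thesis using 1 False V n by (simp add: normalized_def)
  next
    case 2
    have "contact j i x y" using 2 V eq by (simp add: contact_def)
    from glue_part_contact[OF i j _ this] show ?thesis using 2 False V n by (simp add: normalized_def)
  next
    case 3
    show ?thesis
    proof (cases "\<exists>b. contact j i x b")
      case True
      then obtain b where b: "contact j i x b" by blast
      then have "contact k i y b" using V eq by (simp add: contact_def)
      then show ?thesis
        using glue_part_contact[OF i j _ b] glue_part_contact[OF i k, of y b] 3 V n by (simp add: normalized_def)
    next
      case False
      then have "\<nexists>b. contact k i y b" using V eq by (simp add: contact_def)
      then show ?thesis using glue_part_vertex[OF n i] False 3 V j k by metis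
    qed
  qed
qed

lemma glue_eq:
  assumes "normalized \<theta>" "i \<in> I" "j \<in> I" "x \<in> K"
  shows "glue \<theta> i g (f j x) = glue_part \<theta> i g j x"
proof -
  define q where "q = (SOME q. case q of (k, y) \<Rightarrow> k \<in> I \<and> y \<in> K \<and> f j x = f k y)"
  have "case q of (k, y) \<Rightarrow> k \<in> I \<and> y \<in> K \<and> f j x = f k y"
    unfolding q_def by (rule someI[of _ "(j,x)"]) (use assms in auto)
  then show ?thesis
    using glue_compat[OF assms(1,2,3) _ assms(4)]
    unfolding glue_def q_def[symmetric] Let_def by (auto split: prod.splits)
qed

end

section \<open>Extension of test functions and the lower bound for the dual metric\<close>

context gasket_weights
begin

lemma normalized_theta: "normalized \<theta>"
  using theta_vertex by (simp add: normalized_def)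

text \<open>Weights of cells with the same parent are comparable up to constants. Hence a function of amplitude
  \<open>e0\<close> on one of them may be damped to 0 across its touching siblings without becoming too steep.\<close>

definition "e0 = \<epsilon>\<^sup>2 * rmin powr \<alpha> / (2 * C0)"

lemma e0: "0 < e0" "e0 \<le> 1/2"
proof -
  show "0 < e0" using eps C0 rmin_pos by (simp add: e0_def)
  have "rmin powr \<alpha> \<le> 1" using rmin_pos rmin_le_rmax rmax_less_1 alpha_pos by (intro powr_le1) auto
  then have "\<epsilon>\<^sup>2 * rmin powr \<alpha> \<le> 1 * C0"
    using eps C0 mult_mono[of "\<epsilon>\<^sup>2" 1 "rmin powr \<alpha>" 1] by (simp add: power_le_one)
  then show "e0 \<le> 1/2" using C0 by (simp add: e0_def field_simps)
qed

lemma R_letter: "i \<in> I \<Longrightarrow> rmin powr \<alpha> * \<epsilon> \<le> R s [i]" "i \<in> I \<Longrightarrow> R s [i] \<le> 1"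
proof -
  assume i: "i \<in> I"
  show "R s [i] \<le> 1" using R_le_1[of "[i]" s] i by simp
  have "rmin powr \<alpha> * \<epsilon> \<le> r i powr \<alpha> * (if step s i = Some i then 1 else \<epsilon>)"
    using rmin_le[OF i] rmin_pos alpha_pos eps by (intro mult_mono powr_mono2) auto
  then show "rmin powr \<alpha> * \<epsilon> \<le> R s [i]" using i by simp
qed

text \<open>The factor \<open>R s [i]\<close> turns a test function for the state after
  \<open>i\<close> into one on the cell \<open>i\<close>; gluing continues it to \<open>K\<close>.
  The bound \<open>e0\<close> is reproduced, so the construction can be iterated along a
  word.\<close>

lemma extend_letter:
  assumes i: "i \<in> I" and t: "tame (step s i) \<phi>" and b: "\<And>x. x \<in> K \<Longrightarrow> \<bar>\<phi> x\<bar> \<le> e0"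
  defines "\<phi>' \<equiv> glue \<theta> i (\<lambda>x. R s [i] * \<phi> x)"
  shows "tame s \<phi>'" "x \<in> K \<Longrightarrow> \<bar>\<phi>' x\<bar> \<le> e0"
proof -
  let ?g = "\<lambda>x. R s [i] * \<phi> x"
  have eq: "\<phi>' (f j x) = glue_part \<theta> i ?g j x" if "j \<in> I" "x \<in> K" for j x
    unfolding \<phi>'_def by (rule glue_eq[OF normalized_theta i that])
  have g: "\<bar>?g x\<bar> \<le> e0" if "x \<in> K" for x
    using mult_mono[of "R s [i]" 1 "\<bar>\<phi> x\<bar>" e0] R_letter(2)[OF i, of s] b[OF that] e0 R_nonneg[of "[i]" s] i
    by (simp add: abs_mult del: \<rho>_simps)
  have bound: "\<bar>\<phi>' x\<bar> \<le> e0" if x: "x \<in> K" for x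
  proof -
    obtain j y where j: "j \<in> I" "y \<in> K" "x = f j y" using K_cases[OF x] .
    consider "j = i" | "i \<noteq> j" "f j ` K \<inter> f i ` K = {}" | a b where "i \<noteq> j" "contact j i a b"
      using contact_cases[OF i j(1)] by blast
    then show ?thesis
    proof cases
      case 1 then show ?thesis using eq[OF j(1,2)] j g by simp
    next
      case 2 then show ?thesis using eq[OF j(1,2)] j e0 glue_part_disjoint[OF i j(1)] by simp
    next
      case (3 a b)
      then have ab: "a \<in> V" "b \<in> V" by (auto simp: contact_def)
      have "\<bar>?g b\<bar> * \<bar>\<theta> a y\<bar> \<le> e0 * 1"
        using g[of b] ab V_K theta_01[OF ab(1) j(2)] e0 by (intro mult_mono) auto
      then show ?thesis using eq[OF j(1,2)] j glue_part_contact[OF i j(1) 3] by (simp add: abs_mult)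
    qed
  qed
  then show "x \<in> K \<Longrightarrow> \<bar>\<phi>' x\<bar> \<le> e0" .
  show "tame s \<phi>'"
    unfolding tame_def
  proof (intro ballI)
    fix w x y assume w: "w \<in> lists I" and x: "x \<in> K" and y: "y \<in> K"
    show "\<bar>\<phi>' (fw w x) - \<phi>' (fw w y)\<bar> \<le> R s w"
    proof (cases w)
      case Nil
      \<comment> \<open>For the empty word the oscillation is at most \<open>2 * e0\<close>, which
        must not exceed the weight 1; hence the factor 2 in \<open>e0\<close>.\<close>
      then show ?thesis using bound[OF x] bound[OF y] e0 by simp
    next
      case (Cons k v)
      then have k: "k \<in> I" and v: "v \<in> lists I" using w by auto
      let ?x = "fw v x" and ?y = "fw v y"
      have xy: "?x \<in> K" "?y \<in> K" using v x y by auto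
      have eq': "\<phi>' (fw w x) = glue_part \<theta> i ?g k ?x" "\<phi>' (fw w y) = glue_part \<theta> i ?g k ?y"
        using eq[OF k] xy Cons by auto
      have Rw: "R s w = R s [k] * R (step s k) v" using k v Cons by simp
      consider "k = i" | "i \<noteq> k" "f k ` K \<inter> f i ` K = {}" | a b where "i \<noteq> k" "contact k i a b"
        using contact_cases[OF i k] by blast
      then show ?thesis
      proof cases
        case 1
        have "\<bar>\<phi> ?x - \<phi> ?y\<bar> \<le> R (step s i) v" using t v x y by (auto simp: tame_def)
        then have "R s [i] * \<bar>\<phi> ?x - \<phi> ?y\<bar> \<le> R s [i] * R (step s i) v"
          using R_nonneg[of "[i]" s] i by (intro mult_left_mono) auto
        then show ?thesis using 1 eq' Rw R_nonneg[of "[i]" s] i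
          by (simp add: abs_mult del: \<rho>_simps flip: right_diff_distrib)
      next
        case 2 then show ?thesis using eq' glue_part_disjoint[OF i k] R_nonneg[OF w] by simp
      next
        case (3 a b)
        then have ab: "a \<in> V" "b \<in> V" by (auto simp: contact_def)
        have "\<bar>\<phi>' (fw w x) - \<phi>' (fw w y)\<bar> = \<bar>?g b\<bar> * \<bar>\<theta> a ?x - \<theta> a ?y\<bar>"
          unfolding eq' glue_part_contact[OF i k 3] by (simp add: abs_mult flip: right_diff_distrib)
        also have "\<dots> \<le> e0 * (C0 * R None v)"
          using g[of b] ab V_K theta_osc[OF ab(1) v x y] e0 by (intro mult_mono) auto
        also have "\<dots> = (1/2) * (rmin powr \<alpha> * \<epsilon> * (\<epsilon> * R None v))"
          using C0 by (simp add: e0_def power2_eq_square)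
        \<comment> \<open>Both factors \<open>\<epsilon>\<close> of \<open>e0\<close> are spent
          here: one bounds the weight of the letter \<open>k\<close> from below, the other changes
          the state \<open>None\<close> into \<open>step s k\<close>.\<close>
        also have "\<dots> \<le> 1 * (R s [k] * R (step s k) v)"
          using R_letter[OF k] R_compare[OF v] R_nonneg[OF v] R_nonneg[of "[k]" s] k eps rmin_pos
          by (intro mult_mono) auto
        finally show ?thesis using Rw by simp
      qed
    qed
  qed
qed

text \<open>Iterates \<open>extend_letter\<close> from the innermost cell outwards.\<close>

lemma extend_word:
  assumes "w \<in> lists I" "tame (foldl step s w) \<phi>" "\<And>x. x \<in> K \<Longrightarrow> \<bar>\<phi> x\<bar> \<le> e0"
  shows "\<exists>\<phi>'. tame s \<phi>' \<and> (\<forall>x\<in>K. \<bar>\<phi>' x\<bar> \<le> e0) \<and> (\<forall>x\<in>K. \<phi>' (fw w x) = R s w * \<phi> x)"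
  using assms
proof (induction w arbitrary: s)
  case Nil
  then show ?case by (intro exI[of _ \<phi>]) auto
next
  case (Cons i w)
  have i: "i \<in> I" "w \<in> lists I" using Cons.hyps by auto
  have "tame (foldl step (step s i) w) \<phi>" using Cons.prems by simp
  from Cons.IH[OF this Cons.prems(2)]
  obtain \<phi>1 where \<phi>1: "tame (step s i) \<phi>1" "\<forall>x\<in>K. \<bar>\<phi>1 x\<bar> \<le> e0" "\<forall>x\<in>K. \<phi>1 (fw w x) = R (step s i) w * \<phi> x"
    by blast
  let ?\<phi> = "glue \<theta> i (\<lambda>x. R s [i] * \<phi>1 x)"
  have "?\<phi> (fw (i # w) x) = R s (i # w) * \<phi> x" if "x \<in> K" for x
    using glue_eq[OF normalized_theta i(1) i(1), of "fw w x"] i that \<phi>1(3) by simp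
  then show ?case
    using extend_letter[OF i(1) \<phi>1(1)] \<phi>1(2) by (intro exI[of _ ?\<phi>]) blast
qed

definition "cL = rmin powr \<alpha> * \<epsilon> * e0 * min 1 c0"

lemma cL_pos: "0 < cL"
  using rmin_pos eps e0 c0 by (simp add: cL_def)

text \<open>The test function is the constant \<open>e0\<close> on the child \<open>i\<close> of the
  cell \<open>u\<close>, scaled by the weights and glued to the rest of \<open>K\<close>. On the
  sibling \<open>j\<close> it is 0 or a multiple of \<open>\<theta> a\<close>, and then the
  difference is a multiple of \<open>1 - \<theta> a y\<close>.\<close>

lemma D_siblings:
  assumes u: "u \<in> lists I" and i: "i \<in> I" and j: "j \<in> I" and ij: "i \<noteq> j" and x: "x \<in> K" and y: "y \<in> K"
  shows "f j ` K \<inter> f i ` K = {} \<Longrightarrow> cL * R None u \<le> D (fw u (f i x)) (fw u (f j y))"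
    and "contact j i a b \<Longrightarrow> cL * R None u * dist y a powr \<alpha> \<le> D (fw u (f i x)) (fw u (f j y))"
proof -
  define s where "s = foldl step None u"
  define g where "g = (\<lambda>x::'a. R s [i] * e0)"
  define \<phi> where "\<phi> = glue \<theta> i g"
  have c: "tame (step s i) (\<lambda>x. e0)" using R_nonneg by (auto simp: tame_def)
  have "tame s \<phi>" "\<And>x. x \<in> K \<Longrightarrow> \<bar>\<phi> x\<bar> \<le> e0"
    unfolding \<phi>_def g_def using extend_letter[OF i c] e0 by auto
  then obtain \<phi>' where \<phi>': "tame None \<phi>'" "\<forall>x\<in>K. \<phi>' (fw u x) = R None u * \<phi> x"
    using extend_word[OF u, of None \<phi>] s_def by blast
  have "\<bar>\<phi>' (fw u (f i x)) - \<phi>' (fw u (f j y))\<bar> \<le> D (fw u (f i x)) (fw u (f j y))"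
    using \<phi>' u i j x y by (intro D_ge) auto
  then have D: "R None u * \<bar>\<phi> (f i x) - \<phi> (f j y)\<bar> \<le> D (fw u (f i x)) (fw u (f j y))"
    using \<phi>'(2) x y i j R_nonneg[OF u] by (simp add: abs_mult flip: right_diff_distrib)
  have \<phi>x: "\<phi> (f i x) = R s [i] * e0"
    unfolding \<phi>_def using glue_eq[OF normalized_theta i i x] by (simp add: g_def)
  have \<phi>y: "\<phi> (f j y) = glue_part \<theta> i g j y"
    unfolding \<phi>_def by (rule glue_eq[OF normalized_theta i j y])
  have low: "cL * z \<le> R s [i] * e0 * z'" if "min 1 c0 * z \<le> z'" "0 \<le> z" for z z'
  proof -
    have "cL * z = rmin powr \<alpha> * \<epsilon> * e0 * (min 1 c0 * z)" by (simp add: cL_def)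
    also have "\<dots> \<le> R s [i] * e0 * z'"
      using R_letter[OF i, of s] e0 that c0 R_nonneg[of "[i]" s] i by (intro mult_mono) auto
    finally show ?thesis .
  qed
  { assume "f j ` K \<inter> f i ` K = {}"
    then have "\<bar>\<phi> (f i x) - \<phi> (f j y)\<bar> = R s [i] * e0"
      using \<phi>x \<phi>y glue_part_disjoint[OF i j ij] e0 R_nonneg[of "[i]" s] i by simp
    with low[of 1 1] have "cL \<le> \<bar>\<phi> (f i x) - \<phi> (f j y)\<bar>" by simp
    from mult_left_mono[OF this R_nonneg[OF u, of None]] D
    show "cL * R None u \<le> D (fw u (f i x)) (fw u (f j y))" by (simp add: mult.commute) }
  { assume ab: "contact j i a b"
    then have a: "a \<in> V" by (simp add: contact_def)
    have "\<phi> (f i x) - \<phi> (f j y) = R s [i] * e0 * (1 - \<theta> a y)"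
      using \<phi>x \<phi>y glue_part_contact[OF i j ij ab] by (simp add: g_def algebra_simps)
    moreover have "min 1 c0 * dist y a powr \<alpha> \<le> 1 - \<theta> a y"
      using theta_sep[OF a y] mult_right_mono[of "min 1 c0" c0 "dist y a powr \<alpha>"] by simp
    ultimately have "cL * dist y a powr \<alpha> \<le> \<bar>\<phi> (f i x) - \<phi> (f j y)\<bar>"
      using low[of "dist y a powr \<alpha>" "1 - \<theta> a y"] by simp
    from mult_left_mono[OF this R_nonneg[OF u, of None]] D
    show "cL * R None u * dist y a powr \<alpha> \<le> D (fw u (f i x)) (fw u (f j y))" by (simp add: mult_ac) }
qed

text \<open>The 2 stems from the triangle inequality through a contact point, \<open>diamK\<close>
  from disjoint children.\<close>

definition "cD = cL * (2 * diamK) powr (-\<alpha>)"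

lemma cD_pos: "0 < cD"
  using cL_pos diamK(1) by (simp add: cD_def)

text \<open>The weight of the separating cell \<open>u\<close> already contains the factor
  \<open>rw u powr \<alpha>\<close> of the distance. If the children touch, the cut function is
  placed on the child whose point is farther from the contact vertex in its own coordinates; this
  decides between the two uses of \<open>D_siblings\<close>.\<close>

lemma D_ge_dist:
  assumes "x \<in> K" "y \<in> K" "x \<noteq> y"
  shows "\<exists>w\<in>lists I. \<exists>x0\<in>K. \<exists>y0\<in>K. x = fw w x0 \<and> y = fw w y0 \<and> cD * h None w * dist x y powr \<alpha> \<le> D x y"
proof -
  obtain u i j x' y' where u: "u \<in> lists I" "i \<in> I" "j \<in> I" "x' \<in> K" "y' \<in> K" "i \<noteq> j"
    "x = fw u (f i x')" "y = fw u (f j y')"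
    using separating_word[OF assms] by blast
  have dxy: "dist x y = rw u * dist (f i x') (f j y')"
    using u by (simp add: dist_fw)
  have le: "cD * h None u * dist x y powr \<alpha> \<le> cL * R None u * z"
    if z: "(dist (f i x') (f j y') / (2 * diamK)) powr \<alpha> \<le> z" for z
  proof -
    have "cD * h None u * dist x y powr \<alpha> = cL * R None u * (dist (f i x') (f j y') / (2 * diamK)) powr \<alpha>"
      unfolding dxy cD_def \<rho>_def using rw_pos[OF u(1)] diamK(1)
      by (simp add: powr_mult powr_divide powr_minus_divide)
    also have "\<dots> \<le> cL * R None u * z"
      using z cL_pos R_nonneg[OF u(1)] by (intro mult_left_mono) auto
    finally show ?thesis .
  qed
  have "cD * h None u * dist x y powr \<alpha> \<le> D x y"
  proof (cases "f j ` K \<inter> f i ` K = {}")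
    case True
    have "(dist (f i x') (f j y') / (2 * diamK)) powr \<alpha> \<le> 1"
      using diamK(1) u alpha_pos diamK(2)[of "f i x'" "f j y'"] by (intro powr_le1) auto
    from le[OF this] show ?thesis using D_siblings(1)[OF u(1,2,3,6,4,5) True] u by simp
  next
    case False
    then obtain a b where ab: "contact j i a b" using contact_cases[OF u(2,3,6)] by blast
    then have ba: "contact i j b a" by (simp add: contact_def)
    have V: "a \<in> V" "b \<in> V" and eq: "f j a = f i b" using ab by (auto simp: contact_def)
    define m where "m = max (dist y' a) (dist x' b)"
    have "dist (f i x') (f j y') \<le> dist (f i x') (f i b) + dist (f j a) (f j y')"
      using dist_triangle[of "f i x'" "f j y'" "f i b"] eq by simp
    also have "\<dots> = r i * dist x' b + r j * dist y' a"
      using u V V_K by (simp add: dist_f dist_commute)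
    also have "\<dots> \<le> 1 * m + 1 * m"
      using u r_less_1 r_pos by (intro add_mono mult_mono) (auto simp: m_def intro: less_imp_le)
    also have "\<dots> \<le> m * (2 * diamK)"
      using diamK(1) mult_left_mono[of 1 diamK "2 * m"] by (simp add: m_def mult_ac le_max_iff_disj)
    finally have "(dist (f i x') (f j y') / (2 * diamK)) powr \<alpha> \<le> m powr \<alpha>"
      using diamK(1) alpha_pos by (intro powr_mono2) (auto simp: field_simps)
    from le[OF this] have "cD * h None u * dist x y powr \<alpha> \<le> cL * R None u * m powr \<alpha>" .
    also have "\<dots> \<le> D x y"
      using D_siblings(2)[OF u(1,2,3,6,4,5) ab] D_siblings(2)[OF u(1,3,2) u(6)[symmetric] u(5,4) ba] u D_commute
      by (cases "dist y' a \<le> dist x' b") (auto simp: m_def max_def)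
    finally show ?thesis .
  qed
  then show ?thesis using u by (intro bexI[of _ u] bexI[of _ "f i x'"] bexI[of _ "f j y'"]) auto
qed

end

section \<open>Two general facts: homeomorphisms of the half-line, and covers that bound the
  Hausdorff dimension\<close>

lemma homeomorphism_half_line:
  fixes \<eta> :: "real \<Rightarrow> real"
  assumes cont: "continuous_on {0..} \<eta>" and mono: "strict_mono_on {0..} \<eta>" and zero: "\<eta> 0 = 0"
    and unbounded: "\<And>y. 0 \<le> y \<Longrightarrow> \<exists>t\<ge>0. y \<le> \<eta> t"
  shows "\<exists>\<eta>'. homeomorphism {0..} {0..} \<eta> \<eta>'"
proof -
  have inj: "inj_on \<eta> {0..}" using mono by (rule strict_mono_on_imp_inj_on)
  have pos: "0 \<le> \<eta> t" if "0 \<le> t" for t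
    using that zero strict_mono_onD[OF mono, of 0 t] by (cases "t = 0") auto
  have img: "\<eta> ` {0..} = {0..}"
  proof (intro antisym subsetI)
    fix y :: real assume y: "y \<in> {0..}"
    then obtain t where t: "0 \<le> t" "y \<le> \<eta> t" using unbounded by auto
    then obtain s where "0 \<le> s" "s \<le> t" "\<eta> s = y"
      using IVT'[of \<eta> 0 y t] zero y continuous_on_subset[OF cont, of "{0..t}"] by auto
    then show "y \<in> \<eta> ` {0..}" by auto
  qed (use pos in auto)
  \<comment> \<open>The inverse is continued by the identity to negative numbers: it is then
    monotone with range the whole line, and monotone functions with open range are
    continuous.\<close>
  define G where "G y = (if 0 \<le> y then inv_into {0..} \<eta> y else y)" for y
  have G: "G (\<eta> t) = t" if "0 \<le> t" for t
    using that pos[OF that] inj by (simp add: G_def)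
  have G': "0 \<le> G y" "\<eta> (G y) = y" if "0 \<le> y" for y
    using that img inv_into_into[of y \<eta> "{0..}"] f_inv_into_f[of y \<eta> "{0..}"] by (auto simp: G_def)
  have "G x \<le> G y" if "x \<le> y" for x y
  proof (cases "0 \<le> x")
    case True
    show ?thesis
    proof (rule ccontr)
      assume "\<not> G x \<le> G y"
      then have "\<eta> (G y) < \<eta> (G x)"
        using G'(1)[of x] G'(1)[of y] True that by (intro strict_mono_onD[OF mono]) auto
      then show False using G' True that by simp
    qed
  next
    case False
    then show ?thesis using G'(1)[of y] that by (cases "0 \<le> y") (auto simp: G_def)
  qed
  moreover have "range G = UNIV"
  proof -
    have "x \<in> range G" for x
    proof (cases "0 \<le> x")
      case True then show ?thesis using G[of x] by (metis rangeI)
    next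
      case False then have "G x = x" by (simp add: G_def)
      then show ?thesis by (metis rangeI)
    qed
    then show ?thesis by auto
  qed
  ultimately have "continuous_on UNIV G" by (intro continuous_onI_mono) auto
  then have "continuous_on {0..} G" by (rule continuous_on_subset) simp
  moreover have "G ` {0..} = {0..}"
  proof (intro antisym subsetI)
    fix t :: real assume "t \<in> {0..}"
    then show "t \<in> G ` {0..}" using G[of t] pos[of t] by (intro image_eqI[of _ _ "\<eta> t"]) auto
  qed (use G' in auto)
  ultimately have "homeomorphism {0..} {0..} \<eta> G"
    using cont G G' img unfolding homeomorphism_def by auto
  then show ?thesis by blast
qed

lemma hausdorff_dim_le:
  fixes m :: "'b metric"
  assumes p: "0 < p"
    and cover: "\<And>e. 0 < e \<Longrightarrow> \<exists>(S :: 'c set) U b. finite S \<and> mspace m \<subseteq> (\<Union>w\<in>S. U w) \<and>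
      (\<forall>w\<in>S. U w \<subseteq> mspace m \<and> 0 \<le> b w \<and> (\<forall>x\<in>U w. \<forall>y\<in>U w. mdist m x y \<le> b w)) \<and> (\<Sum>w\<in>S. b w powr p) \<le> e"
  shows "hausdorff_dim m \<le> ennreal p"
proof -
  have "hausdorff_premeasure m p \<delta> (mspace m) \<le> ennreal e" if \<delta>: "0 < \<delta>" and e: "0 < e" for \<delta> e
  proof -
    \<comment> \<open>If the sum of the powers is at most \<open>\<delta> powr p\<close>, then every
      single \<open>b w\<close> is at most \<open>\<delta>\<close>, so the cover is admissible at
      scale \<open>\<delta>\<close>.\<close>
    have "0 < min e (\<delta> powr p)" using \<delta> e by simp
    from cover[OF this] obtain S :: "'c set" and U b where *: "finite S \<and> mspace m \<subseteq> (\<Union>w\<in>S. U w) \<and>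
      (\<forall>w\<in>S. U w \<subseteq> mspace m \<and> 0 \<le> b w \<and> (\<forall>x\<in>U w. \<forall>y\<in>U w. mdist m x y \<le> b w)) \<and>
      (\<Sum>w\<in>S. b w powr p) \<le> min e (\<delta> powr p)"
      by (elim exE) (rule that)
    then have S: "finite S" "mspace m \<subseteq> (\<Union>w\<in>S. U w)"
      "\<And>w. w \<in> S \<Longrightarrow> U w \<subseteq> mspace m" "\<And>w. w \<in> S \<Longrightarrow> 0 \<le> b w"
      "\<And>w x y. w \<in> S \<Longrightarrow> x \<in> U w \<Longrightarrow> y \<in> U w \<Longrightarrow> mdist m x y \<le> b w"
      "(\<Sum>w\<in>S. b w powr p) \<le> min e (\<delta> powr p)"
      by (simp_all only: Ball_def)
    obtain g where g: "bij_betw g {0..<card S} S" using ex_bij_betw_nat_finite[OF S(1)] by blast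
    \<comment> \<open>The finite cover is padded by empty sets, which the gauge counts as 0.\<close>
    define W where "W i = (if i < card S then U (g i) else {})" for i
    have gS: "g i \<in> S" if "i < card S" for i using g that by (auto simp: bij_betw_def)
    have diam: "mdiam m (U w) \<le> ennreal (b w)" if "w \<in> S" for w
      unfolding mdiam_def using S(5)[OF that] by (intro SUP_least ennreal_leI) auto
    have b: "b w \<le> \<delta>" if "w \<in> S" for w
    proof -
      have "b w powr p \<le> (\<Sum>w\<in>S. b w powr p)" using that S(1) by (intro member_le_sum) auto
      then have "b w powr p \<le> \<delta> powr p" using S(6) by simp
      then show ?thesis using powr_less_mono2[OF p, of \<delta> "b w"] \<delta> by linarith
    qed
    have gauge: "hausdorff_gauge m p (U w) \<le> ennreal (b w powr p)" if "w \<in> S" for w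
    proof -
      have "enn2real (mdiam m (U w)) \<le> b w" using diam[OF that] S(4)[OF that] by (rule enn2real_leI[rotated])
      then have "enn2real (mdiam m (U w)) powr p \<le> b w powr p" using p by (intro powr_mono2) auto
      then show ?thesis using p by (auto simp: hausdorff_gauge_def intro: ennreal_leI)
    qed
    have "hausdorff_premeasure m p \<delta> (mspace m) \<le> (\<Sum>i. hausdorff_gauge m p (W i))"
      unfolding hausdorff_premeasure_def
    proof (rule INF_lower, intro CollectI conjI allI)
      show "W i \<subseteq> mspace m" for i using S(3) gS by (auto simp: W_def)
      show "mdiam m (W i) \<le> ennreal \<delta>" for i
      proof (cases "i < card S")
        case True
        then have "mdiam m (U (g i)) \<le> ennreal (b (g i))" "b (g i) \<le> \<delta>"
          using diam b gS by auto
        then have "mdiam m (U (g i)) \<le> ennreal \<delta>" by (meson ennreal_leI order_trans)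
        then show ?thesis using True by (simp add: W_def)
      qed (simp add: W_def mdiam_def)
      show "mspace m \<subseteq> (\<Union>i. W i)"
      proof
        fix x assume "x \<in> mspace m"
        then obtain w where w: "w \<in> S" "x \<in> U w" using S(2) by blast
        have "w \<in> g ` {0..<card S}" using w(1) by (simp only: bij_betw_imp_surj_on[OF g])
        then obtain i where "i < card S" "w = g i" by (meson atLeastLessThan_iff imageE)
        then have "x \<in> W i" using w(2) by (simp add: W_def)
        then show "x \<in> (\<Union>i. W i)" by blast
      qed
    qed
    also have "\<dots> = (\<Sum>i\<in>{0..<card S}. hausdorff_gauge m p (W i))"
      by (intro suminf_finite) (auto simp: W_def hausdorff_gauge_def)
    also have "\<dots> = (\<Sum>i\<in>{0..<card S}. hausdorff_gauge m p (U (g i)))"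
      by (intro sum.cong) (auto simp: W_def)
    also have "\<dots> = (\<Sum>w\<in>S. hausdorff_gauge m p (U w))"
      by (rule sum.reindex_bij_betw[OF g])
    also have "\<dots> \<le> (\<Sum>w\<in>S. ennreal (b w powr p))" by (intro sum_mono gauge)
    also have "\<dots> = ennreal (\<Sum>w\<in>S. b w powr p)" by (intro sum_ennreal) auto
    also have "\<dots> \<le> ennreal e" using S(6) by (intro ennreal_leI) auto
    finally show ?thesis .
  qed
  then have "hausdorff_measure m p (mspace m) \<le> ennreal e" if "0 < e" for e
    unfolding hausdorff_measure_def using that by (intro SUP_least) auto
  then have "hausdorff_measure m p (mspace m) \<le> 0"
    using ennreal_le_epsilon[of 0 "hausdorff_measure m p (mspace m)"] by simp
  then show ?thesis
    unfolding hausdorff_dim_def using p by (intro INF_lower2[of p]) auto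
qed


section \<open>Quasisymmetry\<close>

context gasket_ifs
begin

definition words :: "nat \<Rightarrow> 'i list set" where
  "words n = {w. set w \<subseteq> I \<and> length w = n}"

lemma finite_words: "finite (words n)"
  unfolding words_def using finite_I by (rule finite_lists_length_eq)

lemma K_words: "x \<in> K \<Longrightarrow> \<exists>w\<in>words n. x \<in> fw w ` K"
proof (induction n arbitrary: x)
  case 0
  then show ?case by (auto simp: words_def)
next
  case (Suc n)
  obtain i y where i: "i \<in> I" "y \<in> K" "x = f i y" using K_cases[OF Suc.prems] .
  obtain w y' where "w \<in> words n" "y' \<in> K" "y = fw w y'" using Suc.IH[OF i(2)] by blast
  then show ?case using i by (intro bexI[of _ "i # w"]) (auto simp: words_def)
qed

end

section \<open>Penalties compared with distances\<close>

context gasket_weights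
begin

text \<open>Chosen such that \<open>rmax powr \<beta> = \<epsilon>\<close>: one penalty is then at
  least \<open>r i powr \<beta>\<close>, so that all penalties together cost no more than a power of
  the ratio, see \<open>h_ge\<close>.\<close>

definition "\<beta> = ln \<epsilon> / ln rmax"

lemma rmax_beta: "0 \<le> \<beta>" "rmax powr \<beta> = \<epsilon>"
proof -
  have "0 < rmax" using rmin_pos rmin_le_rmax by simp
  moreover have "ln rmax < 0" using calculation rmax_less_1 by simp
  ultimately show "0 \<le> \<beta>" "rmax powr \<beta> = \<epsilon>"
    using eps by (auto simp: \<beta>_def powr_def intro: divide_nonpos_neg)
qed

lemma h_ge: "w \<in> lists I \<Longrightarrow> rw w powr \<beta> \<le> h s w"
proof (induction w arbitrary: s)
  case (Cons i w)
  then have i: "i \<in> I" "w \<in> lists I" by auto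
  have "r i powr \<beta> \<le> \<epsilon>"
    using powr_mono2[OF rmax_beta(1) _ rmax_ge[OF i(1)]] r_pos[OF i(1)] rmax_beta by simp
  then have "r i powr \<beta> * rw w powr \<beta> \<le> (if step s i = Some i then 1 else \<epsilon>) * h (step s i) w"
    using Cons.IH[OF i(2)] eps by (intro mult_mono) auto
  then show ?case using r_pos[OF i(1)] rw_pos[OF i(2)] by (simp add: powr_mult)
qed simp

text \<open>The penalties of \<open>w\<close> are at least \<open>rw w powr \<beta>\<close>, and the
  relative distance \<open>d / rw w\<close> makes up for exactly this power.\<close>

lemma far_point:
  assumes w: "w \<in> lists I" and g: "0 < g" "g \<le> d"
  shows "g powr \<beta> \<le> h s w * (1 + d / rw w) powr \<beta>"
proof -
  have w0: "0 < rw w" by (rule rw_pos[OF w])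
  then have "g powr \<beta> = rw w powr \<beta> * (g / rw w) powr \<beta>"
    using g by (simp add: powr_divide)
  also have "\<dots> \<le> h s w * (1 + d / rw w) powr \<beta>"
    using h_ge[OF w] w0 g rmax_beta(1)
    by (intro mult_mono powr_mono2) (auto simp: divide_right_mono intro: add_increasing less_imp_le h_pos)
  finally show ?thesis .
qed

text \<open>As long as \<open>v\<close> repeats the corner letter of \<open>a\<close>, nothing is
  paid and the quotient of distance and ratio does not change. At the first other letter the
  distance is at least \<open>gap\<close>, and \<open>far_point\<close> applies.\<close>

lemma near_vertex:
  assumes a: "a \<in> V" and x: "x \<in> K" and v: "v \<in> lists I"
  shows "gap powr \<beta> \<le> h (Some (corner a)) v * (1 + dist (fw v x) a / rw v) powr \<beta>"
  using v
proof (induction v)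
  case Nil
  have "gap powr \<beta> \<le> 1" using gap(1,2) rmax_beta(1) by (intro powr_le1) auto
  also have "\<dots> \<le> (1 + dist x a) powr \<beta>" using rmax_beta(1) by (intro ge_one_powr_ge_zero) auto
  finally show ?case by simp
next
  case (Cons k v)
  then have k: "k \<in> I" "v \<in> lists I" by auto
  show ?case
  proof (cases "k = corner a")
    case True
    have "dist (f k (fw v x)) a = r k * dist (fw v x) a"
      using dist_f[OF k(1), of "fw v x" a] corner_fix[OF a] True k x V_K[OF a] by simp
    then show ?thesis using Cons True a k r_pos[OF k(1)] by simp
  next
    case False
    have "gap \<le> dist (fw (k # v) x) a" using gap(4)[OF a k(1) False, of "fw v x"] k x by simp
    from far_point[OF _ gap(1) this, of "k # v"] show ?thesis using k by simp
  qed
qed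

definition "cg = \<epsilon>\<^sup>2 * (min 1 \<kappa>) powr \<beta> * gap powr \<beta>"

lemma cg: "0 < cg" "cg \<le> 1" "cg \<le> gap powr \<beta>"
proof -
  show "0 < cg" using eps kappa_pos gap(1) by (simp add: cg_def)
  have g: "gap powr \<beta> \<le> 1" using gap(1,2) rmax_beta(1) by (intro powr_le1) auto
  have k: "(min 1 \<kappa>) powr \<beta> \<le> 1" using kappa_pos rmax_beta(1) by (intro powr_le1) auto
  have "\<epsilon>\<^sup>2 * (min 1 \<kappa>) powr \<beta> \<le> 1 * 1"
    using k eps by (intro mult_mono) (auto simp: power_le_one)
  then show "cg \<le> gap powr \<beta>" using gap(1) by (simp add: cg_def mult_left_le_one_le)
  then show "cg \<le> 1" using g by simp
qed

text \<open>If the cells touch, \<open>cone\<close> bounds the distance of the first point from the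
  contact point, and \<open>near_vertex\<close> at the contact vertex \<open>b\<close> bounds the
  penalties.\<close>

lemma near_sibling:
  assumes i: "i \<in> I" and j: "j \<in> I" and ij: "i \<noteq> j" and x: "x \<in> K" and y: "y \<in> K" and v: "v \<in> lists I"
  shows "cg \<le> h s (i # v) * (1 + dist (fw (i # v) x) (f j y) / rw (i # v)) powr \<beta>"
proof (cases "f j ` K \<inter> f i ` K = {}")
  case True
  have "f i ` K \<inter> f j ` K = {}" using True by blast
  from gap(3)[OF i j this] have "gap \<le> dist (fw (i # v) x) (f j y)" using x y v by simp
  from far_point[OF _ gap(1) this, of "i # v" s] show ?thesis using i v cg(3) by simp
next
  case False
  then obtain a b where "contact j i a b" using contact_cases[OF i j ij] by blast
  then have ab: "a \<in> V" "b \<in> V" "f i b = f j a" by (auto simp: contact_def)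
  let ?X = "fw v x" and ?k = "min 1 \<kappa>"
  have X: "?X \<in> K" using v x by simp
  have r: "0 < r i" "0 < rw v" using r_pos i rw_pos v by auto
  have "?k * dist ?X b * r i \<le> \<kappa> * dist ?X b * r i"
    using r by (intro mult_right_mono) auto
  also have "\<dots> \<le> dist (f i ?X) (f j y)"
    using cone[OF i j ij V_K[OF ab(2)] V_K[OF ab(1)] ab(3) X y] dist_f[OF i X V_K[OF ab(2)]] by (simp add: mult_ac)
  finally have "?k * dist ?X b / rw v \<le> dist (f i ?X) (f j y) / (r i * rw v)"
    using r by (simp add: field_simps)
  then have le: "?k * (1 + dist ?X b / rw v) \<le> 1 + dist (f i ?X) (f j y) / (r i * rw v)"
    by (simp add: distrib_left)
  \<comment> \<open>One \<open>\<epsilon>\<close> pays for the letter \<open>i\<close>, the other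
    for replacing the state \<open>step s i\<close> by \<open>Some (corner b)\<close>.\<close>
  have "\<epsilon> * (\<epsilon> * h (Some (corner b)) v) \<le> (if step s i = Some i then 1 else \<epsilon>) * h (step s i) v"
  proof (rule mult_mono)
    have "\<epsilon> * h (Some (corner b)) v \<le> \<epsilon> * h None v"
      using hh_compare(1)[OF eps] eps by (intro mult_left_mono) auto
    also have "\<dots> \<le> h (step s i) v" by (rule hh_compare(2)[OF eps])
    finally show "\<epsilon> * h (Some (corner b)) v \<le> h (step s i) v" .
  qed (use eps h_pos[THEN less_imp_le] in auto)
  then have hle: "\<epsilon>\<^sup>2 * h (Some (corner b)) v \<le> h s (i # v)" by (simp add: power2_eq_square mult.assoc)
  have "cg = \<epsilon>\<^sup>2 * ?k powr \<beta> * gap powr \<beta>" by (simp add: cg_def)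
  also have "\<dots> \<le> \<epsilon>\<^sup>2 * ?k powr \<beta> * (h (Some (corner b)) v * (1 + dist ?X b / rw v) powr \<beta>)"
    using near_vertex[OF ab(2) x v] by (intro mult_left_mono) auto
  also have "\<dots> = (\<epsilon>\<^sup>2 * h (Some (corner b)) v) * (?k * (1 + dist ?X b / rw v)) powr \<beta>"
    using kappa_pos r by (simp add: powr_mult add_nonneg_nonneg)
  also have "\<dots> \<le> h s (i # v) * (1 + dist (f i ?X) (f j y) / (r i * rw v)) powr \<beta>"
    using hle le r kappa_pos rmax_beta(1) by (intro mult_mono powr_mono2) (auto intro: less_imp_le h_pos simp del: hh.simps)
  finally show ?thesis by simp
qed

text \<open>The key to quasisymmetry. The penalties that \<open>v\<close> collects after
  \<open>w\<close> are compensated by the distance of \<open>y\<close>, measured in units of the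
  size of the cell \<open>v\<close>. The constant \<open>cg\<close> is lost only once, at the letter
  where the addresses separate.\<close>

lemma common_prefix:
  assumes "v \<in> lists I" "x \<in> K" "y \<in> K"
  shows "\<exists>w u. v = w @ u \<and> y \<in> fw w ` K \<and> cg * h s w \<le> h s v * (1 + dist (fw v x) y / rw v) powr \<beta>"
  using assms(1,3)
proof (induction v arbitrary: s y)
  case Nil
  have "1 \<le> (1 + dist x y) powr \<beta>" using rmax_beta(1) by (intro ge_one_powr_ge_zero) auto
  then have "cg \<le> (1 + dist x y) powr \<beta>" using cg by linarith
  then show ?case using Nil by (intro exI[of _ "[]"]) auto
next
  case (Cons i v)
  have i: "i \<in> I" "v \<in> lists I" using Cons.hyps by auto
  obtain j y' where j: "j \<in> I" "y' \<in> K" "y = f j y'" using K_cases[OF Cons.prems] .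
  show ?case
  proof (cases "i = j")
    case True
    obtain w u where wu: "v = w @ u" "y' \<in> fw w ` K"
      "cg * h (step s i) w \<le> h (step s i) v * (1 + dist (fw v x) y' / rw v) powr \<beta>"
      using Cons.IH[OF j(2)] by blast
    have "dist (fw (i # v) x) y / rw (i # v) = dist (fw v x) y' / rw v"
      using j True i dist_f[OF i(1), of "fw v x" y'] r_pos[OF i(1)] assms(2) by simp
    moreover have "(if step s i = Some i then 1 else \<epsilon>) * (cg * h (step s i) w)
        \<le> (if step s i = Some i then 1 else \<epsilon>) * (h (step s i) v * (1 + dist (fw v x) y' / rw v) powr \<beta>)"
      using wu(3) eps by (intro mult_left_mono) auto
    ultimately have "cg * h s (i # w) \<le> h s (i # v) * (1 + dist (fw (i # v) x) y / rw (i # v)) powr \<beta>"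
      by (simp add: mult_ac)
    then show ?thesis using wu(1,2) j True by (intro exI[of _ "i # w"] exI[of _ u]) auto
  next
    case False
    have "cg * h s [] \<le> h s (i # v) * (1 + dist (fw (i # v) x) y / rw (i # v)) powr \<beta>"
      using near_sibling[OF i(1) j(1) False assms(2) j(2) i(2), of s] j(3) by simp
    then show ?thesis using Cons.prems by (intro exI[of _ "[]"] exI[of _ "i # v"]) auto
  qed
qed

definition "CQ = CU * diamK powr \<beta> / (cg * cD)"

lemma CQ_pos: "0 < CQ"
  using CU_pos cg cD_pos diamK(1) by (simp add: CQ_def)

text \<open>\<open>D x z\<close> is bounded below in a common cell \<open>v\<close> of
  \<open>x\<close> and \<open>z\<close>, and \<open>D x y\<close> above in a common cell
  \<open>w\<close> of \<open>x\<close> and \<open>y\<close>, where \<open>w\<close> is a prefix of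
  \<open>v\<close>. Since \<open>z\<close> lies in the cell \<open>v\<close>, the distance of
  \<open>x\<close> and \<open>y\<close> is at most \<open>t * diamK\<close> times the ratio of
  \<open>v\<close>, so \<open>common_prefix\<close> compares the two penalties.\<close>

lemma D_quasisymmetric:
  assumes x: "x \<in> K" and y: "y \<in> K" and z: "z \<in> K" and t: "0 \<le> t" and le: "dist x y \<le> t * dist x z"
  shows "D x y \<le> CQ * t powr \<alpha> * (1 + t) powr \<beta> * D x z"
proof (cases "x = z")
  case True
  then have "x = y" using le by simp
  then show ?thesis using True by simp
next
  case False
  obtain v x0 z0 where v: "v \<in> lists I" "x0 \<in> K" "z0 \<in> K" "x = fw v x0" "z = fw v z0"
    and lo: "cD * h None v * dist x z powr \<alpha> \<le> D x z"
    using D_ge_dist[OF x z False] by blast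
  obtain w u where wu: "v = w @ u" "y \<in> fw w ` K"
    and hw: "cg * h None w \<le> h None v * (1 + dist x y / rw v) powr \<beta>"
    using common_prefix[OF v(1,2) y, of None] v(4) by blast
  obtain y0 where y0: "y0 \<in> K" "y = fw w y0" using wu(2) by blast
  have w: "w \<in> lists I" "u \<in> lists I" using v(1) wu(1) by auto
  have rv: "0 < rw v" by (rule rw_pos[OF v(1)])
  have "D x y \<le> CU * h None w * dist x y powr \<alpha>"
    using D_le[OF w(1), of "fw u x0" y0] w v y0 wu by simp
  then have "cg * D x y \<le> cg * (CU * h None w * dist x y powr \<alpha>)"
    using cg by (intro mult_left_mono) auto
  also have "\<dots> = CU * (cg * h None w) * dist x y powr \<alpha>" by (simp add: mult_ac)
  also have "\<dots> \<le> CU * (h None v * (diamK * (1 + t)) powr \<beta>) * (t * dist x z) powr \<alpha>"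
  proof (rule mult_mono)
    have "dist x z \<le> rw v * diamK"
      unfolding v(4,5) using dist_fw[OF v(1-3)] diamK(2)[OF v(2,3)] rv by simp
    then have "dist x y \<le> t * (rw v * diamK)"
      using le mult_left_mono[OF _ t] by (meson order_trans)
    then have "dist x y / rw v \<le> t * diamK" using rv by (simp add: field_simps)
    then have "1 + dist x y / rw v \<le> diamK * (1 + t)" using diamK(1) by (simp add: algebra_simps)
    then have "(1 + dist x y / rw v) powr \<beta> \<le> (diamK * (1 + t)) powr \<beta>"
      using rmax_beta(1) rv by (intro powr_mono2) auto
    then have "h None v * (1 + dist x y / rw v) powr \<beta> \<le> h None v * (diamK * (1 + t)) powr \<beta>"
      using h_pos[of None v] by simp
    with hw have "cg * h None w \<le> h None v * (diamK * (1 + t)) powr \<beta>" by linarith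
    then show "CU * (cg * h None w) \<le> CU * (h None v * (diamK * (1 + t)) powr \<beta>)"
      using CU_pos by simp
    show "dist x y powr \<alpha> \<le> (t * dist x z) powr \<alpha>" using le alpha_pos by (intro powr_mono2) auto
    show "0 \<le> CU * (h None v * (diamK * (1 + t)) powr \<beta>)" using CU_pos h_pos[of None v] by simp
  qed simp
  also have "\<dots> = CU * diamK powr \<beta> / cD * t powr \<alpha> * (1 + t) powr \<beta> * (cD * h None v * dist x z powr \<alpha>)"
    using t diamK(1) cD_pos by (simp add: powr_mult mult_ac)
  also have "\<dots> \<le> CU * diamK powr \<beta> / cD * t powr \<alpha> * (1 + t) powr \<beta> * D x z"
    using lo CU_pos cD_pos by (intro mult_left_mono) auto
  finally show ?thesis using cg(1) cD_pos by (simp add: CQ_def field_simps)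
qed

text \<open>\<open>Metric_space\<close> demands nonnegativity for all arguments, and outside
  \<open>K\<close> the supremum in \<open>D\<close> may run over an unbounded set; hence the value 0
  there.\<close>

definition D_metric :: "'a metric" where
  "D_metric = metric (K, \<lambda>x y. if x \<in> K \<and> y \<in> K then D x y else 0)"

lemma Metric_space_D: "Metric_space K (\<lambda>x y. if x \<in> K \<and> y \<in> K then D x y else 0)"
proof
  fix x y assume xy: "x \<in> K" "y \<in> K"
  have "x = y" if "D x y = 0"
  proof (rule ccontr)
    assume ne: "x \<noteq> y"
    then obtain w where "w \<in> lists I" "cD * h None w * dist x y powr \<alpha> \<le> D x y"
      using D_ge_dist[OF xy] by blast
    moreover have "0 < cD * h None w * dist x y powr \<alpha>" using cD_pos h_pos ne by simp
    ultimately show False using that by simp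
  qed
  then show "(if x \<in> K \<and> y \<in> K then D x y else 0) = 0 \<longleftrightarrow> x = y" using xy by auto
qed (auto simp: D_commute D_nonneg D_triangle)

lemma mspace_D [simp]: "mspace D_metric = K"
  and mdist_D: "mdist D_metric = (\<lambda>x y. if x \<in> K \<and> y \<in> K then D x y else 0)"
  unfolding D_metric_def using Metric_space.mspace_metric[OF Metric_space_D] Metric_space.mdist_metric[OF Metric_space_D]
  by auto

text \<open>A continuous bijection from a compact space onto a Hausdorff space is a homeomorphism,
  so only continuity has to be shown; it follows from \<open>D_le\<close> for the empty
  word.\<close>

lemma homeomorphic_D: "homeomorphic_map (top_of_set K) (mtopology_of D_metric) id"
proof (rule continuous_imp_homeomorphic_map)
  interpret M: Metric_space K "\<lambda>x y. if x \<in> K \<and> y \<in> K then D x y else 0"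
    by (rule Metric_space_D)
  have top: "mtopology_of D_metric = M.mtopology"
    by (simp add: mtopology_of_def mdist_D)
  show "Hausdorff_space (mtopology_of D_metric)"
    unfolding top by (rule M.Hausdorff_space_mtopology)
  show "continuous_map (top_of_set K) (mtopology_of D_metric) id"
    unfolding top M.continuous_map_to_metric
  proof (intro ballI allI impI)
    fix x and e :: real assume x: "x \<in> topspace (top_of_set K)" and e: "0 < e"
    define \<delta> where "\<delta> = (e / CU) powr (1 / \<alpha>)"
    have \<delta>: "0 < \<delta>" using e CU_pos by (simp add: \<delta>_def)
    have "D x y < e" if "y \<in> K" "dist x y < \<delta>" for y
    proof -
      have "D x y \<le> CU * dist x y powr \<alpha>" using D_le[of "[]" x y] x that by simp
      also have "\<dots> < CU * \<delta> powr \<alpha>" using that CU_pos alpha_pos by (simp add: powr_less_mono2)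
      also have "\<dots> = e" using e CU_pos alpha_pos by (simp add: \<delta>_def powr_powr)
      finally show ?thesis .
    qed
    then show "\<exists>U. openin (top_of_set K) U \<and> x \<in> U \<and> (\<forall>y\<in>U. id y \<in> M.mball (id x) e)"
      using x \<delta> by (intro exI[of _ "K \<inter> ball x \<delta>"]) (auto simp: openin_open)
  qed
qed (use compact_K in \<open>auto simp: compact_space_subtopology compactin_euclidean_iff\<close>)

lemma quasisymmetric_D: "quasisymmetric_map (submetric euclidean_metric K) D_metric id"
  unfolding quasisymmetric_map_def
proof (intro conjI)
  show "homeomorphic_map (mtopology_of (submetric euclidean_metric K)) (mtopology_of D_metric) id"
    using homeomorphic_D by (simp add: mtopology_of_submetric)
  define \<eta> where "\<eta> t = CQ * t powr \<alpha> * (1 + t) powr \<beta>" for t :: real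
  have cont: "continuous_on {0..} \<eta>"
    unfolding \<eta>_def using alpha_pos by (intro continuous_intros continuous_on_powr') auto
  have mono: "strict_mono_on {0..} \<eta>"
  proof (rule strict_mono_onI)
    fix s t :: real assume st: "s \<in> {0..}" "t \<in> {0..}" "s < t"
    have "s powr \<alpha> * (1 + s) powr \<beta> < t powr \<alpha> * (1 + t) powr \<beta>"
      using st alpha_pos rmax_beta(1) by (intro mult_less_le_imp_less powr_less_mono2 powr_mono2) auto
    then show "\<eta> s < \<eta> t" using CQ_pos by (simp add: \<eta>_def mult.assoc)
  qed
  have "\<exists>t\<ge>0. y \<le> \<eta> t" if y: "0 \<le> y" for y
  proof (intro exI conjI)
    define t where "t = (y / CQ) powr (1 / \<alpha>)"
    show "0 \<le> t" by (simp add: t_def)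
    have "y = CQ * t powr \<alpha> * 1" using y CQ_pos alpha_pos by (simp add: t_def powr_powr)
    also have "\<dots> \<le> \<eta> t"
      unfolding \<eta>_def using CQ_pos rmax_beta(1) \<open>0 \<le> t\<close>
      by (intro mult_left_mono ge_one_powr_ge_zero) auto
    finally show "y \<le> \<eta> t" .
  qed
  then obtain \<eta>' where "homeomorphism {0..} {0..} \<eta> \<eta>'"
    using homeomorphism_half_line[OF cont mono] alpha_pos by (auto simp: \<eta>_def)
  moreover have "D x y \<le> \<eta> t * D x z" if "x \<in> K" "y \<in> K" "z \<in> K" "0 \<le> t" "dist x y \<le> t * dist x z" for x y z t
    using D_quasisymmetric[OF that] by (simp add: \<eta>_def)
  ultimately show "\<exists>\<eta> \<eta>'. homeomorphism {0..} {0..} \<eta> \<eta>' \<and> strict_mono_on {0..} \<eta> \<and>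
      (\<forall>x\<in>mspace (submetric euclidean_metric K). \<forall>y\<in>mspace (submetric euclidean_metric K).
        \<forall>z\<in>mspace (submetric euclidean_metric K). \<forall>t\<ge>0.
          mdist (submetric euclidean_metric K) x y \<le> t * mdist (submetric euclidean_metric K) x z \<longrightarrow>
          mdist D_metric (id x) (id y) \<le> \<eta> t * mdist D_metric (id x) (id z))"
    using mono by (intro exI[of _ \<eta>] exI[of _ \<eta>']) (auto simp: mdist_D)
qed

text \<open>The cells of generation \<open>n\<close> cover \<open>K\<close>, and in the metric
  \<open>D\<close> each has diameter at most its weight.\<close>

theorem conformal_dim_le_weights:
  assumes p: "0 < p" and small: "\<And>e. 0 < e \<Longrightarrow> \<exists>n. (\<Sum>w\<in>words n. R None w powr p) \<le> e"
  shows "conformal_dim (submetric euclidean_metric K) \<le> ennreal p"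
proof -
  have "conformal_dim (submetric euclidean_metric K) \<le> hausdorff_dim D_metric"
    by (rule conformal_dim_le[OF quasisymmetric_D])
  also have "\<dots> \<le> ennreal p"
  proof (rule hausdorff_dim_le[OF p])
    fix e :: real assume "0 < e"
    then obtain n where n: "(\<Sum>w\<in>words n. R None w powr p) \<le> e" using small by blast
    have wI: "w \<in> lists I" if "w \<in> words n" for w using that by (auto simp: words_def)
    show "\<exists>(S :: 'i list set) U b. finite S \<and> mspace D_metric \<subseteq> (\<Union>w\<in>S. U w) \<and>
      (\<forall>w\<in>S. U w \<subseteq> mspace D_metric \<and> 0 \<le> b w \<and> (\<forall>x\<in>U w. \<forall>y\<in>U w. mdist D_metric x y \<le> b w)) \<and>
      (\<Sum>w\<in>S. b w powr p) \<le> e"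
    proof (intro exI conjI ballI)
      show "finite (words n)" by (rule finite_words)
      show "mspace D_metric \<subseteq> (\<Union>w\<in>words n. fw w ` K)" using K_words by auto
      show "(\<Sum>w\<in>words n. R None w powr p) \<le> e" by (rule n)
      fix w assume w: "w \<in> words n"
      show "fw w ` K \<subseteq> mspace D_metric" using fw_in[OF wI[OF w]] by auto
      show "0 \<le> R None w" by (rule R_nonneg[OF wI[OF w]])
      fix x y assume "x \<in> fw w ` K" "y \<in> fw w ` K"
      then obtain x' y' where "x' \<in> K" "y' \<in> K" "x = fw w x'" "y = fw w y'" by blast
      then show "mdist D_metric x y \<le> R None w"
        using D_upper[OF wI[OF w], of x' y'] fw_in[OF wI[OF w]] by (simp add: mdist_D)
    qed
  qed
  finally show ?thesis .
qed

end


section \<open>Cut functions for small exponents\<close>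

context gasket_ifs
begin

text \<open>Iterates a self-similar equation. With \<open>q = r (corner a) powr \<alpha>\<close>,
  the function falls from 1 to \<open>1 - q\<close> inside the corner cell of \<open>a\<close>, as a
  copy of itself, and from \<open>1 - q\<close> to 0 across the siblings touching that cell, as
  copies of the cut functions at their contact vertices.\<close>

primrec cut_approx :: "real \<Rightarrow> nat \<Rightarrow> 'a \<Rightarrow> 'a \<Rightarrow> real" where
  "cut_approx \<alpha> 0 = (\<lambda>a x. if a = x then 1 else 0)"
| "cut_approx \<alpha> (Suc n) = (\<lambda>a. glue (cut_approx \<alpha> n) (corner a)
     (\<lambda>y. 1 - r (corner a) powr \<alpha> + r (corner a) powr \<alpha> * cut_approx \<alpha> n a y))"

text \<open>A point of \<open>V\<close> lies in its corner cell only, hence is not a contact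
  point.\<close>

lemma corner_contact:
  assumes "a \<in> V" "j \<in> I" "j \<noteq> corner a" "contact j (corner a) a' b"
  shows "b \<noteq> a" "b \<in> V" "a' \<in> V"
  using assms corner_unique[of a j] corner_fix[of a] V_K by (auto simp: contact_def)

lemma vertex_not_contact:
  assumes "a \<in> V" "c \<in> V" "corner c \<noteq> corner a" "contact (corner c) (corner a) a' b"
  shows "a' \<noteq> c"
  using assms corner_unique[of c "corner a"] corner_fix[of c] corner_in V_K by (auto simp: contact_def)

lemma cut_approx_step:
  assumes n: "normalized (cut_approx \<alpha> n)" and a: "a \<in> V" and y: "y \<in> K"
  shows "cut_approx \<alpha> (Suc n) a (f (corner a) y) = 1 - r (corner a) powr \<alpha> + r (corner a) powr \<alpha> * cut_approx \<alpha> n a y"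
    and "j \<in> I \<Longrightarrow> j \<noteq> corner a \<Longrightarrow> contact j (corner a) a' b \<Longrightarrow>
      cut_approx \<alpha> (Suc n) a (f j y) = (1 - r (corner a) powr \<alpha>) * cut_approx \<alpha> n a' y"
    and "j \<in> I \<Longrightarrow> j \<noteq> corner a \<Longrightarrow> f j ` K \<inter> f (corner a) ` K = {} \<Longrightarrow> cut_approx \<alpha> (Suc n) a (f j y) = 0"
proof -
  note eq = glue_eq[OF n corner_in[OF a] _ y]
  show "cut_approx \<alpha> (Suc n) a (f (corner a) y) = 1 - r (corner a) powr \<alpha> + r (corner a) powr \<alpha> * cut_approx \<alpha> n a y"
    using eq[OF corner_in[OF a]] by simp
  { assume j: "j \<in> I" "j \<noteq> corner a" and c: "contact j (corner a) a' b"
    have "cut_approx \<alpha> n a b = 0" using n a corner_contact[OF a j c] by (auto simp: normalized_def)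
    then show "cut_approx \<alpha> (Suc n) a (f j y) = (1 - r (corner a) powr \<alpha>) * cut_approx \<alpha> n a' y"
      using eq[OF j(1)] glue_part_contact[OF corner_in[OF a] j(1) j(2)[symmetric] c] by simp }
  { assume j: "j \<in> I" "j \<noteq> corner a" "f j ` K \<inter> f (corner a) ` K = {}"
    then show "cut_approx \<alpha> (Suc n) a (f j y) = 0"
      using eq[OF j(1)] glue_part_disjoint[OF corner_in[OF a] j(1) j(2)[symmetric] j(3)] by simp }
qed

lemma cell_cases:
  assumes "a \<in> V" "x \<in> K"
  obtains (own) y where "y \<in> K" "x = f (corner a) y"
    | (touching) j a' b y where "j \<in> I" "j \<noteq> corner a" "contact j (corner a) a' b" "y \<in> K" "x = f j y"
    | (disjoint) j y where "j \<in> I" "j \<noteq> corner a" "f j ` K \<inter> f (corner a) ` K = {}" "y \<in> K" "x = f j y"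
proof -
  obtain j y where j: "j \<in> I" "y \<in> K" "x = f j y" using K_cases[OF assms(2)] .
  show thesis
    using contact_cases[OF corner_in[OF assms(1)] j(1)] own[of y] touching[OF j(1) _ _ j(2,3)] disjoint[OF j(1) _ _ j(2,3)] j
    by (cases "j = corner a") auto
qed

context
  fixes \<alpha> :: real
  assumes alpha: "0 < \<alpha>"
begin

lemma ratio_powr: "i \<in> I \<Longrightarrow> 0 < r i powr \<alpha>" "i \<in> I \<Longrightarrow> r i powr \<alpha> < 1"
  using r_pos[of i] r_less_1[of i] powr_less_mono2[OF alpha, of "r i" 1] by auto

lemma normalized_cut_approx: "normalized (cut_approx \<alpha> n)"
proof (induction n)
  case 0
  then show ?case by (simp add: normalized_def)
next
  case (Suc n)
  have "cut_approx \<alpha> (Suc n) a b = (if a = b then 1 else 0)" if a: "a \<in> V" and b: "b \<in> V" for a b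
  proof (cases "a = b")
    case True
    have "cut_approx \<alpha> n a a = 1" using Suc a by (simp add: normalized_def)
    then show ?thesis
      using cut_approx_step(1)[OF Suc a V_K[OF a]] corner_fix[OF a] True by (simp del: cut_approx.simps)
  next
    case False
    have c: "corner b \<in> I" "corner b \<noteq> corner a" using corner_in[OF b] corner_inj[OF a b] False by auto
    from contact_cases[OF corner_in[OF a] c(1) c(2)[symmetric]]
    have "cut_approx \<alpha> (Suc n) a (f (corner b) b) = 0"
    proof
      assume "\<exists>a' b'. contact (corner b) (corner a) a' b' \<and> {(a', b'). contact (corner b) (corner a) a' b'} = {(a', b')}"
      then obtain a' b' where c': "contact (corner b) (corner a) a' b'" by blast
      have "a' \<noteq> b" "a' \<in> V" using vertex_not_contact[OF a b c(2) c'] c' by (auto simp: contact_def)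
      then have "cut_approx \<alpha> n a' b = 0" using Suc b by (simp add: normalized_def)
      then show ?thesis using cut_approx_step(2)[OF Suc a V_K[OF b] c c'] by simp
    qed (use cut_approx_step(3)[OF Suc a V_K[OF b] c] in auto)
    then show ?thesis using False corner_fix[OF b] by (simp del: cut_approx.simps)
  qed
  then show ?case by (simp add: normalized_def)
qed

lemmas approx_step = cut_approx_step[OF normalized_cut_approx]

lemma cut_approx_01: "a \<in> V \<Longrightarrow> x \<in> K \<Longrightarrow> 0 \<le> cut_approx \<alpha> n a x \<and> cut_approx \<alpha> n a x \<le> 1"
proof (induction n arbitrary: a x)
  case (Suc n)
  note q = ratio_powr[OF corner_in[OF Suc.prems(1)]]
  show ?case
    using Suc.prems
  proof (cases rule: cell_cases)
    case (own y)
    show ?thesis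
      using Suc.IH[OF Suc.prems(1) own(1)] q approx_step(1)[OF Suc.prems(1) own(1)] own(2)
        mult_left_mono[of "cut_approx \<alpha> n a y" 1 "r (corner a) powr \<alpha>"] by (simp del: cut_approx.simps)
  next
    case (touching j a' b y)
    have "a' \<in> V" using touching by (simp add: contact_def)
    then show ?thesis
      using Suc.IH[of a' y] q approx_step(2)[OF Suc.prems(1) touching(4,1,2,3)] touching(4,5)
      by (simp add: mult_le_one del: cut_approx.simps)
  next
    case (disjoint j y)
    then show ?thesis using approx_step(3)[OF Suc.prems(1) disjoint(4,1,2,3)] by (simp del: cut_approx.simps)
  qed
qed auto

text \<open>Provides the pointwise limit. The iteration starts with the smallest function that is
  nonnegative and 1 at \<open>a\<close>, and the recursion preserves order.\<close>

lemma cut_approx_mono: "a \<in> V \<Longrightarrow> x \<in> K \<Longrightarrow> cut_approx \<alpha> n a x \<le> cut_approx \<alpha> (Suc n) a x"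
proof (induction n arbitrary: a x)
  case 0
  have "cut_approx \<alpha> (Suc 0) a a = 1"
    using normalized_cut_approx[of "Suc 0"] 0 by (simp add: normalized_def del: cut_approx.simps)
  then show ?case using cut_approx_01[OF 0, of "Suc 0"] by (cases "a = x") (simp_all del: cut_approx.simps(2))
next
  case (Suc n)
  note q = ratio_powr[OF corner_in[OF Suc.prems(1)]]
  show ?case
    using Suc.prems
  proof (cases rule: cell_cases)
    case (own y)
    show ?thesis
      unfolding own(2) approx_step(1)[OF Suc.prems(1) own(1)]
      using Suc.IH[OF Suc.prems(1) own(1)] q by (simp del: cut_approx.simps)
  next
    case (touching j a' b y)
    have "a' \<in> V" using touching by (simp add: contact_def)
    then show ?thesis
      unfolding touching(5) approx_step(2)[OF Suc.prems(1) touching(4,1,2,3)]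
      using Suc.IH[of a' y] q touching(4) by (intro mult_left_mono) (auto simp del: cut_approx.simps)
  next
    case (disjoint j y)
    then show ?thesis using approx_step(3)[OF Suc.prems(1) disjoint(4,1,2,3)] by (simp del: cut_approx.simps)
  qed
qed

section \<open>The limit cut functions\<close>

definition cut :: "'a \<Rightarrow> 'a \<Rightarrow> real" where
  "cut a x = lim (\<lambda>n. cut_approx \<alpha> n a x)"

lemma cut_lim:
  assumes "a \<in> V" "x \<in> K" shows "(\<lambda>n. cut_approx \<alpha> n a x) \<longlonglongrightarrow> cut a x"
proof -
  have "incseq (\<lambda>n. cut_approx \<alpha> n a x)"
    using cut_approx_mono[OF assms] by (intro incseq_SucI)
  then obtain L where "(\<lambda>n. cut_approx \<alpha> n a x) \<longlonglongrightarrow> L"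
    using incseq_convergent[of "\<lambda>n. cut_approx \<alpha> n a x" 1] cut_approx_01[OF assms] by blast
  then show ?thesis unfolding cut_def by (simp add: limI)
qed

lemma cut_vertex: "a \<in> V \<Longrightarrow> b \<in> V \<Longrightarrow> cut a b = (if a = b then 1 else 0)"
  using normalized_cut_approx unfolding cut_def normalized_def by (auto intro!: limI)

lemma cut_01: "a \<in> V \<Longrightarrow> x \<in> K \<Longrightarrow> 0 \<le> cut a x" "a \<in> V \<Longrightarrow> x \<in> K \<Longrightarrow> cut a x \<le> 1"
  using LIMSEQ_le_const[OF cut_lim, of a x 0] LIMSEQ_le_const2[OF cut_lim, of a x 1] cut_approx_01 by auto

lemma cut_own:
  assumes a: "a \<in> V" and y: "y \<in> K"
  shows "cut a (f (corner a) y) = 1 - r (corner a) powr \<alpha> + r (corner a) powr \<alpha> * cut a y"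
proof -
  have "(\<lambda>n. cut_approx \<alpha> (Suc n) a (f (corner a) y)) \<longlonglongrightarrow> cut a (f (corner a) y)"
    using cut_lim[OF a f_in[OF corner_in[OF a] y]] by (rule LIMSEQ_Suc)
  moreover have "(\<lambda>n. cut_approx \<alpha> (Suc n) a (f (corner a) y)) \<longlonglongrightarrow> 1 - r (corner a) powr \<alpha> + r (corner a) powr \<alpha> * cut a y"
    unfolding approx_step(1)[OF a y] by (intro tendsto_intros cut_lim a y)
  ultimately show ?thesis by (rule LIMSEQ_unique)
qed

lemma cut_touching:
  assumes a: "a \<in> V" and y: "y \<in> K" and j: "j \<in> I" "j \<noteq> corner a" and c: "contact j (corner a) a' b"
  shows "cut a (f j y) = (1 - r (corner a) powr \<alpha>) * cut a' y"
proof -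
  have a': "a' \<in> V" using c by (simp add: contact_def)
  have "(\<lambda>n. cut_approx \<alpha> (Suc n) a (f j y)) \<longlonglongrightarrow> cut a (f j y)"
    using cut_lim[OF a f_in[OF j(1) y]] by (rule LIMSEQ_Suc)
  moreover have "(\<lambda>n. cut_approx \<alpha> (Suc n) a (f j y)) \<longlonglongrightarrow> (1 - r (corner a) powr \<alpha>) * cut a' y"
    unfolding approx_step(2)[OF a y j c] by (intro tendsto_intros cut_lim a' y)
  ultimately show ?thesis by (rule LIMSEQ_unique)
qed

lemma cut_disjoint:
  assumes a: "a \<in> V" and y: "y \<in> K" and j: "j \<in> I" "j \<noteq> corner a" "f j ` K \<inter> f (corner a) ` K = {}"
  shows "cut a (f j y) = 0"
proof -
  have "(\<lambda>n. cut_approx \<alpha> (Suc n) a (f j y)) \<longlonglongrightarrow> cut a (f j y)"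
    using cut_lim[OF a f_in[OF j(1) y]] by (rule LIMSEQ_Suc)
  then show ?thesis unfolding approx_step(3)[OF a y j] by (simp add: LIMSEQ_const_iff)
qed

text \<open>In the corner cell the function scales by \<open>r (corner a) powr \<alpha>\<close> and
  the letter is free. In a touching sibling the letter costs \<open>\<epsilon>\<close> and resets
  the state to \<open>None\<close>; the third assumption on \<open>\<epsilon>\<close> says that the
  remaining amplitude fits under this cost.\<close>

lemma cut_osc:
  assumes eps: "0 < \<epsilon>" "\<epsilon> \<le> 1" "\<And>a. a \<in> V \<Longrightarrow> 1 - r (corner a) powr \<alpha> \<le> \<epsilon> * rmin powr \<alpha>"
    and x: "x \<in> K" and y: "y \<in> K"
  shows "a \<in> V \<Longrightarrow> w \<in> lists I \<Longrightarrow> \<bar>cut a (fw w x) - cut a (fw w y)\<bar> \<le> \<rho> \<alpha> \<epsilon> (Some (corner a)) w"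
proof (induction w arbitrary: a)
  case Nil
  then show ?case using cut_01[OF Nil(1) x] cut_01[OF Nil(1) y] by simp
next
  case (Cons j w)
  then have j: "j \<in> I" and w: "w \<in> lists I" by auto
  note a = Cons.prems(1)
  let ?q = "r (corner a) powr \<alpha>"
  have q: "0 < ?q" "?q < 1" using ratio_powr[OF corner_in[OF a]] by auto
  have xy: "fw w x \<in> K" "fw w y \<in> K" using w x y by auto
  have \<rho>0: "0 \<le> \<rho> \<alpha> \<epsilon> s w" for s
    using hh_pos[OF eps(1), of s w] by (simp add: \<rho>_def)
  consider "j = corner a" | "j \<noteq> corner a" "f j ` K \<inter> f (corner a) ` K = {}" | a' b where "j \<noteq> corner a" "contact j (corner a) a' b"
    using contact_cases[OF corner_in[OF a] j] by blast
  then show ?case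
  proof cases
    case 1
    have "\<bar>cut a (fw (j # w) x) - cut a (fw (j # w) y)\<bar> = ?q * \<bar>cut a (fw w x) - cut a (fw w y)\<bar>"
      using cut_own[OF a xy(1)] cut_own[OF a xy(2)] 1 q by (simp add: abs_mult flip: right_diff_distrib)
    also have "\<dots> \<le> ?q * \<rho> \<alpha> \<epsilon> (Some (corner a)) w"
      using Cons.IH[OF a w] q by (intro mult_left_mono) auto
    finally show ?thesis using 1 a j w by simp
  next
    case 2
    then show ?thesis
      using cut_disjoint[OF a xy(1) j 2] cut_disjoint[OF a xy(2) j 2] \<rho>0 j w eps by simp
  next
    case (3 a' b)
    have a': "a' \<in> V" using 3 by (simp add: contact_def)
    have "\<bar>cut a (fw (j # w) x) - cut a (fw (j # w) y)\<bar> = (1 - ?q) * \<bar>cut a' (fw w x) - cut a' (fw w y)\<bar>"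
      using cut_touching[OF a xy(1) j 3] cut_touching[OF a xy(2) j 3] q
      by (simp add: abs_mult flip: right_diff_distrib)
    also have "\<dots> \<le> (1 - ?q) * \<rho> \<alpha> \<epsilon> None w"
    proof (intro mult_left_mono)
      have "\<rho> \<alpha> \<epsilon> (Some (corner a')) w \<le> \<rho> \<alpha> \<epsilon> None w"
        unfolding \<rho>_def using hh_compare(1)[OF eps(1,2)] by (intro mult_left_mono) auto
      then show "\<bar>cut a' (fw w x) - cut a' (fw w y)\<bar> \<le> \<rho> \<alpha> \<epsilon> None w" using Cons.IH[OF a' w] by linarith
    qed (use q in simp)
    also have "\<dots> \<le> (r j powr \<alpha> * \<epsilon>) * \<rho> \<alpha> \<epsilon> None w"
    proof (intro mult_right_mono)
      have "\<epsilon> * rmin powr \<alpha> \<le> \<epsilon> * r j powr \<alpha>"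
        using rmin_le[OF j] rmin_pos alpha eps by (intro mult_left_mono powr_mono2) auto
      then show "1 - ?q \<le> r j powr \<alpha> * \<epsilon>" using eps(3)[OF a] by (simp add: mult.commute)
    qed (rule \<rho>0)
    finally show ?thesis using 3 j w by simp
  qed
qed

text \<open>Each zoom into the corner cell multiplies \<open>1 - cut a\<close> by
  \<open>r (corner a) powr \<alpha>\<close>, just like the power of the distance to
  \<open>a\<close>. Outside the corner cell \<open>1 - cut a\<close> is at least this
  factor.\<close>

lemma cut_sep:
  assumes a: "a \<in> V" and x: "x \<in> K"
  shows "(rmin / diamK) powr \<alpha> * dist x a powr \<alpha> \<le> 1 - cut a x"
proof (cases "x = a")
  case True
  then show ?thesis using cut_01(2)[OF a x] by simp
next
  case False
  obtain n k x' where k: "k \<in> I" "x' \<in> K" "k \<noteq> corner a" "x = fw (replicate n (corner a)) (f k x')"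
    using corner_word[OF a x False] by blast
  let ?l = "corner a"
  let ?q = "r ?l powr \<alpha>"
  have l: "?l \<in> I" by (rule corner_in[OF a])
  have q: "0 < ?q" "?q < 1" using ratio_powr[OF l] by auto
  have fk: "f k x' \<in> K" using k by simp
  have "1 - cut a (fw (replicate n ?l) z) = ?q ^ n * (1 - cut a z)" if "z \<in> K" for z
    using that
  proof (induction n)
    case (Suc n)
    have "fw (replicate n ?l) z \<in> K" by (rule fw_in[OF corner_lists[OF a] Suc.prems])
    from cut_own[OF a this] have "1 - cut a (f ?l (fw (replicate n ?l) z)) = ?q * (1 - cut a (fw (replicate n ?l) z))"
      by (simp add: algebra_simps)
    then show ?case using Suc by simp
  qed simp
  then have 1: "1 - cut a x = ?q ^ n * (1 - cut a (f k x'))" using fk k(4) by simp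
  have qmin: "rmin powr \<alpha> \<le> ?q" using rmin_le[OF l] rmin_pos alpha by (intro powr_mono2) auto
  from contact_cases[OF l k(1) k(3)[symmetric]] have "?q \<le> 1 - cut a (f k x')"
  proof
    assume "\<exists>a' b. contact k ?l a' b \<and> {(a', b). contact k ?l a' b} = {(a', b)}"
    then obtain a' b where c: "contact k ?l a' b" by blast
    then have a': "a' \<in> V" by (simp add: contact_def)
    have "(1 - ?q) * cut a' x' \<le> (1 - ?q) * 1" using cut_01[OF a' k(2)] q by (intro mult_left_mono) auto
    then show ?thesis using cut_touching[OF a k(2,1,3) c] by simp
  qed (use cut_disjoint[OF a k(2,1,3)] q in simp)
  then have 2: "?q ^ n * rmin powr \<alpha> \<le> 1 - cut a x" unfolding 1 using qmin q by (intro mult_left_mono) auto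
  have rn: "rw (replicate n ?l) = r ?l ^ n" by (induction n) auto
  have "dist x a = r ?l ^ n * dist (f k x') a"
    using dist_fw[OF corner_lists[OF a] fk V_K[OF a]] k(4) fw_corner[OF a] rn by metis
  also have "\<dots> \<le> r ?l ^ n * diamK"
    using diamK(2)[OF fk V_K[OF a]] r_pos[OF l] by (intro mult_left_mono) auto
  finally have "dist x a / diamK \<le> r ?l ^ n" using diamK(1) by (simp add: field_simps)
  then have "(dist x a / diamK) powr \<alpha> \<le> (r ?l ^ n) powr \<alpha>" using alpha diamK(1) by (intro powr_mono2) auto
  also have "\<dots> = ?q ^ n" using r_pos[OF l] by (simp add: powr_power powr_realpow[symmetric] powr_powr mult.commute)
  finally have "rmin powr \<alpha> * (dist x a / diamK) powr \<alpha> \<le> rmin powr \<alpha> * ?q ^ n" by (intro mult_left_mono) auto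
  then show ?thesis using 2 rmin_pos diamK(1) by (simp add: powr_divide powr_mult mult_ac)
qed

lemma gasket_weights_cut:
  assumes eps: "0 < \<epsilon>" "\<epsilon> \<le> 1" "\<And>a. a \<in> V \<Longrightarrow> 1 - r (corner a) powr \<alpha> \<le> \<epsilon> * rmin powr \<alpha>"
  shows "gasket_weights K I f r V corner \<kappa> \<alpha> \<epsilon> cut 1 ((rmin / diamK) powr \<alpha>)"
proof
  show "0 < (rmin / diamK) powr \<alpha>" using rmin_pos diamK(1) by simp
  fix a w x y assume "a \<in> V" "w \<in> lists I" "x \<in> K" "y \<in> K"
  then have "\<bar>cut a (fw w x) - cut a (fw w y)\<bar> \<le> \<rho> \<alpha> \<epsilon> (Some (corner a)) w"
    using cut_osc[OF eps, of x y a w] by blast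
  also have "\<dots> \<le> \<rho> \<alpha> \<epsilon> None w"
    unfolding \<rho>_def using hh_compare(1)[OF eps(1,2)] by (intro mult_left_mono) auto
  finally show "\<bar>cut a (fw w x) - cut a (fw w y)\<bar> \<le> 1 * \<rho> \<alpha> \<epsilon> None w" by simp
qed (use eps alpha cut_vertex cut_01 cut_sep in auto)

end

lemma words_Suc: "words (Suc n) = (\<lambda>(i,w). i # w) ` (I \<times> words n)"
  unfolding words_def by (auto simp: image_iff length_Suc_conv)

lemma sum_words_Suc: "(\<Sum>w\<in>words (Suc n). F w) = (\<Sum>i\<in>I. \<Sum>w\<in>words n. (F (i # w) :: real))"
proof -
  have "inj_on (\<lambda>(i,w). i # w) (I \<times> words n)" by (auto simp: inj_on_def)
  then have "(\<Sum>w\<in>words (Suc n). F w) = (\<Sum>(i,w)\<in>I \<times> words n. F (i # w))"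
    unfolding words_Suc by (subst sum.reindex) (auto intro: sum.cong)
  then show ?thesis by (simp add: sum.cartesian_product)
qed

end


section \<open>The bound 1\<close>

context gasket_ifs
begin

text \<open>The sums are powers of a nonnegative transfer matrix on the states. A positive vector
  \<open>v\<close> that the matrix shrinks by the factor \<open>\<tau>\<close> bounds its spectral
  radius.\<close>

lemma sum_words_le:
  assumes eps: "0 < \<epsilon>" and v: "\<And>s. 1 \<le> v s" and \<tau>: "0 \<le> \<tau>"
    and row: "\<And>s. s \<in> insert None (Some ` corner ` V) \<Longrightarrow> (\<Sum>i\<in>I. \<rho> \<alpha> \<epsilon> s [i] powr p * v (step s i)) \<le> \<tau> * v s"
  shows "s \<in> insert None (Some ` corner ` V) \<Longrightarrow> (\<Sum>w\<in>words n. \<rho> \<alpha> \<epsilon> s w powr p) \<le> \<tau> ^ n * v s"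
proof (induction n arbitrary: s)
  case 0
  have "words 0 = {[]}" by (auto simp: words_def)
  then show ?case using v by simp
next
  case (Suc n)
  have st: "step s i \<in> insert None (Some ` corner ` V)" for i by (auto simp: step_def)
  have "(\<Sum>w\<in>words (Suc n). \<rho> \<alpha> \<epsilon> s w powr p) = (\<Sum>i\<in>I. \<rho> \<alpha> \<epsilon> s [i] powr p * (\<Sum>w\<in>words n. \<rho> \<alpha> \<epsilon> (step s i) w powr p))"
    unfolding sum_words_Suc sum_distrib_left
  proof (intro sum.cong refl)
    fix i w assume i: "i \<in> I" and "w \<in> words n"
    then have w: "w \<in> lists I" by (auto simp: words_def)
    have "0 \<le> \<rho> \<alpha> \<epsilon> s [i]" "0 \<le> \<rho> \<alpha> \<epsilon> (step s i) w"
      using hh_pos[OF eps, THEN less_imp_le] unfolding \<rho>_def by (auto simp del: hh.simps)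
    moreover have "\<rho> \<alpha> \<epsilon> s (i # w) = \<rho> \<alpha> \<epsilon> s [i] * \<rho> \<alpha> \<epsilon> (step s i) w" using i w by simp
    ultimately show "\<rho> \<alpha> \<epsilon> s (i # w) powr p = \<rho> \<alpha> \<epsilon> s [i] powr p * \<rho> \<alpha> \<epsilon> (step s i) w powr p"
      by (simp only: powr_mult)
  qed
  also have "\<dots> \<le> (\<Sum>i\<in>I. \<rho> \<alpha> \<epsilon> s [i] powr p * (\<tau> ^ n * v (step s i)))"
    by (intro sum_mono mult_left_mono Suc.IH st) simp
  also have "\<dots> = \<tau> ^ n * (\<Sum>i\<in>I. \<rho> \<alpha> \<epsilon> s [i] powr p * v (step s i))"
    by (simp add: sum_distrib_left mult_ac del: \<rho>_simps)
  also have "\<dots> \<le> \<tau> ^ n * (\<tau> * v s)"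
    using row[OF Suc.prems] \<tau> by (intro mult_left_mono) auto
  finally show ?case by (simp add: mult_ac)
qed

lemma geometric_small:
  fixes \<tau> C e :: real
  assumes "0 \<le> \<tau>" "\<tau> < 1" "0 < e" shows "\<exists>n. \<tau> ^ n * C \<le> e"
proof -
  have "(\<lambda>n. \<tau> ^ n * C) \<longlonglongrightarrow> 0 * C"
    using assms by (intro tendsto_intros LIMSEQ_realpow_zero) auto
  then have "\<forall>\<^sub>F n in sequentially. \<tau> ^ n * C < e" using assms by (intro order_tendstoD) auto
  then show ?thesis by (meson eventually_happens sequentially_bot less_imp_le trivial_limit_def)
qed

text \<open>In state \<open>None\<close> all \<open>N\<close> letters may be free, but they lead to
  states of weight 1; the weight \<open>N + 1\<close> of \<open>None\<close> makes up for their
  number. In state \<open>Some l\<close> at most \<open>l\<close> is free, and returns to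
  \<open>None\<close> carry the factor \<open>\<epsilon> powr p\<close>.\<close>

lemma letter_sum_le:
  assumes \<alpha>: "0 < \<alpha>" and eps: "0 < \<epsilon>" "\<epsilon> \<le> 1" and p: "0 < p"
  defines "N \<equiv> real (card I)"
  defines "v \<equiv> \<lambda>s::'i option. if s = None then N + 1 else 1"
  assumes s: "s \<in> insert None (Some ` corner ` V)"
  shows "(\<Sum>i\<in>I. \<rho> \<alpha> \<epsilon> s [i] powr p * v (step s i)) \<le> (rmax powr (\<alpha> * p) + N * (N + 1) * \<epsilon> powr p) * v s"
proof -
  have N: "0 \<le> N" by (simp add: N_def)
  let ?A = "rmax powr (\<alpha> * p)" and ?B = "(N + 1) * \<epsilon> powr p"
  have own: "\<rho> \<alpha> \<epsilon> s [i] powr p * v (step s i) \<le> ?A" if "i \<in> I" "step s i = Some i" for i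
    using that r_pos[of i] rmax_ge[of i] \<alpha> p by (auto simp: powr_powr v_def intro!: powr_mono2)
  have other: "\<rho> \<alpha> \<epsilon> s [i] powr p * v (step s i) \<le> ?B" if i: "i \<in> I" and ne: "step s i \<noteq> Some i" for i
  proof -
    have "step s i = None" using ne by (auto simp: step_def split: if_splits)
    moreover have "(r i powr \<alpha> * \<epsilon>) powr p \<le> \<epsilon> powr p"
      using r_pos[OF i] r_less_1[OF i] \<alpha> p eps powr_le1[of \<alpha> "r i"]
      by (intro powr_mono2) (auto simp: mult_le_cancel_right1)
    ultimately show ?thesis using i N by (simp add: v_def mult.commute mult_left_mono)
  qed
  have AB: "0 \<le> ?A" "0 \<le> ?B" using N by auto
  show ?thesis
  proof (cases s)
    case None
    have "(\<Sum>i\<in>I. \<rho> \<alpha> \<epsilon> s [i] powr p * v (step s i)) \<le> (\<Sum>i\<in>I. ?A + ?B)"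
    proof (intro sum_mono)
      fix i assume i: "i \<in> I"
      show "\<rho> \<alpha> \<epsilon> s [i] powr p * v (step s i) \<le> ?A + ?B"
        using own[OF i] other[OF i] AB by (cases "step s i = Some i") linarith+
    qed
    also have "\<dots> = N * ?A + N * ?B" by (simp add: N_def distrib_left)
    also have "\<dots> \<le> (N + 1) * (?A + N * ?B)"
      using N AB by (simp add: algebra_simps)
    finally show ?thesis using None by (simp add: v_def mult_ac)
  next
    case (Some l)
    then have l: "l \<in> I" using s corner_in by auto
    have "(\<Sum>i\<in>I. \<rho> \<alpha> \<epsilon> s [i] powr p * v (step s i)) \<le> (\<Sum>i\<in>I. (if i = l then ?A else 0) + ?B)"
    proof (intro sum_mono)
      fix i assume i: "i \<in> I"
      have own_l: "step s i = Some i \<Longrightarrow> i = l" using Some by (auto simp: step_def split: if_splits)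
      have A0: "0 \<le> (if i = l then ?A else 0)" by simp
      show "\<rho> \<alpha> \<epsilon> s [i] powr p * v (step s i) \<le> (if i = l then ?A else 0) + ?B"
      proof (cases "step s i = Some i")
        case True
        then have "(if i = l then ?A else 0) = ?A" using own_l by simp
        then show ?thesis using own[OF i True] AB by linarith
      next
        case False
        then show ?thesis using other[OF i False] A0 by linarith
      qed
    qed
    also have "\<dots> = ?A + N * ?B" using l finite_I by (simp add: sum.distrib N_def)
    finally show ?thesis using Some by (simp add: v_def mult_ac)
  qed
qed

text \<open>The penalty \<open>\<epsilon>\<close> is of order \<open>\<alpha>\<close>, while \<open>1 - rmax powr (\<alpha> * p)\<close> is of order \<open>\<alpha>\<close> as well, so
  \<open>\<epsilon> powr p\<close> is negligible for small \<open>\<alpha>\<close> precisely because \<open>p > 1\<close>.\<close>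

lemma parameters_exist:
  assumes p: "1 < p" and M: "0 < M"
  shows "\<exists>\<alpha> \<epsilon>. 0 < \<alpha> \<and> 0 < \<epsilon> \<and> \<epsilon> \<le> 1 \<and> 1 - rmin powr \<alpha> \<le> \<epsilon> * rmin powr \<alpha> \<and>
    rmax powr (\<alpha> * p) + M * \<epsilon> powr p < (1::real)"
proof -
  define A where "A = - ln rmin"
  define B where "B = - ln rmax"
  have r: "0 < rmin" "rmin \<le> rmax" "0 < rmax" "rmax < 1"
    using rmin_pos rmin_le_rmax rmax_less_1 by auto
  have AB: "0 < B" "B \<le> A" "0 < A" using r by (auto simp: A_def B_def)
  \<comment> \<open>Chosen such that \<open>\<alpha> powr (p - 1) \<le> c\<close> makes
    \<open>M * (2 * A * \<alpha>) powr p\<close> at most \<open>\<alpha> * B / 4\<close>, half of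
    the lower bound \<open>\<alpha> * B / 2\<close> for
    \<open>1 - rmax powr (\<alpha> * p)\<close>.\<close>
  define c where "c = B / (4 * M * (2 * A) powr p)"
  have c: "0 < c" using AB M by (simp add: c_def)
  \<comment> \<open>The first bound gives \<open>\<alpha> * A \<le> 1/2\<close> and with it
    \<open>\<epsilon> \<le> 1\<close>; the second gives
    \<open>\<alpha> powr (p - 1) \<le> c\<close>.\<close>
  define \<alpha> where "\<alpha> = min (1 / (2 * A)) (c powr (1 / (p - 1)))"
  have \<alpha>: "0 < \<alpha>" "\<alpha> * A \<le> 1/2" "\<alpha> \<le> c powr (1 / (p - 1))"
    using AB c by (auto simp: \<alpha>_def min_def field_simps)
  \<comment> \<open>Since \<open>rmin powr \<alpha> = exp (- (\<alpha> * A))\<close>, this value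
    turns the required \<open>1 - rmin powr \<alpha> \<le> \<epsilon> * rmin powr \<alpha>\<close>
    into an equality.\<close>
  define \<epsilon> where "\<epsilon> = exp (\<alpha> * A) - 1"
  have rmina: "rmin powr \<alpha> = exp (- (\<alpha> * A))" using r by (simp add: powr_def A_def)
  have "exp (\<alpha> * A) \<le> 1 + \<alpha> * A + (\<alpha> * A)\<^sup>2"
    using \<alpha> AB by (intro exp_bound) auto
  also have "(\<alpha> * A)\<^sup>2 \<le> \<alpha> * A"
    using \<alpha> AB by (simp add: power2_eq_square mult_left_le)
  finally have e1: "\<epsilon> \<le> 2 * A * \<alpha>" by (simp add: \<epsilon>_def mult_ac)
  have e2: "0 < \<epsilon>" using \<alpha> AB by (simp add: \<epsilon>_def)
  have e3: "\<epsilon> \<le> 1" using e1 \<alpha> by (simp add: mult_ac)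
  have e4: "1 - rmin powr \<alpha> \<le> \<epsilon> * rmin powr \<alpha>"
    unfolding rmina \<epsilon>_def by (simp add: left_diff_distrib flip: exp_add)
  have "rmax powr (\<alpha> * p) \<le> rmax powr \<alpha>"
    using r \<alpha> p by (intro powr_mono') auto
  also have "\<dots> = 1 / exp (\<alpha> * B)" using r by (simp add: powr_def B_def exp_minus inverse_eq_divide)
  also have "\<dots> \<le> 1 / (1 + \<alpha> * B)"
    using exp_ge_add_one_self[of "\<alpha> * B"] \<alpha> AB by (intro divide_left_mono mult_pos_pos) (auto simp: add_pos_pos)
  also have "\<dots> \<le> 1 - \<alpha> * B / 2"
  proof -
    have "\<alpha> * B \<le> \<alpha> * A" using \<alpha> AB by simp
    then have "\<alpha> * B \<le> 1" using \<alpha> by linarith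
    then have "0 \<le> \<alpha> * B * (1 - \<alpha> * B)" using \<alpha> AB by simp
    then have "1 \<le> (1 - \<alpha> * B / 2) * (1 + \<alpha> * B)" by (simp add: algebra_simps)
    then show ?thesis using \<alpha> AB by (subst pos_divide_le_eq) (auto intro: add_pos_pos)
  qed
  finally have b1: "rmax powr (\<alpha> * p) \<le> 1 - \<alpha> * B / 2" .
  have "\<epsilon> powr p \<le> (2 * A * \<alpha>) powr p" using e1 e2 p by (intro powr_mono2) auto
  also have "\<dots> = (2 * A) powr p * (\<alpha> * \<alpha> powr (p - 1))"
    using \<alpha> AB by (simp add: powr_mult powr_diff)
  also have "\<dots> \<le> (2 * A) powr p * (\<alpha> * c)"
  proof -
    have "\<alpha> powr (p - 1) \<le> (c powr (1 / (p - 1))) powr (p - 1)"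
      using \<alpha> p by (intro powr_mono2) auto
    also have "\<dots> = c" using c p by (simp add: powr_powr)
    finally show ?thesis using \<alpha> by (intro mult_left_mono) auto
  qed
  also have "\<dots> = \<alpha> * B / (4 * M)" using AB M by (simp add: c_def)
  finally have "M * \<epsilon> powr p \<le> \<alpha> * B / 4" using M by (simp add: field_simps)
  then have "rmax powr (\<alpha> * p) + M * \<epsilon> powr p < 1"
    using b1 \<alpha> AB mult_pos_pos[OF \<alpha>(1) AB(1)] by linarith
  then show ?thesis using \<alpha>(1) e2 e3 e4 by blast
qed

theorem conformal_dim_le_1: "conformal_dim (submetric euclidean_metric K) \<le> 1"
proof -
  have "conformal_dim (submetric euclidean_metric K) \<le> ennreal p" if p: "1 < p" for p
  proof -
    define N where "N = real (card I)"
    define v where "v s = (if s = None then N + 1 else 1)" for s :: "'i option"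
    have "0 < N" using finite_I I_ne by (simp add: N_def card_gt_0_iff)
    then have M: "0 < N * (N + 1)" by simp
    obtain \<alpha> \<epsilon> where \<alpha>: "0 < \<alpha>" and eps: "0 < \<epsilon>" "\<epsilon> \<le> 1" and pen: "1 - rmin powr \<alpha> \<le> \<epsilon> * rmin powr \<alpha>"
      and \<tau>: "rmax powr (\<alpha> * p) + N * (N + 1) * \<epsilon> powr p < 1"
      using parameters_exist[OF p M] by blast
    define \<tau> where "\<tau> = rmax powr (\<alpha> * p) + N * (N + 1) * \<epsilon> powr p"
    have \<tau>01: "0 \<le> \<tau>" "\<tau> < 1" using \<tau> M by (auto simp: \<tau>_def)
    have pen': "1 - r (corner a) powr \<alpha> \<le> \<epsilon> * rmin powr \<alpha>" if "a \<in> V" for a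
      using pen powr_mono2[OF less_imp_le[OF \<alpha>] less_imp_le[OF rmin_pos] rmin_le[OF corner_in[OF that]]] by linarith
    interpret W: gasket_weights K I f r V corner \<kappa> \<alpha> \<epsilon> "cut \<alpha>" 1 "(rmin / diamK) powr \<alpha>"
      by (rule gasket_weights_cut[OF \<alpha> eps pen'])
    show ?thesis
    proof (rule W.conformal_dim_le_weights)
      show "0 < p" using p by simp
      fix e :: real assume "0 < e"
      then obtain n where n: "\<tau> ^ n * v None \<le> e" using geometric_small[OF \<tau>01] by blast
      have "(\<Sum>w\<in>words n. \<rho> \<alpha> \<epsilon> None w powr p) \<le> \<tau> ^ n * v None"
      proof (rule sum_words_le[OF eps(1)])
        fix s show "1 \<le> v s" using \<open>0 < N\<close> by (simp add: v_def)
        assume "s \<in> insert None (Some ` corner ` V)"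
        then show "(\<Sum>i\<in>I. \<rho> \<alpha> \<epsilon> s [i] powr p * v (step s i)) \<le> \<tau> * v s"
          using letter_sum_le[OF \<alpha> eps, of p s] p unfolding \<tau>_def v_def N_def by simp
      qed (use \<tau>01 in auto)
      then show "\<exists>n. (\<Sum>w\<in>words n. \<rho> \<alpha> \<epsilon> None w powr p) \<le> e" using n by (meson order_trans)
    qed
  qed
  then have "conformal_dim (submetric euclidean_metric K) \<le> 1 + ennreal e" if "0 < e" for e
    using that by (metis ennreal_1 ennreal_plus less_add_same_cancel1 less_imp_le zero_le_one)
  then show ?thesis
    using ennreal_le_epsilon[of 1 "conformal_dim (submetric euclidean_metric K)"] by simp
qed

end


section \<open>Totally disconnected gaskets\<close>

context gasket_ifs
begin

lemma rw_replicate: "rw (replicate n i) = r i ^ n"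
  by (induction n) auto

lemma hh_1: "hh 1 s w = 1"
  by (induction w arbitrary: s) auto

text \<open>The component of \<open>a\<close> is a point, so by Sura-Bura it has arbitrarily small
  compact relatively open neighbourhoods; one is taken that avoids all other first-level cells. Its
  complement in \<open>K\<close> is closed, hence at positive distance.\<close>

lemma clopen_near_vertex:
  assumes td: "totally_disconnected K" and a: "a \<in> V"
  shows "\<exists>E \<delta>. a \<in> E \<and> 0 < \<delta> \<and> E \<subseteq> K \<and> (\<forall>j\<in>I. j \<noteq> corner a \<longrightarrow> E \<inter> f j ` K = {}) \<and> (\<forall>x\<in>E. \<forall>y\<in>K - E. \<delta> \<le> dist x y)"
proof -
  let ?U = "- (\<Union>j\<in>I - {corner a}. f j ` K)"
  have "closed (\<Union>j\<in>I - {corner a}. f j ` K)"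
    using finite_I compact_image_f compact_imp_closed by (intro closed_UN) auto
  then have U: "open ?U" by (rule open_Compl)
  have aU: "a \<in> ?U" using corner_unique[OF a] by auto
  obtain C where C: "C \<in> components K" "a \<in> C"
    using V_K[OF a] by (metis Union_components UnionE)
  then have Ca: "C = {a}" using td by (auto simp: totally_disconnected_def)
  obtain E where E: "openin (top_of_set K) E" "compact E" "C \<subseteq> E" "E \<subseteq> ?U"
    using Sura_Bura_clopen_subset[OF closed_imp_locally_compact[OF compact_imp_closed[OF compact_K]] C(1) _ U] Ca aU by auto
  have "closedin (top_of_set K) (K - E)" using E(1) by (simp add: closedin_diff)
  then have "closed (K - E)" using compact_K compact_imp_closed closedin_closed_trans by blast
  then obtain \<delta> where "0 < \<delta>" "\<forall>x\<in>E. \<forall>y\<in>K - E. \<delta> \<le> dist x y"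
    using separate_compact_closed[OF E(2), of "K - E"] by blast
  moreover have "E \<inter> f j ` K = {}" if "j \<in> I" "j \<noteq> corner a" for j using E(4) that by blast
  moreover have "a \<in> E" using E(3) Ca by blast
  ultimately show ?thesis
    using openin_imp_subset[OF E(1)] by (intro exI[of _ E] exI[of _ \<delta>] conjI ballI impI) auto
qed

text \<open>With \<open>\<epsilon> = 1\<close> the weights are plain powers
  \<open>rw w powr \<alpha>\<close>, and their sums decay once \<open>\<alpha>\<close> is so large
  that \<open>N * rmax powr (\<alpha> * p) < 1\<close>. The work lies in the cut functions for such
  \<open>\<alpha>\<close>; they have the form \<open>1 - S a\<close>.\<close>

lemma conformal_dim_tot_disc_le:
  assumes td: "totally_disconnected K" and p: "0 < p"
  shows "conformal_dim (submetric euclidean_metric K) \<le> ennreal p"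
proof -
  obtain E \<delta>' where E: "\<And>a. a \<in> V \<Longrightarrow> a \<in> E a \<and> 0 < \<delta>' a \<and> E a \<subseteq> K \<and>
      (\<forall>j\<in>I. j \<noteq> corner a \<longrightarrow> E a \<inter> f j ` K = {}) \<and> (\<forall>x\<in>E a. \<forall>y\<in>K - E a. \<delta>' a \<le> (dist x y :: real))"
    using clopen_near_vertex[OF td] by metis
  define \<delta> where "\<delta> = Min (insert 1 (\<delta>' ` V))"
  have \<delta>: "0 < \<delta>" "\<And>a. a \<in> V \<Longrightarrow> \<delta> \<le> \<delta>' a"
    using finite_V E by (auto simp: \<delta>_def)
  define N where "N = real (card I)"
  have N: "1 \<le> N" using finite_I I_ne by (simp add: N_def Suc_le_eq card_gt_0_iff)
  have r: "0 < rmax" "rmax < 1" using rmin_pos rmin_le_rmax rmax_less_1 by auto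
  have rp: "0 < rmax powr p" "rmax powr p < 1" using r p powr_less_mono2[of p rmax 1] by auto
  obtain m where m: "(rmax powr p) ^ m < 1 / (2 * N)"
    using real_arch_pow_inv[of "1 / (2 * N)" "rmax powr p"] rp N by auto
  define \<alpha> where "\<alpha> = real (Suc m)"
  have \<alpha>: "0 < \<alpha>" by (simp add: \<alpha>_def)
  define \<tau> where "\<tau> = N * rmax powr (\<alpha> * p)"
  have "rmax powr (\<alpha> * p) = (rmax powr p) ^ Suc m"
    using r by (simp add: \<alpha>_def powr_powr[symmetric] powr_realpow[symmetric] mult.commute del: power_Suc)
  also have "\<dots> \<le> (rmax powr p) ^ m" using rp by (simp add: mult_left_le_one_le)
  finally have "\<tau> \<le> N * (1 / (2 * N))" using m N unfolding \<tau>_def by (intro mult_left_mono) auto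
  then have \<tau>: "0 \<le> \<tau>" "\<tau> < 1" using N by (auto simp: \<tau>_def)
  define q where "q a = r (corner a) powr \<alpha>" for a
  have q: "0 < q a" "q a < 1" if "a \<in> V" for a
    using ratio_powr[OF \<alpha> corner_in[OF that]] by (auto simp: q_def)
  define \<psi>0 where "\<psi>0 a x = (if x \<in> E a then 0 else 1 :: real)" for a x
  \<comment> \<open>Each step adds a copy of the function in the corner cell, damped by
    \<open>q a\<close>, so that it vanishes at \<open>a\<close> and grows like a power of the
    distance. Outside the corner cell \<open>inv_into\<close> is arbitrary, but there
    \<open>\<psi>0 a x = 1\<close> wins the maximum.\<close>
  define \<psi> where "\<psi> = rec_nat \<psi>0 (\<lambda>n \<psi> a x. max (\<psi>0 a x) (q a * \<psi> a (inv_into K (f (corner a)) x)))"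
  have \<psi>_0: "\<psi> 0 a x = \<psi>0 a x" and \<psi>_Suc: "\<psi> (Suc n) a x = max (\<psi>0 a x) (q a * \<psi> n a (inv_into K (f (corner a)) x))" for n a x
    by (simp_all add: \<psi>_def)
  have \<psi>01: "0 \<le> \<psi> n a x \<and> \<psi> n a x \<le> 1" if "a \<in> V" for n a x
  proof (induction n arbitrary: x)
    case (Suc n)
    show ?case using Suc[of "inv_into K (f (corner a)) x"] q[OF that] 
      by (auto simp: \<psi>_Suc \<psi>0_def mult_le_one less_imp_le)
  qed (simp add: \<psi>_0 \<psi>0_def)
  have inv: "inv_into K (f (corner a)) (f (corner a) y) = y" if "a \<in> V" "y \<in> K" for a y
    using f_inj[OF corner_in[OF that(1)]] that by (intro inv_into_f_f inj_onI) auto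
  have own: "\<psi> (Suc n) a (f (corner a) y) = max (\<psi>0 a (f (corner a) y)) (q a * \<psi> n a y)" if "a \<in> V" "y \<in> K" for n a y
    using inv[OF that] by (simp add: \<psi>_Suc)
  have other: "\<psi> n a (f j y) = 1" if a: "a \<in> V" and j: "j \<in> I" "j \<noteq> corner a" and y: "y \<in> K" for n a j y
  proof -
    have "\<psi>0 a (f j y) = 1" using E[OF a] j y by (auto simp: \<psi>0_def)
    moreover have "\<psi>0 a (f j y) \<le> \<psi> n a (f j y)" by (cases n) (auto simp: \<psi>_0 \<psi>_Suc)
    ultimately show ?thesis using \<psi>01[OF a, of n "f j y"] by simp
  qed
  have vertex: "\<psi> n a b = (if a = b then 0 else 1)" if a: "a \<in> V" and b: "b \<in> V" for n a b
  proof (cases "a = b")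
    case True
    have "\<psi>0 a a = 0" using E[OF a] by (simp add: \<psi>0_def)
    then have "\<psi> n a a = 0"
    proof (induction n)
      case (Suc n)
      have "\<psi> (Suc n) a a = max (\<psi>0 a a) (q a * \<psi> n a a)"
        using own[OF a V_K[OF a], of n] corner_fix[OF a] by simp
      then show ?case using Suc by simp
    qed (simp add: \<psi>_0)
    then show ?thesis using True by simp
  next
    case False
    then have "corner b \<noteq> corner a" using corner_inj[OF a b] by auto
    from other[OF a corner_in[OF b] this V_K[OF b]] show ?thesis using False by (simp add: corner_fix[OF b])
  qed
  \<comment> \<open>The 1 covers the empty word, the other summand the cells that meet both
    \<open>E a\<close> and its complement: such a cell has diameter at least
    \<open>\<delta>\<close>.\<close>
  define C0 where "C0 = 1 + (diamK / \<delta>) powr \<alpha>"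
  have C0: "1 \<le> C0" by (simp add: C0_def)
  have osc0: "\<bar>\<psi>0 a (fw w x) - \<psi>0 a (fw w y)\<bar> \<le> C0 * rw w powr \<alpha>"
    if a: "a \<in> V" and w: "w \<in> lists I" and x: "x \<in> K" and y: "y \<in> K" for a w x y
  proof (cases "fw w x \<in> E a \<longleftrightarrow> fw w y \<in> E a")
    case True
    then show ?thesis using C0 by (simp add: \<psi>0_def)
  next
    case False
    have K: "fw w x \<in> K" "fw w y \<in> K" using w x y by auto
    have "\<delta>' a \<le> dist (fw w x) (fw w y)"
      using False E[OF a] K by (metis Diff_iff dist_commute)
    also have "\<dots> \<le> rw w * diamK"
      using dist_fw[OF w x y] diamK(2)[OF x y] rw_pos[OF w] by simp
    finally have "1 \<le> diamK / \<delta> * rw w" using \<delta>(1) \<delta>(2)[OF a] by (simp add: field_simps)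
    then have "1 \<le> (diamK / \<delta> * rw w) powr \<alpha>" using \<alpha> by (intro ge_one_powr_ge_zero) auto
    also have "\<dots> = (diamK / \<delta>) powr \<alpha> * rw w powr \<alpha>"
      by (rule powr_mult)
    also have "\<dots> \<le> C0 * rw w powr \<alpha>" by (intro mult_right_mono) (auto simp: C0_def)
    finally show ?thesis by (simp add: \<psi>0_def)
  qed
  have osc: "\<bar>\<psi> n a (fw w x) - \<psi> n a (fw w y)\<bar> \<le> C0 * rw w powr \<alpha>"
    if a: "a \<in> V" and w: "w \<in> lists I" and x: "x \<in> K" and y: "y \<in> K" for n a w x y
    using w
  proof (induction n arbitrary: w)
    case 0
    then show ?case using osc0[OF a _ x y] by (simp add: \<psi>_0)
  next
    case (Suc n)
    show ?case
    proof (cases w)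
      case Nil
      then show ?thesis using \<psi>01[OF a, of "Suc n" x] \<psi>01[OF a, of "Suc n" y] C0 by simp linarith
    next
      case (Cons j v)
      then have j: "j \<in> I" and v: "v \<in> lists I" using Suc.prems by auto
      have K: "fw v x \<in> K" "fw v y \<in> K" using v x y by auto
      show ?thesis
      proof (cases "j = corner a")
        case True
        have "\<bar>max A B - max A' B'\<bar> \<le> c" if "\<bar>A - A'\<bar> \<le> c" "\<bar>B - B'\<bar> \<le> c" for A A' B B' c :: real
          using that by (auto simp: max_def)
        moreover have "\<bar>q a * \<psi> n a (fw v x) - q a * \<psi> n a (fw v y)\<bar> \<le> C0 * rw w powr \<alpha>"
        proof -
          have "\<bar>q a * \<psi> n a (fw v x) - q a * \<psi> n a (fw v y)\<bar> = q a * \<bar>\<psi> n a (fw v x) - \<psi> n a (fw v y)\<bar>"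
            using q[OF a] by (simp add: abs_mult flip: right_diff_distrib)
          also have "\<dots> \<le> q a * (C0 * rw v powr \<alpha>)" using Suc.IH[OF v] q[OF a] by (intro mult_left_mono) auto
          also have "\<dots> = C0 * rw w powr \<alpha>"
            using Cons True r_pos[OF j] rw_pos[OF v] by (simp add: q_def powr_mult)
          finally show ?thesis .
        qed
        ultimately show ?thesis
          using osc0[OF a Suc.prems x y] own[OF a K(1), of n] own[OF a K(2), of n] Cons True by simp
      next
        case False
        then show ?thesis using other[OF a j False K(1)] other[OF a j False K(2)] Cons C0 by simp
      qed
    qed
  qed
  \<comment> \<open>Bounds that are uniform in \<open>n\<close> pass to the supremum.\<close>
  define S where "S a x = (SUP n. \<psi> n a x)" for a x
  have bdd: "bdd_above (range (\<lambda>n. \<psi> n a x))" if "a \<in> V" for a x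
    using \<psi>01[OF that] by (intro bdd_aboveI[of _ 1]) auto
  have S_ge: "\<psi> n a x \<le> S a x" if "a \<in> V" for n a x
    unfolding S_def by (rule cSUP_upper[OF _ bdd[OF that]]) simp
  have S_le: "S a x \<le> c" if "\<And>n. \<psi> n a x \<le> c" for a x c
    unfolding S_def using that by (intro cSUP_least) auto
  have S_vertex: "S a b = (if a = b then 0 else 1)" if "a \<in> V" "b \<in> V" for a b
    unfolding S_def vertex[OF that] by simp
  have S01: "0 \<le> S a x" "S a x \<le> 1" if "a \<in> V" for a x
    using order_trans[OF _ S_ge[OF that, of 0 x]] S_le[of a x 1] \<psi>01[OF that] by auto
  have S_osc: "\<bar>S a (fw w x) - S a (fw w y)\<bar> \<le> C0 * rw w powr \<alpha>"
    if a: "a \<in> V" and w: "w \<in> lists I" and x: "x \<in> K" and y: "y \<in> K" for a w x y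
  proof -
    have "S a (fw w x) \<le> S a (fw w y) + C0 * rw w powr \<alpha>" if x: "x \<in> K" and y: "y \<in> K" for x y
    proof (rule S_le)
      fix n show "\<psi> n a (fw w x) \<le> S a (fw w y) + C0 * rw w powr \<alpha>"
        using osc[OF a w x y, of n] S_ge[OF a, of n "fw w y"] by linarith
    qed
    from this[OF x y] this[OF y x] show ?thesis by linarith
  qed
  have S_sep: "(1 / diamK) powr \<alpha> * dist x a powr \<alpha> \<le> S a x" if a: "a \<in> V" and x: "x \<in> K" for a x
  proof (cases "x = a")
    case True
    then show ?thesis using S01(1)[OF a, of x] by simp
  next
    case False
    obtain n k x' where k: "k \<in> I" "x' \<in> K" "k \<noteq> corner a" "x = fw (replicate n (corner a)) (f k x')"
      using corner_word[OF a x False] by blast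
    let ?l = "corner a"
    have l: "?l \<in> I" by (rule corner_in[OF a])
    have fk: "f k x' \<in> K" using k by simp
    \<comment> \<open>Zooming \<open>n\<close> times carries the value 1 taken outside the corner
      cell to \<open>q a ^ n\<close>, which is comparable with the power of the distance as in
      \<open>cut_sep\<close>.\<close>
    have low: "q a ^ n * \<psi>0 a z \<le> \<psi> n a (fw (replicate n ?l) z)" if "z \<in> K" for z
      using that
    proof (induction n)
      case (Suc n)
      have "fw (replicate n ?l) z \<in> K" by (rule fw_in[OF corner_lists[OF a] Suc.prems])
      from own[OF a this, of n]
      have "q a * \<psi> n a (fw (replicate n ?l) z) \<le> \<psi> (Suc n) a (fw (replicate (Suc n) ?l) z)" by simp
      moreover have "q a * (q a ^ n * \<psi>0 a z) \<le> q a * \<psi> n a (fw (replicate n ?l) z)"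
        using Suc q[OF a] by (intro mult_left_mono) auto
      ultimately show ?case by (simp add: mult.assoc)
    qed (simp add: \<psi>_0)
    have "\<psi>0 a (f k x') = 1" using other[OF a k(1,3,2), of 0] by (simp add: \<psi>_0)
    then have 1: "q a ^ n \<le> S a x"
      using low[OF fk] S_ge[OF a, of n x] k(4) by simp
    have "dist x a = r ?l ^ n * dist (f k x') a"
      using dist_fw[OF corner_lists[OF a] fk V_K[OF a]] k(4) fw_corner[OF a] rw_replicate by metis
    also have "\<dots> \<le> r ?l ^ n * diamK"
      using diamK(2)[OF fk V_K[OF a]] r_pos[OF l] by (intro mult_left_mono) auto
    finally have "dist x a / diamK \<le> r ?l ^ n" using diamK(1) by (simp add: field_simps)
    then have "(dist x a / diamK) powr \<alpha> \<le> (r ?l ^ n) powr \<alpha>" using \<alpha> diamK(1) by (intro powr_mono2) auto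
    also have "\<dots> = q a ^ n"
      using r_pos[OF l] by (simp add: q_def powr_power powr_realpow[symmetric] powr_powr mult.commute)
    finally show ?thesis using 1 diamK(1) by (simp add: powr_divide)
  qed
  interpret W: gasket_weights K I f r V corner \<kappa> \<alpha> 1 "\<lambda>a x. 1 - S a x" C0 "(1 / diamK) powr \<alpha>"
  proof
    fix a w x y assume "a \<in> V" "w \<in> lists I" "x \<in> K" "y \<in> K"
    then show "\<bar>(1 - S a (fw w x)) - (1 - S a (fw w y))\<bar> \<le> C0 * \<rho> \<alpha> 1 None w"
      using S_osc[of a w x y] by (simp add: \<rho>_def hh_1 abs_minus_commute)
  qed (use \<alpha> C0 diamK(1) S_vertex S01 S_sep in auto)
  show ?thesis
  proof (rule W.conformal_dim_le_weights[OF p])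
    fix e :: real assume "0 < e"
    then obtain n where n: "\<tau> ^ n * 1 \<le> e" using geometric_small[OF \<tau>] by blast
    have "(\<Sum>w\<in>words n. \<rho> \<alpha> 1 None w powr p) \<le> \<tau> ^ n * (\<lambda>_. 1) (None :: 'i option)"
    proof (rule sum_words_le)
      fix s :: "'i option"
      have "(\<Sum>i\<in>I. \<rho> \<alpha> 1 s [i] powr p * 1) \<le> (\<Sum>i\<in>I. rmax powr (\<alpha> * p))"
        using r_pos rmax_ge \<alpha> p
        by (intro sum_mono) (auto simp: powr_powr intro!: powr_mono2 intro: less_imp_le)
      then show "(\<Sum>i\<in>I. \<rho> \<alpha> 1 s [i] powr p * 1) \<le> \<tau> * 1" by (simp add: \<tau>_def N_def)
    qed (use \<tau> in auto)
    then show "\<exists>n. (\<Sum>w\<in>words n. \<rho> \<alpha> 1 None w powr p) \<le> e" using n by (meson order_trans)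
  qed
qed

theorem conformal_dim_tot_disc:
  assumes "totally_disconnected K" shows "conformal_dim (submetric euclidean_metric K) = 0"
proof -
  have "conformal_dim (submetric euclidean_metric K) \<le> 0 + ennreal e" if "0 < e" for e
    using conformal_dim_tot_disc_le[OF assms that] by simp
  then show ?thesis
    using ennreal_le_epsilon[of 0 "conformal_dim (submetric euclidean_metric K)"] by simp
qed

end


section \<open>Connected sets have dimension at least 1\<close>

text \<open>The distance from \<open>x\<close> is 1-Lipschitz, and the image of \<open>C\<close>
  contains \<open>{0..mdist m x y}\<close>. A covering set of diameter \<open>d\<close> is mapped
  into an interval of length \<open>2 * d\<close> around the image of one of its points; hence the
  factor 2.\<close>

lemma hausdorff_premeasure_ge_connected:
  fixes m :: "'b metric"
  assumes C: "connectedin (mtopology_of m) C" and x: "x \<in> C" and y: "y \<in> C" and s: "0 \<le> s" "s < 1"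
  shows "ennreal (mdist m x y) \<le> 2 * hausdorff_premeasure m s 1 (mspace m)"
proof -
  interpret M: Metric_space "mspace m" "mdist m" by (rule Metric_space_mspace_mdist)
  have Cm: "C \<subseteq> mspace m" using C by (simp add: connectedin_def)
  define g where "g z = mdist m x z" for z
  have xm: "x \<in> mspace m" using x Cm by blast
  have lip: "\<bar>g u - g v\<bar> \<le> mdist m u v" if "u \<in> mspace m" "v \<in> mspace m" for u v
    using M.mdist_reverse_triangle[of u x v] that xm by (simp add: g_def mdist_commute)
  have "continuous_map (mtopology_of m) euclideanreal g"
    unfolding g_def using xm by (intro continuous_map_mdist) auto
  then have "connectedin euclideanreal (g ` C)"
    using C by (rule connectedin_continuous_map_image)
  then have con: "connected (g ` C)" by simp
  have sub: "{0..mdist m x y} \<subseteq> g ` C"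
    using connected_contains_Icc[OF con imageI[OF x] imageI[OF y]] xm by (simp add: g_def)
  have "ennreal (mdist m x y / 2) \<le> hausdorff_premeasure m s 1 (mspace m)"
    unfolding hausdorff_premeasure_def
  proof (rule INF_greatest)
    fix U :: "nat \<Rightarrow> 'b set"
    assume "U \<in> {U. (\<forall>i. U i \<subseteq> mspace m \<and> mdiam m (U i) \<le> ennreal 1) \<and> mspace m \<subseteq> (\<Union>i. U i)}"
    then have U: "\<And>i. U i \<subseteq> mspace m" "\<And>i. mdiam m (U i) \<le> 1" "mspace m \<subseteq> (\<Union>i. U i)" by auto
    define d where "d i = enn2real (mdiam m (U i))" for i
    have d: "mdiam m (U i) = ennreal (d i)" "0 \<le> d i" "d i \<le> 1" for i
    proof -
      have "mdiam m (U i) < top" using U(2)[of i] ennreal_one_less_top by (rule order.strict_trans1)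
      then show "mdiam m (U i) = ennreal (d i)" by (simp add: d_def)
      show "d i \<le> 1" using U(2)[of i] by (simp add: d_def enn2real_leI)
    qed (simp add: d_def)
    have dd: "mdist m u v \<le> d i" if "u \<in> U i" "v \<in> U i" for u v i
    proof -
      have "ennreal (mdist m u v) \<le> mdiam m (U i)"
        unfolding mdiam_def by (rule SUP_upper2[OF that(1)], rule SUP_upper[OF that(2)])
      then show ?thesis using d[of i] by (simp add: ennreal_le_iff)
    qed
    define c where "c i = (SOME u. u \<in> U i)" for i
    define W where "W i = (if U i = {} then {} else {g (c i) - d i .. g (c i) + d i})" for i
    have c: "c i \<in> U i" if "U i \<noteq> {}" for i using that unfolding c_def by (simp add: some_in_eq)
    have W_in: "g u \<in> W i" if "u \<in> U i" for u i
    proof -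
      have ne: "U i \<noteq> {}" using that by blast
      have "u \<in> mspace m" "c i \<in> mspace m" using U(1)[of i] c[OF ne] that by auto
      then have "\<bar>g u - g (c i)\<bar> \<le> d i" using lip[of u "c i"] dd[OF that c[OF ne]] by linarith
      then show ?thesis using ne by (simp add: W_def abs_le_iff)
    qed
    have cover: "{0..mdist m x y} \<subseteq> (\<Union>i. W i)"
    proof
      fix t assume "t \<in> {0..mdist m x y}"
      then obtain u where u: "u \<in> C" "t = g u" using sub by (meson imageE subsetD)
      then obtain i where "u \<in> U i" using Cm U(3) by (meson UN_E subsetD)
      then show "t \<in> (\<Union>i. W i)" using W_in u(2) by (intro UN_I[of i]) auto
    qed
    have W: "emeasure lborel (W i) \<le> 2 * hausdorff_gauge m s (U i)" for i
    proof (cases "U i = {}")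
      case False
      \<comment> \<open>The scale 1 of the premeasure enters here: \<open>d i \<le> 1\<close> and
        \<open>s < 1\<close> give \<open>d i \<le> d i powr s\<close>. The case distinction mirrors
        the convention of \<open>hausdorff_gauge\<close> for the exponent 0.\<close>
      have "d i \<le> (if s = 0 then 1 else d i powr s)"
      proof (cases "d i = 0")
        case False
        then have "d i powr 1 \<le> d i powr s" using d[of i] s by (intro powr_mono') auto
        then show ?thesis using d[of i] by simp
      qed simp
      then have "ennreal (d i) \<le> ennreal (if s = 0 then 1 else d i powr s)" by (rule ennreal_leI)
      also have "\<dots> = hausdorff_gauge m s (U i)"
        using False by (simp add: hausdorff_gauge_def d_def)
      finally have "2 * ennreal (d i) \<le> 2 * hausdorff_gauge m s (U i)" by (rule mult_left_mono) simp
      moreover have "emeasure lborel (W i) = 2 * ennreal (d i)"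
        using False d(2)[of i] by (simp add: W_def ennreal_mult')
      ultimately show ?thesis by simp
    qed (simp add: W_def)
    have "ennreal (mdist m x y) = emeasure lborel {0..mdist m x y}" by simp
    also have "\<dots> \<le> emeasure lborel (\<Union>i. W i)"
      using cover by (intro emeasure_mono) (auto simp: W_def)
    also have "\<dots> \<le> (\<Sum>i. emeasure lborel (W i))"
      by (intro emeasure_subadditive_countably) (auto simp: W_def)
    also have "\<dots> \<le> (\<Sum>i. 2 * hausdorff_gauge m s (U i))"
      by (intro suminf_le W) auto
    also have "\<dots> = 2 * (\<Sum>i. hausdorff_gauge m s (U i))" by simp
    finally have "ennreal (mdist m x y) \<le> 2 * (\<Sum>i. hausdorff_gauge m s (U i))" .
    then have "ennreal (mdist m x y) / 2 \<le> (\<Sum>i. hausdorff_gauge m s (U i))"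
      by (subst divide_le_posI_ennreal) (auto simp: mult.commute)
    then show "ennreal (mdist m x y / 2) \<le> (\<Sum>i. hausdorff_gauge m s (U i))"
      by (simp add: divide_ennreal[symmetric])
  qed
  then have "2 * ennreal (mdist m x y / 2) \<le> 2 * hausdorff_premeasure m s 1 (mspace m)"
    by (intro mult_left_mono) auto
  moreover have "2 * ennreal (mdist m x y / 2) = ennreal (2 * (mdist m x y / 2))"
    by (simp only: ennreal_mult' ennreal_numeral)
  ultimately show ?thesis by simp
qed

lemma hausdorff_dim_ge_1:
  fixes m :: "'b metric"
  assumes C: "connectedin (mtopology_of m) C" and x: "x \<in> C" and y: "y \<in> C" and ne: "x \<noteq> y"
  shows "1 \<le> hausdorff_dim m"
  unfolding hausdorff_dim_def
proof (rule INF_greatest)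
  fix s assume "s \<in> {s. 0 \<le> s \<and> hausdorff_measure m s (mspace m) = 0}"
  then have s: "0 \<le> s" "hausdorff_measure m s (mspace m) = 0" by auto
  have "1 \<le> s"
  proof (rule ccontr)
    assume "\<not> 1 \<le> s"
    then have "ennreal (mdist m x y) \<le> 2 * hausdorff_premeasure m s 1 (mspace m)"
      using hausdorff_premeasure_ge_connected[OF C x y s(1)] by simp
    also have "\<dots> \<le> 2 * hausdorff_measure m s (mspace m)"
      unfolding hausdorff_measure_def by (intro mult_left_mono SUP_upper) auto
    finally have "mdist m x y \<le> 0" using s(2) by simp
    moreover have "x \<in> mspace m" "y \<in> mspace m" using C x y by (auto simp: connectedin_def)
    ultimately show False
      using ne mdist_nonneg[of m x y] by (metis antisym mdist_zero)
  qed
  then show "1 \<le> ennreal s" by simp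
qed

lemma conformal_dim_ge_1:
  fixes S :: "'a::metric_space set"
  assumes C: "connected C" "C \<subseteq> S" and x: "x \<in> C" and y: "y \<in> C" and ne: "x \<noteq> y"
  shows "1 \<le> conformal_dim (submetric euclidean_metric S)"
  unfolding conformal_dim_def
proof (rule INF_greatest)
  fix m' :: "'a metric" assume "m' \<in> {m'. \<exists>h. quasisymmetric_map (submetric euclidean_metric S) m' h}"
  then obtain h where "homeomorphic_map (mtopology_of (submetric euclidean_metric S)) (mtopology_of m') h"
    by (auto simp: quasisymmetric_map_def)
  then have h: "homeomorphic_map (top_of_set S) (mtopology_of m') h" by (simp add: mtopology_of_submetric)
  then have "continuous_map (top_of_set S) (mtopology_of m') h"
    by (rule homeomorphic_imp_continuous_map)
  moreover have "connectedin (top_of_set S) C" using C by (simp add: connectedin_subtopology)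
  ultimately have "connectedin (mtopology_of m') (h ` C)" by (rule connectedin_continuous_map_image)
  moreover have "h x \<noteq> h y"
    using homeomorphic_imp_injective_map[OF h] x y ne C by (auto simp: inj_on_def)
  ultimately show "1 \<le> hausdorff_dim m'" using x y by (intro hausdorff_dim_ge_1[of m' "h ` C" "h x" "h y"]) auto
qed


section \<open>Fractal gaskets\<close>

lemma norm_vector_2_diff: "norm (vector [x, y] - vector [u, v] :: real^2) = sqrt ((x - u)\<^sup>2 + (y - v)\<^sup>2)"
  by (simp add: norm_vec_def L2_set_def sum_2)

lemma triangle_vertices_dist:
  assumes "a \<in> triangle_vertices" "b \<in> triangle_vertices"
  shows "norm (a - b) = (if a = b then 0 else 1)"
proof -
  have "norm (a - b) = 1" if "a \<noteq> b"
    using assms that unfolding triangle_vertices_def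
    by (elim insertE emptyE) (simp_all add: norm_vector_2_diff power_divide)
  then show ?thesis by simp
qed

text \<open>The law of cosines in a triangle with sides of length 1.\<close>

lemma triangle_vertices_inner:
  assumes "a \<in> triangle_vertices" "b \<in> triangle_vertices" "c \<in> triangle_vertices" "a \<noteq> b"
  shows "norm (c - a) / 2 \<le> (c - a) \<bullet> (b - a)"
proof -
  have "(c - a) \<bullet> (b - a) = ((norm (c - a))\<^sup>2 + (norm (b - a))\<^sup>2 - (norm (c - b))\<^sup>2) / 2"
    unfolding power2_norm_eq_inner by (simp add: algebra_simps inner_commute)
  then show ?thesis using assms by (simp add: triangle_vertices_dist)
qed

text \<open>From the vertex \<open>a\<close> the whole triangle is seen within 60 degrees of the
  direction of \<open>b\<close>. The inequality describes a convex set, so it suffices to check the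
  vertices.\<close>

lemma unit_triangle_cone:
  assumes "a \<in> triangle_vertices" "b \<in> triangle_vertices" "a \<noteq> b" "x \<in> unit_triangle"
  shows "norm (x - a) / 2 \<le> (x - a) \<bullet> (b - a)"
proof -
  let ?S = "{x. norm (x - a) / 2 \<le> (x - a) \<bullet> (b - a)}"
  have "convex ?S"
  proof (rule convexI)
    fix x y and u v :: real
    assume xy: "x \<in> ?S" "y \<in> ?S" and uv: "0 \<le> u" "0 \<le> v" "u + v = 1"
    have eq: "u *\<^sub>R x + v *\<^sub>R y - a = u *\<^sub>R (x - a) + v *\<^sub>R (y - a)"
    proof -
      have "u *\<^sub>R a + v *\<^sub>R a = a" using uv(3) by (simp flip: scaleR_add_left)
      then show ?thesis by (simp add: scaleR_diff_right add_diff_add [symmetric])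
    qed
    have "norm (u *\<^sub>R x + v *\<^sub>R y - a) / 2 \<le> u * (norm (x - a) / 2) + v * (norm (y - a) / 2)"
      unfolding eq using norm_triangle_ineq[of "u *\<^sub>R (x - a)" "v *\<^sub>R (y - a)"] uv by simp
    also have "\<dots> \<le> u * ((x - a) \<bullet> (b - a)) + v * ((y - a) \<bullet> (b - a))"
      using xy uv by (intro add_mono mult_left_mono) auto
    also have "\<dots> = (u *\<^sub>R x + v *\<^sub>R y - a) \<bullet> (b - a)"
      unfolding eq by (simp add: inner_add_left)
    finally show "u *\<^sub>R x + v *\<^sub>R y \<in> ?S" by simp
  qed
  moreover have "triangle_vertices \<subseteq> ?S" using triangle_vertices_inner assms by auto
  ultimately have "unit_triangle \<subseteq> ?S" unfolding unit_triangle_def by (rule hull_minimal[rotated])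
  then show ?thesis using assms by auto
qed

lemma other_vertex: "\<exists>b\<in>triangle_vertices. b \<noteq> a"
proof -
  have "vector [0, 0] \<noteq> (vector [1, 0] :: real^2)" by (metis vector_2(1) zero_neq_one)
  then show ?thesis unfolding triangle_vertices_def by auto
qed

lemma vertices_subset: "triangle_vertices \<subseteq> unit_triangle"
  unfolding unit_triangle_def by (rule hull_subset)

lemma compact_unit_triangle: "compact unit_triangle"
  unfolding unit_triangle_def triangle_vertices_def by (intro compact_convex_hull finite_imp_compact) auto

lemma convex_unit_triangle: "convex unit_triangle"
  by (simp add: unit_triangle_def)

section \<open>Homothetic copies of the triangle\<close>

lemma gasket_map_diff: "gasket_map r d x - gasket_map r d y = r *\<^sub>R (x - y)"
  by (simp add: gasket_map_def algebra_simps)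

lemma dist_gasket_map: "0 \<le> r \<Longrightarrow> dist (gasket_map r d x) (gasket_map r d y) = r * dist x y"
  by (simp add: dist_norm gasket_map_diff)

lemma convex_gasket_triangle: "convex (gasket_map r d ` unit_triangle)"
proof -
  have "gasket_map r d ` unit_triangle = (\<lambda>x. r *\<^sub>R d + x) ` ((\<lambda>x. r *\<^sub>R x) ` unit_triangle)"
    by (simp add: image_image gasket_map_def algebra_simps)
  then show ?thesis using convex_unit_triangle by (simp add: convex_translation convex_scaling)
qed

theorem fractal_gasket_ifs:
  assumes "fractal_gasket K"
  shows "\<exists>(I :: nat set) f r V corner \<kappa>. gasket_ifs K I f r V corner \<kappa>"
proof -
  obtain N :: nat and r :: "nat \<Rightarrow> real" and d :: "nat \<Rightarrow> real^2" where
    r: "\<forall>i\<in>{1..N}. 0 < r i \<and> r i < 1" and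
    att: "ifs_attractor {1..N} (\<lambda>i. gasket_map (r i) (d i)) K" and
    sub: "(\<Union>i\<in>{1..N}. gasket_map (r i) (d i) ` unit_triangle) \<subseteq> unit_triangle" and
    sep: "\<forall>i\<in>{1..N}. \<forall>j\<in>{1..N}. i \<noteq> j \<longrightarrow>
       gasket_map (r i) (d i) ` unit_triangle \<inter> gasket_map (r j) (d j) ` unit_triangle
       \<subseteq> gasket_map (r i) (d i) ` triangle_vertices \<inter> gasket_map (r j) (d j) ` triangle_vertices"
    using assms unfolding fractal_gasket_def by (elim exE conjE) (rule that)
  define I where "I = {1..N}"
  define f where "f i = gasket_map (r i) (d i)" for i
  let ?T = unit_triangle and ?V = triangle_vertices
  have K: "K \<noteq> {}" "compact K" "K = (\<Union>i\<in>I. f i ` K)"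
    using att by (auto simp: ifs_attractor_def I_def f_def)
  have r: "0 < r i" "r i < 1" if "i \<in> I" for i using r that by (auto simp: I_def)
  have fT: "f i x \<in> ?T" if "i \<in> I" "x \<in> ?T" for i x using sub that unfolding I_def f_def by blast
  have diff: "f i x - f i y = r i *\<^sub>R (x - y)" for i x y by (simp add: f_def gasket_map_diff)
  have dist_f: "dist (f i x) (f i y) = r i * dist x y" if "i \<in> I" for i x y
    using r[OF that] by (simp add: f_def dist_gasket_map)
  have inj: "x = y" if "i \<in> I" "f i x = f i y" for i x y
    using dist_f[OF that(1), of x y] r[OF that(1)] that(2) by simp
  have meet: "f i x \<in> f i ` ?V" if "i \<in> I" "j \<in> I" "i \<noteq> j" "x \<in> ?T" "y \<in> ?T" "f i x = f j y" for i j x y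
    using sep that unfolding I_def f_def by blast
  \<comment> \<open>A point of \<open>K\<close> at the largest distance from the triangle is the
    image of a point of \<open>K\<close>, and the maps contract this distance; so it is 0.\<close>
  have KT: "K \<subseteq> ?T"
  proof -
    have "?T \<noteq> {}" using vertices_subset other_vertex by blast
    have "continuous_on K (\<lambda>x. infdist x ?T)" by (intro continuous_on_infdist continuous_on_id)
    from continuous_attains_sup[OF K(2,1) this]
    obtain x where x: "x \<in> K" "\<And>y. y \<in> K \<Longrightarrow> infdist y ?T \<le> infdist x ?T"
      by blast
    obtain i y where i: "i \<in> I" "y \<in> K" "x = f i y" using x(1) K(3) by blast
    obtain t where t: "t \<in> ?T" "infdist y ?T = dist y t"
      using infdist_attains_inf[OF compact_imp_closed[OF compact_unit_triangle] \<open>?T \<noteq> {}\<close>] by blast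
    have "infdist x ?T \<le> dist x (f i t)" using fT[OF i(1) t(1)] by (rule infdist_le)
    also have "\<dots> = r i * infdist y ?T" using i t dist_f by simp
    also have "\<dots> \<le> r i * infdist x ?T" using x(2)[OF i(2)] r[OF i(1)] by (intro mult_left_mono) auto
    finally have "infdist x ?T = 0"
      using r[OF i(1)] infdist_nonneg[of x ?T] by (smt (verit) mult_less_cancel_right2)
    then have "infdist y ?T = 0" if "y \<in> K" for y
      using x(2)[OF that] infdist_nonneg[of y ?T] by simp
    then show ?thesis
      using in_closed_iff_infdist_zero[OF compact_imp_closed[OF compact_unit_triangle] \<open>?T \<noteq> {}\<close>] by blast
  qed
  have overlap: "x \<in> ?V" if "i \<in> I" "j \<in> I" "i \<noteq> j" "x \<in> ?T" "y \<in> ?T" "f i x = f j y" for i j x y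
  proof -
    have "f i x \<in> f i ` ?V" by (rule meet[OF that])
    then obtain v where "v \<in> ?V" "f i x = f i v" by (rule imageE)
    then show ?thesis using inj[OF that(1), of x v] by simp
  qed
  \<comment> \<open>The intersection of two small triangles is convex and consists of finitely many
    vertices, so it has at most one point.\<close>
  have unique: "p = q" if ij: "i \<in> I" "j \<in> I" "i \<noteq> j" and
    p: "p \<in> f i ` ?T" "p \<in> f j ` ?T" and q: "q \<in> f i ` ?T" "q \<in> f j ` ?T" for i j p q
  proof (rule ccontr)
    assume "p \<noteq> q"
    have "convex (f i ` ?T \<inter> f j ` ?T)"
      unfolding f_def by (intro convex_Int convex_gasket_triangle)
    then have "closed_segment p q \<subseteq> f i ` ?T \<inter> f j ` ?T"
      using p q by (intro closed_segment_subset) auto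
    also have "\<dots> \<subseteq> f i ` ?V" using sep ij unfolding I_def f_def by blast
    finally have "finite (closed_segment p q)"
      by (rule finite_subset) (simp add: triangle_vertices_def)
    then show False using uncountable_closed_segment[OF \<open>p \<noteq> q\<close>] by (simp add: countable_finite)
  qed
  \<comment> \<open>All small triangles have the same orientation. If two shared corresponding
    vertices, both would contain the initial piece of length \<open>m\<close> of the side towards
    \<open>b\<close>, contradicting \<open>unique\<close>.\<close>
  have no_same: False if ij: "i \<in> I" "j \<in> I" "i \<noteq> j" and a: "a \<in> ?V" and eq: "f i a = f j a" for i j a
  proof -
    obtain b where b: "b \<in> ?V" "b \<noteq> a" using other_vertex by blast
    have aT: "a \<in> ?T" "b \<in> ?T" using a b vertices_subset by auto
    define m where "m = min (r i) (r j)"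
    have m: "0 < m" using r ij by (simp add: m_def)
    have in_img: "f k a + m *\<^sub>R (b - a) \<in> f k ` ?T" if k: "k \<in> I" "m \<le> r k" for k
    proof
      have "a + (m / r k) *\<^sub>R (b - a) = (1 - m / r k) *\<^sub>R a + (m / r k) *\<^sub>R b"
        by (simp add: algebra_simps)
      then show "a + (m / r k) *\<^sub>R (b - a) \<in> ?T"
        using convexD_alt[OF convex_unit_triangle aT, of "m / r k"] r[OF k(1)] k(2) m by simp
      have "f k (a + (m / r k) *\<^sub>R (b - a)) - f k a = m *\<^sub>R (b - a)"
        unfolding diff using r[OF k(1)] by simp
      then show "f k a + m *\<^sub>R (b - a) = f k (a + (m / r k) *\<^sub>R (b - a))" by (simp add: algebra_simps)
    qed
    have "f i a + m *\<^sub>R (b - a) \<in> f i ` ?T" using in_img[OF ij(1)] by (simp add: m_def)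
    moreover have "f i a + m *\<^sub>R (b - a) \<in> f j ` ?T" using in_img[OF ij(2)] eq by (simp add: m_def)
    moreover have "f i a \<in> f i ` ?T" "f i a \<in> f j ` ?T"
      using imageI[OF aT(1), of "f i"] imageI[OF aT(1), of "f j"] eq by simp_all
    ultimately have "f i a = f i a + m *\<^sub>R (b - a)" using unique[OF ij] by blast
    then show False using m b by simp
  qed
  \<comment> \<open>If \<open>a = f i t\<close>, then \<open>f i a - a\<close> and
    \<open>t - a\<close> have opposite directions, but both \<open>f i a\<close> and
    \<open>t\<close> lie in the cone of the triangle at \<open>a\<close>. This forces
    \<open>t = a\<close>.\<close>
  have fixed: "f i a = a" if i: "i \<in> I" and a: "a \<in> ?V" "a \<in> f i ` ?T" for i a
  proof -
    obtain t where t: "t \<in> ?T" "a = f i t" using a by blast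
    obtain b where b: "b \<in> ?V" "b \<noteq> a" using other_vertex by blast
    have "norm (f i a - a) / 2 \<le> (f i a - a) \<bullet> (b - a)"
      using unit_triangle_cone[OF a(1) b(1)] b fT[OF i] a vertices_subset by blast
    moreover have "f i a - a = r i *\<^sub>R (a - t)" using diff[of i a t] t by simp
    ultimately have "norm (a - t) / 2 \<le> (a - t) \<bullet> (b - a)"
      using r[OF i] by (simp add: mult_le_cancel_left_pos flip: times_divide_eq_right)
    moreover have "norm (t - a) / 2 \<le> (t - a) \<bullet> (b - a)"
      using unit_triangle_cone[OF a(1) b(1) _ t(1)] b by simp
    moreover have "(a - t) \<bullet> (b - a) = - ((t - a) \<bullet> (b - a))" by (simp add: inner_diff_left)
    ultimately have "norm (t - a) \<le> 0" using norm_minus_commute[of t a] by linarith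
    then show ?thesis using t by simp
  qed
  define corner where "corner a = (SOME i. i \<in> I \<and> a \<in> f i ` K)" for a
  have corner: "corner a \<in> I" "a \<in> f (corner a) ` K" if "a \<in> K" for a
  proof -
    have "\<exists>i. i \<in> I \<and> a \<in> f i ` K" using that K(3) by blast
    from someI_ex[OF this] show "corner a \<in> I" "a \<in> f (corner a) ` K" by (simp_all add: corner_def)
  qed
  have imT: "f i ` K \<subseteq> f i ` ?T" for i using KT by blast
  \<comment> \<open>Contact points are images of points of \<open>K\<close>, so the vertices lying
    in \<open>K\<close> suffice. The constant 1/2 is the cosine of 60 degrees from
    \<open>unit_triangle_cone\<close>.\<close>
  have "gasket_ifs K I f r (?V \<inter> K) corner (1/2)"
  proof
    show "finite I" by (simp add: I_def)
    show "K \<noteq> {}" "compact K" "K = (\<Union>i\<in>I. f i ` K)" by (rule K)+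
    show "finite (?V \<inter> K)" by (simp add: triangle_vertices_def)
    show "0 < r i" "r i < 1" if "i \<in> I" for i using r[OF that] by auto
    show "dist (f i x) (f i y) = r i * dist x y" if "i \<in> I" for i x y by (rule dist_f[OF that])
    show "corner a \<in> I" if "a \<in> ?V \<inter> K" for a using corner that by blast
    show cf: "f (corner a) a = a" if "a \<in> ?V \<inter> K" for a
      using fixed[OF corner(1)] corner(2) imT that by blast
    \<comment> \<open>Both \<open>f j\<close> and \<open>f (corner a)\<close> fix \<open>a\<close>,
      which \<open>no_same\<close> forbids for different letters.\<close>
    show "j = corner a" if "a \<in> ?V \<inter> K" "j \<in> I" "a \<in> f j ` K" for a j
      using no_same[OF that(2) corner(1), of a a] fixed[OF that(2), of a] cf[OF that(1)] imT that by auto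
    show "x \<in> ?V \<inter> K" if "i \<in> I" "j \<in> I" "i \<noteq> j" "x \<in> K" "y \<in> K" "f i x = f j y" for i j x y
      using overlap[OF that(1-3), of x y] that KT by auto
    show "x = x'" if "i \<in> I" "j \<in> I" "i \<noteq> j" "x \<in> K" "y \<in> K" "f i x = f j y" "x' \<in> K" "y' \<in> K" "f i x' = f j y'" for i j x y x' y'
    proof -
      have "x \<in> ?T" "y \<in> ?T" "x' \<in> ?T" "y' \<in> ?T" using that KT by auto
      then have "f i x \<in> f i ` ?T" "f i x' \<in> f i ` ?T" "f j y \<in> f j ` ?T" "f j y' \<in> f j ` ?T" by auto
      then have "f i x \<in> f i ` ?T" "f i x' \<in> f i ` ?T" "f i x \<in> f j ` ?T" "f i x' \<in> f j ` ?T"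
        using that by simp_all
      then have "f i x = f i x'" using unique[OF that(1-3)] by blast
      then show ?thesis by (rule inj[OF that(1)])
    qed
    show "1 / 2 * dist (f i x) (f i a) \<le> dist (f i x) (f j y)"
      if ij: "i \<in> I" "j \<in> I" "i \<noteq> j" and ab: "a \<in> K" "b \<in> K" "f i a = f j b" and x: "x \<in> K" and y: "y \<in> K" for i j a b x y
    proof -
      have T: "a \<in> ?T" "b \<in> ?T" "x \<in> ?T" "y \<in> ?T" using ab x y KT by auto
      have V: "a \<in> ?V" "b \<in> ?V"
        using overlap[OF ij T(1,2) ab(3)] overlap[OF ij(2,1) ij(3)[symmetric] T(2,1) ab(3)[symmetric]] by auto
      have ne: "a \<noteq> b" using no_same[OF ij V(1)] ab(3) by blast
      \<comment> \<open>Projection onto the unit vector \<open>b - a\<close>: seen from the contact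
        point, the cell \<open>i\<close> lies within 60 degrees of this direction, and the cell
        \<open>j\<close> within 60 degrees of the opposite one.\<close>
      have "norm (f i x - f i a) / 2 \<le> (f i x - f i a) \<bullet> (b - a)"
        unfolding diff using unit_triangle_cone[OF V ne T(3)] r[OF ij(1)]
        by (simp add: mult_left_mono flip: times_divide_eq_right)
      moreover have "norm (f j y - f j b) / 2 \<le> (f j y - f j b) \<bullet> (a - b)"
        unfolding diff using unit_triangle_cone[OF V(2,1) ne[symmetric] T(4)] r[OF ij(2)]
        by (simp add: mult_left_mono flip: times_divide_eq_right)
      then have "0 \<le> (f j y - f j b) \<bullet> (a - b)" using norm_ge_zero[of "f j y - f j b"] by linarith
      moreover have "(f i x - f j y) \<bullet> (b - a) = (f i x - f i a) \<bullet> (b - a) + (f j y - f j b) \<bullet> (a - b)"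
        using ab(3) by (simp add: algebra_simps)
      moreover have "(f i x - f j y) \<bullet> (b - a) \<le> norm (f i x - f j y) * norm (b - a)"
        by (rule norm_cauchy_schwarz)
      moreover have "norm (b - a) = 1" using triangle_vertices_dist[OF V(2,1)] ne by simp
      ultimately show ?thesis by (simp add: dist_norm)
    qed
  qed simp_all
  then show ?thesis by blast
qed

theorem theorem1p4:
  fixes K :: "(real^2) set"
  assumes "fractal_gasket K"
  shows "(totally_disconnected K \<longrightarrow> conformal_dim (submetric euclidean_metric K) = 0) \<and>
         ((\<exists>C\<in>components K. \<exists>x\<in>C. \<exists>y\<in>C. x \<noteq> y) \<longrightarrow>
            conformal_dim (submetric euclidean_metric K) = 1)"
proof -
  obtain I :: "nat set" and f r V corner \<kappa> where "gasket_ifs K I f r V corner \<kappa>"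
    using fractal_gasket_ifs[OF assms] by blast
  then interpret gasket_ifs K I f r V corner \<kappa> .
  have "1 \<le> conformal_dim (submetric euclidean_metric K)"
    if "C \<in> components K" "x \<in> C" "y \<in> C" "x \<noteq> y" for C x y
    using conformal_dim_ge_1[of C K x y] in_components_connected[OF that(1)] in_components_subset[OF that(1)] that by blast
  then show ?thesis
    using conformal_dim_tot_disc conformal_dim_le_1 by (blast intro: antisym)
qed

end
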